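(* At least one of the following holds: (A) $\mathcal K'=\hat{\mathcal K}\oplus\mathbb C\overline\ell\subseteq\mathcal H$ is a Lie algebra of rank $1$, i.e., the dimension of any maximal torus in $\mathcal K'$ is $1$; (B) there is a nonzero semisimple element $\mathfrak k\in\mathcal K$ and a (unipotent) element $u\in U(\lambda)$ such that the conjugate $\mathfrak k^u=u\mathfrak ku^{-1}$ lies in $\mathcal H$.
   Context: Let $X$ be a finite dimensional complex vector space and $G\subseteq GL(X)$ a reductive algebraic group over $\mathbb C$ containing the center $\{tI \mid t\in\mathbb C^*\}$ of $GL(X)$. Let $V$ be a finite dimensional rational $G$-module on which $tI$ acts as multiplication by $t^c$, for a fixed integer $c\neq 0$. Let $\mathcal G=Lie(G)\subseteq gl(X)$, acting on $V$ through the differentiated action. Let $\lambda:\mathbb C^*\to G$ be a one-parameter subgroup. It gives gradings $V=\oplus_i V_i$ with $\lambda(t)v_i=t^iv_i$, and $\mathcal G=\oplus_j\mathcal G_j$ with $\lambda(t)\mathfrak g_j\lambda(t)^{-1}=t^j\mathfrak g_j$. For a nonzero vector in $V$ or element of $\mathcal G$, its leading term (denoted by a hat) is its nonzero homogeneous component of smallest degree. Let $y\in V$ satisfy $\lambda(t)y=t^dz+t^ey_e+\cdots+t^Dy_D$ with $d<e<\cdots<D$ and $z,y_e\ne 0$. Let $\mathcal K$ and $\mathcal H$ be the stabilizers in $\mathcal G$ of $y$ and $z$ (elements sending the vector to $0$), and let $\hat{\mathcal K}$ be the span of $\{\hat{\mathfrak k}\mid 0\neq\mathfrak k\in\mathcal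 K\}$; it is a graded Lie subalgebra of $\mathcal H$. Let $\overline\ell\in\mathcal G$ be the semisimple element with $t^{\overline\ell}=\lambda'(t)$, where $\lambda'(t)=t^a\lambda(t)$ is the (possibly fractional-exponent) multiple of $\lambda$ by a central element for which $\lambda'(t)y=z+t^{e-d}y_e+\cdots+t^{D-d}y_D$; thus $\overline\ell v_i=(i-d)v_i$ for $v_i\in V_i$, and $\overline\ell\in\mathcal H$. $P(\lambda)=\{g\in G\mid\lim_{t\to0}\lambda(t)g\lambda(t)^{-1}\text{ exists}\}$ and $U(\lambda)$ is its unipotent radical. "Semisimple" means diagonalizable as an element of $gl(X)$; a torus in a Lie subalgebra of $gl(X)$ is an abelian subalgebra consisting of semisimple elements. *)

theory Defs
  imports "HOL-Analysis.Analysis"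
begin

section \<open>Complex matrices as a vector space and a Lie algebra\<close>

text \<open>The type \<open>complex ^ 'n ^ 'n\<close> plays the role of gl(X) for X = \<open>complex ^ 'n\<close>. The library's scalar
  multiplication \<open>*s\<close> acts on vectors over the field only, so matrices get their own complex scaling.\<close>

definition cscale :: "complex \<Rightarrow> complex ^ 'n ^ 'n \<Rightarrow> complex ^ 'n ^ 'n" where
  "cscale c A = (\<chi> i j. c * A $ i $ j)"

global_interpretation cmat: vector_space "cscale :: complex \<Rightarrow> complex ^ 'n ^ 'n \<Rightarrow> _"
  by unfold_locales (simp_all add: cscale_def vec_eq_iff algebra_simps)

definition bracket :: "complex ^ 'n ^ 'n \<Rightarrow> complex ^ 'n ^ 'n \<Rightarrow> complex ^ 'n ^ 'n" where
  "bracket A B = A ** B - B ** A"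

definition lie_subalgebra :: "(complex ^ 'n ^ 'n) set \<Rightarrow> bool" where
  "lie_subalgebra L \<longleftrightarrow> cmat.subspace L \<and> (\<forall>A\<in>L. \<forall>B\<in>L. bracket A B \<in> L)"

definition diag :: "('n \<Rightarrow> complex) \<Rightarrow> complex ^ 'n ^ 'n" where
  "diag m = (\<chi> i j. if i = j then m i else 0)"

definition semisimple :: "complex ^ 'n ^ 'n \<Rightarrow> bool" where
  "semisimple A \<longleftrightarrow> (\<exists>(P :: complex ^ 'n ^ 'n) m. invertible P \<and> A = P ** diag m ** matrix_inv P)"

definition torus_in :: "(complex ^ 'n ^ 'n) set \<Rightarrow> (complex ^ 'n ^ 'n) set \<Rightarrow> bool" where
  "torus_in L T \<longleftrightarrow> T \<subseteq> L \<and> lie_subalgebra T \<and> (\<forall>A\<in>T. \<forall>B\<in>T. bracket A B = 0)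
     \<and> (\<forall>A\<in>T. semisimple A)"

definition maximal_torus_in :: "(complex ^ 'n ^ 'n) set \<Rightarrow> (complex ^ 'n ^ 'n) set \<Rightarrow> bool" where
  "maximal_torus_in L T \<longleftrightarrow> torus_in L T \<and> (\<forall>T'. torus_in L T' \<and> T \<subseteq> T' \<longrightarrow> T' = T)"

definition has_rank :: "(complex ^ 'n ^ 'n) set \<Rightarrow> nat \<Rightarrow> bool" where
  "has_rank L r \<longleftrightarrow> (\<forall>T. maximal_torus_in L T \<longrightarrow> cmat.dim T = r)"

section \<open>Linear algebraic groups\<close>

text \<open>Polynomials in the matrix entries, as functions.\<close>

inductive poly_fun :: "(complex ^ 'n ^ 'n \<Rightarrow> complex) \<Rightarrow> bool" where
  const: "poly_fun (\<lambda>_. c)"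
| entry: "poly_fun (\<lambda>A. A $ i $ j)"
| add: "poly_fun f \<Longrightarrow> poly_fun g \<Longrightarrow> poly_fun (\<lambda>A. f A + g A)"
| mult: "poly_fun f \<Longrightarrow> poly_fun g \<Longrightarrow> poly_fun (\<lambda>A. f A * g A)"

text \<open>The Zariski topology on GL(X). Polynomials in the entries and in 1/det have the same zero sets
  in GL(X) as polynomials in the entries alone.\<close>

definition zariski :: "(complex ^ 'n ^ 'n) topology" where
  "zariski = topology (\<lambda>U. \<exists>F. (\<forall>f\<in>F. poly_fun f) \<and> U = {g. invertible g \<and> (\<exists>f\<in>F. f g \<noteq> 0)})"

lemma openin_zariski:
  fixes U :: "(complex ^ 'n ^ 'n) set"
  shows "openin zariski U \<longleftrightarrow> (\<exists>F. (\<forall>f\<in>F. poly_fun f) \<and> U = {g. invertible g \<and> (\<exists>f\<in>F. f g \<noteq> 0)})"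
proof -
  let ?P = "\<lambda>U :: (complex ^ 'n ^ 'n) set.
      \<exists>F. (\<forall>f\<in>F. poly_fun f) \<and> U = {g. invertible g \<and> (\<exists>f\<in>F. f g \<noteq> 0)}"
  have "istopology ?P"
    unfolding istopology_def
  proof (intro conjI allI impI)
    fix S T assume "?P S" "?P T"
    then obtain F F' where F: "\<forall>f\<in>F. poly_fun f" "S = {g. invertible g \<and> (\<exists>f\<in>F. f g \<noteq> 0)}"
      and F': "\<forall>f\<in>F'. poly_fun f" "T = {g. invertible g \<and> (\<exists>f\<in>F'. f g \<noteq> 0)}"
      by blast
    let ?Q = "{\<lambda>A. f A * f' A | f f'. f \<in> F \<and> f' \<in> F'}"
    have "\<forall>q\<in>?Q. poly_fun q"
      using F(1) F'(1) by (auto intro: poly_fun.mult)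
    moreover have "S \<inter> T = {g. invertible g \<and> (\<exists>q\<in>?Q. q g \<noteq> 0)}"
    proof (intro set_eqI iffI)
      fix g assume "g \<in> S \<inter> T"
      then obtain f f' where "f \<in> F" "f' \<in> F'" "f g \<noteq> 0" "f' g \<noteq> 0" "invertible g"
        using F(2) F'(2) by blast
      then show "g \<in> {g. invertible g \<and> (\<exists>q\<in>?Q. q g \<noteq> 0)}"
        by (intro CollectI conjI bexI[of _ "\<lambda>A. f A * f' A"]) auto
    next
      fix g assume "g \<in> {g. invertible g \<and> (\<exists>q\<in>?Q. q g \<noteq> 0)}"
      then show "g \<in> S \<inter> T"
        using F(2) F'(2) by auto
    qed
    ultimately show "?P (S \<inter> T)" by (intro exI[of _ ?Q] conjI)
  next
    fix K assume "\<forall>S\<in>K. ?P S"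
    from bchoice[OF this] obtain \<F> where
      "\<forall>S\<in>K. (\<forall>f\<in>\<F> S. poly_fun f) \<and> S = {g. invertible g \<and> (\<exists>f\<in>\<F> S. f g \<noteq> 0)}" ..
    then have \<F>: "\<forall>S\<in>K. \<forall>f\<in>\<F> S. poly_fun f"
      and \<F>2: "\<forall>S\<in>K. S = {g. invertible g \<and> (\<exists>f\<in>\<F> S. f g \<noteq> 0)}"
      unfolding ball_conj_distrib by (rule conjunct1, rule conjunct2)
    have "\<forall>f\<in>\<Union>(\<F> ` K). poly_fun f"
      using \<F> by blast
    moreover have "\<Union>K = {g. invertible g \<and> (\<exists>f\<in>\<Union>(\<F> ` K). f g \<noteq> 0)}"
    proof (rule set_eqI)
      fix g
      have mem: "g \<in> S \<longleftrightarrow> invertible g \<and> (\<exists>f\<in>\<F> S. f g \<noteq> 0)" if "S \<in> K" for S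
        using bspec[OF \<F>2 that] by blast
      have "g \<in> \<Union>K \<longleftrightarrow> (\<exists>S\<in>K. g \<in> S)" by simp
      also have "\<dots> \<longleftrightarrow> (\<exists>S\<in>K. invertible g \<and> (\<exists>f\<in>\<F> S. f g \<noteq> 0))"
        using mem by (rule bex_cong[OF refl])
      finally show "g \<in> \<Union>K \<longleftrightarrow> g \<in> {g. invertible g \<and> (\<exists>f\<in>\<Union>(\<F> ` K). f g \<noteq> 0)}"
        by auto
    qed
    ultimately show "?P (\<Union>K)" by (intro exI[of _ "\<Union>(\<F> ` K)"] conjI)
  qed
  then show ?thesis
    unfolding zariski_def by (simp add: topology_inverse')
qed

lemma topspace_zariski: "topspace zariski = {g :: complex ^ 'n ^ 'n. invertible g}"
proof -
  have "openin zariski {g :: complex ^ 'n ^ 'n. invertible g}"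
    unfolding openin_zariski by (rule exI[of _ "{\<lambda>_. 1}"]) (auto intro: poly_fun.const)
  moreover have "topspace zariski \<subseteq> {g :: complex ^ 'n ^ 'n. invertible g}"
    using openin_topspace[of zariski] unfolding openin_zariski by blast
  ultimately show ?thesis
    using openin_subset by blast
qed

lemma closedin_zariski:
  fixes S :: "(complex ^ 'n ^ 'n) set"
  shows "closedin zariski S \<longleftrightarrow> (\<exists>F. (\<forall>f\<in>F. poly_fun f) \<and> S = {g. invertible g \<and> (\<forall>f\<in>F. f g = 0)})"
proof -
  have "closedin zariski S \<longleftrightarrow> S \<subseteq> {g. invertible g} \<and>
      (\<exists>F. (\<forall>f\<in>F. poly_fun f) \<and> {g. invertible g} - S = {g. invertible g \<and> (\<exists>f\<in>F. f g \<noteq> 0)})"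
    by (simp add: closedin_def openin_zariski topspace_zariski)
  also have "\<dots> \<longleftrightarrow> (\<exists>F. (\<forall>f\<in>F. poly_fun f) \<and> S = {g. invertible g \<and> (\<forall>f\<in>F. f g = 0)})"
    (is "?L \<longleftrightarrow> ?R")
  proof
    assume ?L
    then obtain F where "S \<subseteq> {g. invertible g}" and F: "\<forall>f\<in>F. poly_fun f"
      and "{g. invertible g} - S = {g. invertible g \<and> (\<exists>f\<in>F. f g \<noteq> 0)}"
      by blast
    then have "S = {g. invertible g \<and> (\<forall>f\<in>F. f g = 0)}" by blast
    with F show ?R by blast
  next
    assume ?R
    then obtain F where F: "\<forall>f\<in>F. poly_fun f" and "S = {g. invertible g \<and> (\<forall>f\<in>F. f g = 0)}"
      by blast
    then have "S \<subseteq> {g. invertible g}"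
      and "{g. invertible g} - S = {g. invertible g \<and> (\<exists>f\<in>F. f g \<noteq> 0)}"
      by blast+
    with F show ?L by blast
  qed
  finally show ?thesis .
qed

definition alg_group :: "(complex ^ 'n ^ 'n) set \<Rightarrow> bool" where
  "alg_group G \<longleftrightarrow> closedin zariski G \<and> mat 1 \<in> G \<and> (\<forall>g\<in>G. \<forall>h\<in>G. g ** h \<in> G)
     \<and> (\<forall>g\<in>G. matrix_inv g \<in> G)"

definition unipotent :: "complex ^ 'n ^ 'n \<Rightarrow> bool" where
  "unipotent g \<longleftrightarrow> (\<exists>k. (((**) (g - mat 1)) ^^ k) (mat 1) = 0)"

text \<open>The unipotent radical is the largest connected normal unipotent closed subgroup, hence the union
  of all of them.\<close>

definition unipotent_radical :: "(complex ^ 'n ^ 'n) set \<Rightarrow> (complex ^ 'n ^ 'n) set" where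
  "unipotent_radical G = \<Union>{N. N \<subseteq> G \<and> alg_group N \<and> connectedin zariski N
     \<and> (\<forall>g\<in>G. \<forall>n\<in>N. g ** n ** matrix_inv g \<in> N) \<and> (\<forall>n\<in>N. unipotent n)}"

definition reductive :: "(complex ^ 'n ^ 'n) set \<Rightarrow> bool" where
  "reductive G \<longleftrightarrow> alg_group G \<and> unipotent_radical G = {mat 1}"

text \<open>The Lie algebra is the Zariski tangent space at the identity.\<close>

definition lie_alg :: "(complex ^ 'n ^ 'n) set \<Rightarrow> (complex ^ 'n ^ 'n) set" where
  "lie_alg G = {A. \<forall>f. poly_fun f \<and> (\<forall>g\<in>G. f g = 0) \<longrightarrow>
     ((\<lambda>t. f (mat 1 + cscale t A)) has_field_derivative 0) (at 0)}"

section \<open>Rational modules and their differentials\<close>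

definition regular_fun :: "(complex ^ 'n ^ 'n \<Rightarrow> complex) \<Rightarrow> bool" where
  "regular_fun f \<longleftrightarrow> (\<exists>p k. poly_fun p \<and> (\<forall>g. invertible g \<longrightarrow> f g = p g / det g ^ k))"

definition rational_module ::
    "(complex ^ 'n ^ 'n) set \<Rightarrow> (complex ^ 'n ^ 'n \<Rightarrow> complex ^ 'm ^ 'm) \<Rightarrow> bool" where
  "rational_module G \<rho> \<longleftrightarrow> \<rho> (mat 1) = mat 1 \<and> (\<forall>g\<in>G. \<forall>h\<in>G. \<rho> (g ** h) = \<rho> g ** \<rho> h)
     \<and> (\<forall>i j. \<exists>f. regular_fun f \<and> (\<forall>g\<in>G. \<rho> g $ i $ j = f g))"

text \<open>The differential of \<open>\<rho>\<close> at the identity. The values of \<open>\<rho>\<close> outside \<open>G\<close> are irrelevant: each matrix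
  coefficient is differentiated through a regular extension to GL(X). For \<open>A \<in> lie_alg G\<close> the result
  does not depend on the extension; other \<open>A\<close> are never used.\<close>

definition diff_rep ::
    "(complex ^ 'n ^ 'n) set \<Rightarrow> (complex ^ 'n ^ 'n \<Rightarrow> complex ^ 'm ^ 'm) \<Rightarrow>
     complex ^ 'n ^ 'n \<Rightarrow> complex ^ 'm ^ 'm" where
  "diff_rep G \<rho> A = (\<chi> i j. THE d. \<exists>f. regular_fun f \<and> (\<forall>g\<in>G. \<rho> g $ i $ j = f g)
     \<and> ((\<lambda>t. f (mat 1 + cscale t A)) has_field_derivative d) (at 0))"

definition lie_stabilizer ::
    "(complex ^ 'n ^ 'n) set \<Rightarrow> (complex ^ 'n ^ 'n \<Rightarrow> complex ^ 'm ^ 'm) \<Rightarrow> complex ^ 'm \<Rightarrow>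
     (complex ^ 'n ^ 'n) set" where
  "lie_stabilizer G \<rho> v = {A \<in> lie_alg G. diff_rep G \<rho> A *v v = 0}"

section \<open>One-parameter subgroups\<close>

definition one_param_subgroup :: "(complex ^ 'n ^ 'n) set \<Rightarrow> (complex \<Rightarrow> complex ^ 'n ^ 'n) \<Rightarrow> bool" where
  "one_param_subgroup G lam \<longleftrightarrow> (\<forall>t. t \<noteq> 0 \<longrightarrow> lam t \<in> G)
     \<and> (\<forall>s t. s \<noteq> 0 \<and> t \<noteq> 0 \<longrightarrow> lam (s * t) = lam s ** lam t)
     \<and> (\<forall>i j. \<exists>(p :: complex poly) k. \<forall>t. t \<noteq> 0 \<longrightarrow> lam t $ i $ j = poly p t / t ^ k)"

definition lie_grade ::
    "(complex ^ 'n ^ 'n) set \<Rightarrow> (complex \<Rightarrow> complex ^ 'n ^ 'n) \<Rightarrow> int \<Rightarrow> (complex ^ 'n ^ 'n) set" where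
  "lie_grade G lam j = {A \<in> lie_alg G. \<forall>t. t \<noteq> 0 \<longrightarrow>
     lam t ** A ** matrix_inv (lam t) = cscale (t powi j) A}"

definition leading_term ::
    "(complex ^ 'n ^ 'n) set \<Rightarrow> (complex \<Rightarrow> complex ^ 'n ^ 'n) \<Rightarrow>
     complex ^ 'n ^ 'n \<Rightarrow> complex ^ 'n ^ 'n \<Rightarrow> bool" where
  "leading_term G lam A B \<longleftrightarrow> (\<exists>C j k. j \<le> k \<and> (\<forall>i. C i \<in> lie_grade G lam i)
     \<and> A = (\<Sum>i=j..k. C i) \<and> C j \<noteq> 0 \<and> B = C j)"

definition leading_span ::
    "(complex ^ 'n ^ 'n) set \<Rightarrow> (complex \<Rightarrow> complex ^ 'n ^ 'n) \<Rightarrow>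
     (complex ^ 'n ^ 'n) set \<Rightarrow> (complex ^ 'n ^ 'n) set" where
  "leading_span G lam K = cmat.span {B. \<exists>A\<in>K. A \<noteq> 0 \<and> leading_term G lam A B}"

text \<open>\<open>lam t ** g ** matrix_inv (lam t)\<close> has Laurent polynomial entries, so the classical limit used here
  exists iff the algebraic one does.\<close>

definition parabolic :: "(complex ^ 'n ^ 'n) set \<Rightarrow> (complex \<Rightarrow> complex ^ 'n ^ 'n) \<Rightarrow>
    (complex ^ 'n ^ 'n) set" where
  "parabolic G lam = {g \<in> G. \<exists>h\<in>G. ((\<lambda>t. lam t ** g ** matrix_inv (lam t)) \<longlongrightarrow> h) (at 0)}"

text \<open>The fractional-exponent multiple \<open>t^a lam(t)\<close> is multivalued in \<open>t\<close>; it is parametrised by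
  \<open>s\<close> with \<open>t = exp s\<close>.\<close>

definition central_twist :: "rat \<Rightarrow> (complex \<Rightarrow> complex ^ 'n ^ 'n) \<Rightarrow> complex \<Rightarrow> complex ^ 'n ^ 'n" where
  "central_twist a lam s = cscale (exp (of_rat a * s)) (lam (exp s))"

text \<open>\<open>l\<close> is semisimple and \<open>t^l = F s\<close> for \<open>t = exp s\<close>, the power of a diagonalizable matrix being taken
  on eigenvalues. This determines \<open>l\<close>, as the derivative of \<open>F\<close> at 0.\<close>

definition semisimple_generator :: "complex ^ 'n ^ 'n \<Rightarrow> (complex \<Rightarrow> complex ^ 'n ^ 'n) \<Rightarrow> bool" where
  "semisimple_generator l F \<longleftrightarrow> (\<exists>(P :: complex ^ 'n ^ 'n) m. invertible P \<and> l = P ** diag m ** matrix_inv P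
     \<and> (\<forall>s. F s = P ** diag (\<lambda>i. exp (s * m i)) ** matrix_inv P))"

end

theory Submission
  imports Defs "HOL-Complex_Analysis.Cauchy_Integral_Formula"
    "HOL-Computational_Algebra.Fundamental_Theorem_Algebra"
    "HOL-Computational_Algebra.Polynomial_Factorial"
    "HOL-Computational_Algebra.Field_as_Ring"
begin

text \<open>The proof turns on the element \<open>l\<close>, the generator of the normalised one-parameter group: it is
  semisimple, nonzero (as \<open>yc e \<noteq> 0\<close>), and fixes \<open>z\<close>. The weights of \<open>l\<close> grade
  all matrices by integers, and a Lie algebra of an algebraic group that contains \<open>l\<close> is graded
  with them. As \<open>s\<close> tends to minus infinity, \<open>exp (s l)\<close> moves \<open>y\<close> to \<open>z\<close> and an element of \<open>K\<close>, suitably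
  rescaled, to its leading term; so leading terms annihilate \<open>z\<close>
  (\<open>leading_part_stabilizes_limit\<close>).

  Suppose that \<open>K\<close> contains a nonzero semisimple element \<open>k\<close> without components of negative degree. Then an
  element of the unipotent radical conjugates \<open>k\<close> to its part of degree 0, one degree at a time
  (\<open>conjugate_to_leading_part\<close>). This part lies in \<open>H\<close>, which is alternative (B).

  Suppose that there is no such \<open>k\<close>. The stabilizer of \<open>y\<close> is an algebraic group, so its Lie algebra \<open>K\<close>
  contains the semisimple Jordan part of each of its elements (\<open>lie_alg_jordan\<close>). This part is a
  polynomial in the element and hence again has no components of negative degree, so it vanishes if the
  element has none. Therefore leading terms of degree 0 are nilpotent; those of nonzero degree
  are nilpotent because they shift the grading. The leading terms are closed under brackets, and
  Jacobson's theorem on weakly closed sets of nilpotent matrices (\<open>weakly_closed_acts_nilpotently\<close>)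
  shows that every element of their span \<open>Khat\<close> is nilpotent. Now \<open>Khat\<close> is an ideal of codimension 1 in \<open>K'\<close>
  that meets every torus only in 0, so every torus of \<open>K'\<close> has dimension at most 1, and the line
  through \<open>l\<close> excludes 0 as a maximal torus. This is alternative (A).

  The correspondence between algebraic groups and Lie algebras used here rests on one fact: \<open>A\<close>
  lies in \<open>lie_alg G\<close> iff \<open>exp (t A)\<close> lies in \<open>G\<close> for all complex \<open>t\<close> (\<open>flow_in_group\<close>,
  \<open>lie_algI_curve\<close>). Along a flow, polynomials become exponential polynomials in \<open>t\<close>, and
  the linear independence of these separates Jordan parts and homogeneous components.\<close>

section \<open>Matrix algebra\<close>

lemma matrix_inv_both:
  fixes A :: "complex ^ 'n ^ 'n"
  assumes "invertible A"
  shows matrix_inv_right_mult: "A ** matrix_inv A = mat 1"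
    and matrix_inv_left_mult: "matrix_inv A ** A = mat 1"
proof -
  have "A ** matrix_inv A = mat 1 \<and> matrix_inv A ** A = mat 1"
    unfolding matrix_inv_def using assms unfolding invertible_def by (rule someI_ex)
  then show "A ** matrix_inv A = mat 1" "matrix_inv A ** A = mat 1" by auto
qed

lemma matrix_inv_eqI:
  fixes A :: "complex ^ 'n ^ 'n"
  assumes "A ** B = mat 1" "B ** A = mat 1"
  shows "matrix_inv A = B"
proof -
  have "invertible A" using assms unfolding invertible_def by blast
  then have "matrix_inv A = matrix_inv A ** (A ** B)" using assms by simp
  also have "\<dots> = B" by (simp add: matrix_mul_assoc matrix_inv_left_mult \<open>invertible A\<close>)
  finally show ?thesis .
qed

lemma matrix_inv_mult:
  fixes A B :: "complex ^ 'n ^ 'n"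
  assumes "invertible A" "invertible B"
  shows "matrix_inv (A ** B) = matrix_inv B ** matrix_inv A"
proof (rule matrix_inv_eqI)
  have "A ** B ** (matrix_inv B ** matrix_inv A) = A ** (B ** matrix_inv B) ** matrix_inv A"
    by (simp only: matrix_mul_assoc)
  then show "A ** B ** (matrix_inv B ** matrix_inv A) = mat 1" using assms by (simp add: matrix_inv_both)
  have "matrix_inv B ** matrix_inv A ** (A ** B) = matrix_inv B ** (matrix_inv A ** A) ** B"
    by (simp only: matrix_mul_assoc)
  then show "matrix_inv B ** matrix_inv A ** (A ** B) = mat 1" using assms by (simp add: matrix_inv_both)
qed

lemma cscale_nth [simp]: "cscale c A $ i $ j = c * A $ i $ j"
  by (simp add: cscale_def)

lemma matrix_mult_nth: "(A ** B) $ i $ j = (\<Sum>k\<in>UNIV. A $ i $ k * B $ k $ j)"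
  by (simp add: matrix_matrix_mult_def)

lemma matrix_mult_zero [simp]:
  fixes A :: "complex ^ 'n ^ 'n"
  shows "A ** 0 = 0" "0 ** A = 0"
  by (simp_all add: vec_eq_iff matrix_mult_nth)

lemma cscale_mult_left: "cscale c A ** B = cscale c (A ** B)"
  by (simp add: vec_eq_iff matrix_mult_nth sum_distrib_left mult.assoc)

lemma cscale_mult_right: "A ** cscale c B = cscale c (A ** B)"
  by (simp add: vec_eq_iff matrix_mult_nth sum_distrib_left algebra_simps)

lemma cscale_vector: "cscale c A *v x = c *s (A *v x)"
  by (simp add: vec_eq_iff matrix_vector_mult_def sum_distrib_left mult.assoc)

lemma matrix_diff_ldistrib: "(A::complex^'n^'n) ** (B - C) = A ** B - A ** C"
  by (simp add: vec_eq_iff matrix_mult_nth right_diff_distrib sum_subtractf)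

lemma matrix_diff_rdistrib: "((B::complex^'n^'n) - C) ** A = B ** A - C ** A"
  by (simp add: vec_eq_iff matrix_mult_nth left_diff_distrib sum_subtractf)

lemma matrix_uminus_mult: "(- A) ** B = - ((A::complex^'n^'n) ** B)" "A ** (- B) = - (A ** B)"
  by (simp_all add: vec_eq_iff matrix_mult_nth sum_negf)

lemma matrix_add_rdistrib: "((B::complex^'n^'n) + C) ** A = B ** A + C ** A"
  by (simp add: vec_eq_iff matrix_mult_nth distrib_right sum.distrib)

lemma matrix_sum_mult: "(\<Sum>i\<in>I. (f i :: complex^'n^'n)) ** A = (\<Sum>i\<in>I. f i ** A)"
  by (induction I rule: infinite_finite_induct) (auto simp: matrix_add_rdistrib)

lemma matrix_mult_sum_right: "(A::complex^'n^'n) ** (\<Sum>i\<in>I. f i) = (\<Sum>i\<in>I. A ** f i)"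
  by (induction I rule: infinite_finite_induct) (auto simp: matrix_add_ldistrib)

lemmas matrix_ring = matrix_add_ldistrib matrix_add_rdistrib matrix_diff_ldistrib matrix_diff_rdistrib
  matrix_mul_assoc cscale_mult_left cscale_mult_right matrix_uminus_mult

lemma mat_eq_cscale: "mat c = cscale c (mat 1 :: complex^'n^'n)"
  by (simp add: vec_eq_iff mat_def)

lemma sum_matrix_nth: "(\<Sum>x\<in>I. f x) $ i $ j = (\<Sum>x\<in>I. f x $ i $ (j::'n::finite))"
  by (induction I rule: infinite_finite_induct) auto

lemma bracket_simps:
  "bracket (A + B) C = bracket A C + bracket B C" "bracket C (A + B) = bracket C A + bracket C B"
  "bracket (cscale c A) B = cscale c (bracket A B)" "bracket A (cscale c B) = cscale c (bracket A B)"
  "bracket A A = 0" "bracket 0 A = 0" "bracket A 0 = 0"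
  by (simp_all add: bracket_def matrix_ring cmat.scale_right_diff_distrib)

lemma bracket_swap: "bracket A B = cscale (-1) (bracket B A)"
  by (simp add: bracket_def vec_eq_iff)

section \<open>Powers and polynomials in a matrix\<close>

definition mpow :: "complex ^ 'n ^ 'n \<Rightarrow> nat \<Rightarrow> complex ^ 'n ^ 'n" where
  "mpow A k = ((**) A ^^ k) (mat 1)"

lemma mpow_0 [simp]: "mpow A 0 = mat 1" and mpow_Suc: "mpow A (Suc k) = A ** mpow A k"
  by (simp_all add: mpow_def)

lemma mpow_add: "mpow A (i + j) = mpow A i ** mpow A j"
  by (induction i) (simp_all add: mpow_Suc matrix_mul_assoc)

lemma mpow_Suc2: "mpow A (Suc k) = mpow A k ** A"
  using mpow_add[of A k 1] by (simp add: mpow_Suc)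

definition nilpotent :: "complex ^ 'n ^ 'n \<Rightarrow> bool" where
  "nilpotent A \<longleftrightarrow> (\<exists>k. mpow A k = 0)"

text \<open>Horner's scheme. The product \<open>**\<close> is not the multiplication of a ring class, so \<open>poly\<close> does not apply.\<close>

definition peval :: "complex poly \<Rightarrow> complex ^ 'n ^ 'n \<Rightarrow> complex ^ 'n ^ 'n" where
  "peval p A = fold_coeffs (\<lambda>c X. cscale c (mat 1) + A ** X) p 0"

lemma peval_0 [simp]: "peval 0 A = 0"
  by (simp add: peval_def)

lemma peval_pCons [simp]: "peval (pCons c p) A = cscale c (mat 1) + A ** peval p A"
  by (cases "c = 0 \<and> p = 0") (auto simp: peval_def)

lemma peval_add: "peval (p + q) A = peval p A + peval q A"
  by (induction p q rule: poly_induct2) (simp_all add: matrix_ring cmat.scale_left_distrib)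

lemma peval_smult: "peval (smult c p) A = cscale c (peval p A)"
  by (induction p) (simp_all add: matrix_ring cmat.scale_right_distrib)

lemma peval_diff: "peval (p - q) A = peval p A - peval q A"
  using peval_add[of "p - q" q A] by simp

lemma peval_mult: "peval (p * q) A = peval p A ** peval q A"
proof (induction p)
  case (pCons c p)
  have "peval (pCons c p * q) A = cscale c (peval q A) + A ** peval (p * q) A"
    by (simp add: mult_pCons_left peval_add peval_smult)
  then show ?case using pCons by (simp add: matrix_ring)
qed simp

lemma peval_1 [simp]: "peval 1 A = mat 1"
  by (simp add: one_pCons)

lemma peval_sum: "peval (\<Sum>i\<in>I. f i) A = (\<Sum>i\<in>I. peval (f i) A)"
  by (induction I rule: infinite_finite_induct) (auto simp: peval_add)

lemma peval_commute: "peval p A ** peval q A = peval q A ** peval p A"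
  by (metis peval_mult mult.commute)

lemma peval_X: "peval [:0, 1:] A = A"
  by simp

lemma peval_commute_self: "A ** peval p A = peval p A ** A"
  by (metis peval_commute peval_X)

lemma peval_monom: "peval (monom c k) A = cscale c (mpow A k)"
  by (induction k) (simp_all add: monom_0 monom_Suc mpow_Suc cscale_mult_right)

lemma peval_power: "peval (p ^ k) A = mpow (peval p A) k"
  by (induction k) (simp_all add: peval_mult mpow_Suc)

lemma peval_dvd:
  assumes "p dvd q" "peval p A = 0" shows "peval q A = 0"
  using assms by (auto simp: peval_mult elim!: dvdE)

lemma peval_conj:
  fixes P Q A :: "complex ^ 'n ^ 'n"
  assumes "Q ** P = mat 1" "P ** Q = mat 1"
  shows "peval p (P ** A ** Q) = P ** peval p A ** Q"
proof (induction p)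
  case (pCons c p)
  have "P ** A ** Q ** (P ** peval p A ** Q) = P ** A ** (Q ** P) ** peval p A ** Q"
    by (simp add: matrix_mul_assoc)
  then show ?case using pCons assms
    by (simp add: matrix_add_ldistrib matrix_add_rdistrib cscale_mult_left cscale_mult_right
        matrix_mul_assoc)
qed simp

lemma diag_nth: "diag m $ i $ j = (if i = j then m i else 0)"
  by (simp add: diag_def)

lemma diag_mult_nth:
  "(diag m ** A) $ i $ j = m i * A $ i $ j" "(A ** diag m) $ i $ j = A $ i $ j * m j"
  by (simp_all add: matrix_mult_nth diag_nth if_distrib [of "\<lambda>x. x * _"] if_distrib [of "\<lambda>x. _ * x"]
      sum.delta cong: if_cong)

lemma diag_mult: "diag m ** diag n = diag (\<lambda>i. m i * n i)"
  by (simp add: vec_eq_iff diag_mult_nth) (simp add: diag_nth)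

lemma peval_diag: "peval p (diag m) = diag (\<lambda>i. poly p (m i))"
proof (induction p)
  case 0 then show ?case by (simp add: vec_eq_iff diag_nth)
next
  case (pCons c p)
  then show ?case by (simp add: diag_mult) (simp add: vec_eq_iff diag_nth mat_def)
qed

text \<open>Matrices form a finite-dimensional real space, so the powers of \<open>A\<close> satisfy a linear relation.\<close>

lemma annihilating_poly_exists:
  fixes A :: "complex ^ 'n ^ 'n"
  shows "\<exists>p. p \<noteq> 0 \<and> peval p A = 0"
proof (cases "inj_on (mpow A) {..DIM(complex^'n^'n)}")
  case False
  then obtain i j where "i \<noteq> j" "mpow A i = mpow A j" by (auto simp: inj_on_def)
  then have "peval (monom 1 i - monom 1 j) A = 0" by (simp add: peval_diff peval_monom)
  moreover have "monom 1 i - monom 1 j \<noteq> (0 :: complex poly)"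
    using \<open>i \<noteq> j\<close> by (simp add: monom_eq_iff')
  ultimately show ?thesis by blast
next
  case True
  let ?K = "{..DIM(complex^'n^'n)}"
  have "dependent (mpow A ` ?K)"
    by (rule dependent_biggerset) (simp_all only: card_image [OF True], simp_all)
  then obtain u v where u: "v \<in> mpow A ` ?K" "u v \<noteq> 0" "(\<Sum>v\<in>mpow A ` ?K. u v *\<^sub>R v) = 0"
    by (auto simp: dependent_finite)
  define p where "p = (\<Sum>k\<in>?K. monom (complex_of_real (u (mpow A k))) k)"
  have "peval p A = (\<Sum>k\<in>?K. u (mpow A k) *\<^sub>R mpow A k)"
    unfolding p_def peval_sum peval_monom by (intro sum.cong refl) (simp add: vec_eq_iff, simp add: scaleR_conv_of_real)
  also have "\<dots> = (\<Sum>v\<in>mpow A ` ?K. u v *\<^sub>R v)"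
    by (simp only: sum.reindex [OF True] o_def)
  also have "\<dots> = 0" by (rule u(3))
  finally have "peval p A = 0" .
  moreover obtain k where k: "k \<in> ?K" "v = mpow A k" using u(1) by auto
  have "coeff p k = of_real (u v)"
    using k by (simp add: p_def coeff_sum coeff_monom)
  then have "p \<noteq> 0" using u(2) by auto
  ultimately show ?thesis by blast
qed

text \<open>An annihilating polynomial of least degree has nonzero constant term, as otherwise the invertible factor
  \<open>A\<close> could be cancelled; solving for the constant term gives the inverse. It follows that the inverse
  of a block triangular matrix is block triangular.\<close>

lemma inverse_is_peval:
  fixes A :: "complex ^ 'n ^ 'n"
  assumes "invertible A"
  shows "\<exists>q. matrix_inv A = peval q A"
proof -
  define n where "n = (LEAST n. \<exists>p. p \<noteq> 0 \<and> peval p A = 0 \<and> degree p = n)"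
  have "\<exists>n p. p \<noteq> 0 \<and> peval p A = 0 \<and> degree p = n"
    using annihilating_poly_exists[of A] by blast
  then have "\<exists>p. p \<noteq> 0 \<and> peval p A = 0 \<and> degree p = n"
    unfolding n_def by (rule LeastI_ex)
  then obtain p where p: "p \<noteq> 0" "peval p A = 0" "degree p = n" by blast
  have least: "n \<le> degree q" if "q \<noteq> 0" "peval q A = 0" for q
    unfolding n_def by (rule Least_le) (use that in blast)
  obtain c q where pq: "p = pCons c q" by (cases p)
  have eq: "cscale c (mat 1) + A ** peval q A = 0" using p pq by simp
  have "c \<noteq> 0"
  proof
    assume c: "c = 0"
    then have "A ** peval q A = 0" using eq by simp
    then have "matrix_inv A ** (A ** peval q A) = 0" by simp
    then have "peval q A = 0" using assms by (simp add: matrix_mul_assoc matrix_inv_left_mult)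
    moreover have "q \<noteq> 0" using p pq c by auto
    ultimately have "n \<le> degree q" using least by blast
    then show False using p pq \<open>q \<noteq> 0\<close> by simp
  qed
  define r where "r = smult (- 1 / c) q"
  have "A ** peval q A = cscale (- c) (mat 1)"
    using eq by (simp add: add_eq_0_iff2 vec_eq_iff)
  then have "A ** peval r A = mat 1"
    using \<open>c \<noteq> 0\<close> unfolding r_def by (simp only: peval_smult cscale_mult_right) simp
  then have "matrix_inv A = peval r A"
    by (intro matrix_inv_eqI) (simp_all add: peval_commute_self [symmetric])
  then show ?thesis by blast
qed

section \<open>Jordan decomposition\<close>

lemma mat_1_neq_0: "(mat 1 :: complex ^ 'n ^ 'n) \<noteq> 0"
proof
  assume "(mat 1 :: complex ^ 'n ^ 'n) = 0"
  then have "(mat 1 :: complex ^ 'n ^ 'n) $ i $ i = 0" for i by simp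
  then show False by (simp add: mat_def)
qed

definition root_poly :: "complex set \<Rightarrow> complex poly" where
  "root_poly M = (\<Prod>\<mu>\<in>M. [:- \<mu>, 1:])"

text \<open>The interpolation polynomials at the points of \<open>M\<close>. On a matrix that is annihilated by
  \<open>root_poly M\<close> they take as values the projections to the eigenspaces.\<close>

definition lagrange :: "complex set \<Rightarrow> complex \<Rightarrow> complex poly" where
  "lagrange M \<mu> = smult (\<Prod>\<nu>\<in>M - {\<mu>}. 1 / (\<mu> - \<nu>)) (root_poly (M - {\<mu>}))"

lemma poly_root_poly: "finite M \<Longrightarrow> poly (root_poly M) x = 0 \<longleftrightarrow> x \<in> M"
  by (auto simp: root_poly_def poly_prod)

lemma poly_lagrange:
  assumes "finite M" "\<mu> \<in> M" "\<kappa> \<in> M"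
  shows "poly (lagrange M \<mu>) \<kappa> = (if \<kappa> = \<mu> then 1 else 0)"
proof (cases "\<kappa> = \<mu>")
  case True
  have "(\<Prod>\<nu>\<in>M - {\<mu>}. 1 / (\<mu> - \<nu>)) * (\<Prod>\<nu>\<in>M - {\<mu>}. \<mu> - \<nu>) = 1"
    by (subst prod.distrib [symmetric]) (rule prod.neutral, auto)
  then show ?thesis using True by (simp add: lagrange_def root_poly_def poly_prod)
next
  case False
  then have "poly (root_poly (M - {\<mu>})) \<kappa> = 0" using assms by (simp add: poly_root_poly)
  then show ?thesis using False by (simp add: lagrange_def)
qed

text \<open>Both sides agree at the points of \<open>M\<close> and have degree less than \<open>card M\<close>.\<close>

lemma lagrange_sum:
  assumes "finite M" "M \<noteq> {}"
  shows "(\<Sum>\<mu>\<in>M. lagrange M \<mu>) = 1"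
proof (rule ccontr)
  let ?p = "(\<Sum>\<mu>\<in>M. lagrange M \<mu>) - 1"
  assume "(\<Sum>\<mu>\<in>M. lagrange M \<mu>) \<noteq> 1"
  then have nz: "?p \<noteq> 0" by simp
  have "degree (lagrange M \<mu>) \<le> card M - 1" if "\<mu> \<in> M" for \<mu>
  proof -
    have "degree (root_poly (M - {\<mu>})) \<le> (\<Sum>\<nu>\<in>M - {\<mu>}. degree [:- \<nu>, 1:])"
      unfolding root_poly_def using degree_prod_sum_le[of "M - {\<mu>}" "\<lambda>\<nu>. [:- \<nu>, 1:]"] assms by (simp add: comp_def)
    then show ?thesis using assms that by (simp add: lagrange_def degree_smult_eq)
  qed
  then have "degree ?p \<le> card M - 1"
    by (intro degree_diff_le degree_sum_le) (use assms in auto)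
  moreover have "M \<subseteq> {x. poly ?p x = 0}"
  proof
    fix \<kappa> assume "\<kappa> \<in> M"
    then have "(\<Sum>\<mu>\<in>M. poly (lagrange M \<mu>) \<kappa>) = (\<Sum>\<mu>\<in>M. if \<kappa> = \<mu> then 1 else 0)"
      using assms by (intro sum.cong refl) (simp add: poly_lagrange)
    then show "\<kappa> \<in> {x. poly ?p x = 0}" using assms \<open>\<kappa> \<in> M\<close> by (simp add: poly_sum)
  qed
  then have "card M \<le> degree ?p"
    using card_mono[OF poly_roots_finite[OF nz]] card_poly_roots_bound[OF nz] by (meson order_trans)
  ultimately show False using assms by (metis One_nat_def Suc_pred card_gt_0_iff not_less_eq_eq order_trans)
qed

lemma root_poly_dvd_lagrange:
  assumes "finite M" "\<mu> \<in> M"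
  shows "root_poly M dvd [:- \<mu>, 1:] * lagrange M \<mu>"
proof -
  have "root_poly M = [:- \<mu>, 1:] * root_poly (M - {\<mu>})"
    unfolding root_poly_def using assms by (simp add: prod.remove)
  then show ?thesis unfolding lagrange_def by (simp add: dvd_smult)
qed

lemma coprime_linear_powers:
  assumes "\<mu> \<noteq> (\<nu> :: complex)"
  shows "coprime ([:- \<mu>, 1:] ^ k) ([:- \<nu>, 1:] ^ k)"
proof -
  have "coprime [:- \<mu>, 1:] [:- \<nu>, 1:]"
  proof (rule coprimeI)
    fix c assume "c dvd [:- \<mu>, 1:]" "c dvd [:- \<nu>, 1:]"
    then have "c dvd [:- \<mu>, 1:] - [:- \<nu>, 1:]" by (rule dvd_diff)
    then have "c dvd [:\<nu> - \<mu>:]" by simp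
    moreover have "[:\<nu> - \<mu>:] dvd 1" using assms by (simp add: is_unit_iff_degree)
    ultimately show "is_unit c" by (rule dvd_trans)
  qed
  then show ?thesis by simp
qed

lemma coprime_linear_prod:
  assumes "finite M" "\<mu> \<notin> M"
  shows "coprime ([:- \<mu>, 1:] ^ k) (\<Prod>\<nu>\<in>M. [:- \<nu> :: complex, 1:] ^ k)"
  using assms by (intro prod_coprime_right coprime_linear_powers) auto

lemma prod_linear_dvd:
  assumes "finite M" "\<And>\<mu>. \<mu> \<in> M \<Longrightarrow> [:- \<mu> :: complex, 1:] ^ k dvd r"
  shows "(\<Prod>\<mu>\<in>M. [:- \<mu>, 1:] ^ k) dvd r"
  using assms by (induction M rule: finite_induct) (auto intro!: divides_mult coprime_linear_prod simp del: mult_pCons_left)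

lemma chinese_remainder_linear_powers:
  assumes "finite M"
  shows "\<exists>s :: complex poly. \<forall>\<mu>\<in>M. [:- \<mu>, 1:] ^ k dvd s - [:\<mu>:]"
  using assms
proof (induction M rule: finite_induct)
  case (insert \<nu> M)
  then obtain s where s: "\<forall>\<mu>\<in>M. [:- \<mu>, 1:] ^ k dvd s - [:\<mu>:]" by blast
  let ?P = "\<Prod>\<mu>\<in>M. [:- \<mu>, 1:] ^ k" and ?q = "[:- \<nu>, 1:] ^ k"
  have "gcd ?q ?P = 1" using coprime_linear_prod[OF insert(1,2)] by (simp only: coprime_iff_gcd_eq_1)
  then obtain a b where ab: "a * ?q + b * ?P = 1" using bezout_coefficients_fst_snd by metis
  \<comment> \<open>Unchanged modulo \<open>?P\<close>, and congruent to \<open>\<nu>\<close> modulo \<open>?q\<close> since \<open>b * ?P\<close> is 1 there.\<close>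
  define s' where "s' = s - (s - [:\<nu>:]) * (b * ?P)"
  have "s' - [:\<nu>:] = (s - [:\<nu>:]) * (1 - b * ?P)" unfolding s'_def by algebra
  also have "1 - b * ?P = a * ?q" using ab by (simp add: algebra_simps del: mult_pCons_left mult_pCons_right)
  finally have "?q dvd s' - [:\<nu>:]" by simp
  moreover have "[:- \<mu>, 1:] ^ k dvd s' - [:\<mu>:]" if "\<mu> \<in> M" for \<mu>
  proof -
    have "[:- \<mu>, 1:] ^ k dvd ?P" using insert(1) that by (rule dvd_prodI)
    then have "[:- \<mu>, 1:] ^ k dvd (s - [:\<mu>:]) - (s - [:\<nu>:]) * (b * ?P)"
      using s that by (intro dvd_diff [OF _ dvd_mult [OF dvd_mult]]) auto
    then show ?thesis by (simp add: s'_def algebra_simps)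
  qed
  ultimately show ?case by auto
qed simp

lemma peval_pcompose: "peval (pcompose p q) A = peval p (peval q A)"
  by (induction p) (simp_all add: pcompose_pCons peval_add peval_mult)

lemma sum_matrix_vector_mult: "(\<Sum>i\<in>I. (f i :: complex ^ 'n ^ 'n)) *v v = (\<Sum>i\<in>I. f i *v v)"
  by (induction I rule: infinite_finite_induct) (auto simp: matrix_vector_mult_add_rdistrib)

text \<open>The interpolation polynomials resolve the identity into maps with values in eigenspaces. Hence the
  eigenvectors span, and a basis chosen among them diagonalizes \<open>S\<close>.\<close>

lemma semisimpleI_root_poly:
  fixes S :: "complex ^ 'n ^ 'n"
  assumes M: "finite M" and S: "peval (root_poly M) S = 0"
  shows "semisimple S"
proof -
  have "M \<noteq> {}" using S by (auto simp: root_poly_def mat_1_neq_0)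
  define E where "E = {v. \<exists>\<mu>. S *v v = \<mu> *s v}"
  have eig: "peval (lagrange M \<mu>) S *v v \<in> E" if "\<mu> \<in> M" for \<mu> v
  proof -
    have "peval ([:- \<mu>, 1:] * lagrange M \<mu>) S = 0"
      using root_poly_dvd_lagrange[OF M that] S by (rule peval_dvd)
    then have "(S - cscale \<mu> (mat 1)) ** peval (lagrange M \<mu>) S = 0"
      unfolding peval_mult by (simp add: cscale_mult_right)
    then have "S ** peval (lagrange M \<mu>) S = cscale \<mu> (peval (lagrange M \<mu>) S)"
      by (simp add: matrix_diff_rdistrib cscale_mult_left)
    then show ?thesis unfolding E_def by (auto simp: matrix_vector_mul_assoc cscale_vector)
  qed
  have span: "vec.span E = UNIV"
  proof -
    have "v \<in> vec.span E" for v
    proof -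
      have "v = (\<Sum>\<mu>\<in>M. peval (lagrange M \<mu>) S) *v v"
        using lagrange_sum[OF M \<open>M \<noteq> {}\<close>] by (simp add: peval_sum [symmetric])
      also have "\<dots> = (\<Sum>\<mu>\<in>M. peval (lagrange M \<mu>) S *v v)"
        by (rule sum_matrix_vector_mult)
      also have "\<dots> \<in> vec.span E" by (intro vec.span_sum vec.span_base eig)
      finally show ?thesis .
    qed
    then show ?thesis by blast
  qed
  obtain B where B: "B \<subseteq> E" "vec.independent B" "E \<subseteq> vec.span B" "card B = vec.dim E"
    by (rule vec.basis_exists)
  have "vec.span B = UNIV"
    using B(3) span by (metis top.extremum_uniqueI vec.span_minimal vec.subspace_span)
  have "vec.dim E = CARD('n)"
    using span by (metis vec.dim_span vec.dim_UNIV card_cart_basis)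
  then have "card B = CARD('n)" using B by simp
  moreover have "finite B" using B(2) by (rule vec.finiteI_independent)
  ultimately obtain b where b: "bij_betw b (UNIV :: 'n set) B"
    using finite_same_card_bij[of "UNIV :: 'n set" B] by auto
  define P where "P = (\<chi> i j. b j $ i)"
  have col: "column j P = b j" for j by (simp add: P_def column_def vec_eq_iff)
  have "columns P = B"
    using b by (auto simp: columns_def col bij_betw_def)
  then have "\<exists>B. P ** B = mat 1"
    using \<open>vec.span B = UNIV\<close> by (simp add: matrix_right_invertible_span_columns)
  then have P: "invertible P" by (simp add: invertible_right_inverse)
  have "\<forall>j. \<exists>\<mu>. S *v b j = \<mu> *s b j"
    using b B(1) by (auto simp: E_def bij_betw_def)
  then obtain m where m: "\<And>j. S *v b j = m j *s b j" by metis
  have "S ** P = P ** diag m"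
  proof -
    have "(S ** P) $ i $ j = (S *v b j) $ i" for i j
      by (simp add: matrix_mult_nth matrix_vector_mult_def P_def)
    then show ?thesis by (simp add: vec_eq_iff diag_mult_nth m) (simp add: P_def)
  qed
  then have "S ** P ** matrix_inv P = P ** diag m ** matrix_inv P" by simp
  then have "S = P ** diag m ** matrix_inv P"
    by (simp add: matrix_mul_assoc [symmetric] matrix_inv_right_mult [OF P])
  then show ?thesis unfolding semisimple_def using P by blast
qed

lemma semisimpleE:
  fixes S :: "complex ^ 'n ^ 'n"
  assumes "semisimple S"
  obtains P Q :: "complex ^ 'n ^ 'n" and m
  where "Q ** P = mat 1" "P ** Q = mat 1" "S = P ** diag m ** Q"
proof -
  obtain P :: "complex ^ 'n ^ 'n" and m where "invertible P" "S = P ** diag m ** matrix_inv P"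
    using assms unfolding semisimple_def by blast
  then show ?thesis using that matrix_inv_both by blast
qed

lemma semisimple_root_poly:
  fixes S :: "complex ^ 'n ^ 'n"
  assumes "semisimple S"
  shows "\<exists>M. finite M \<and> peval (root_poly M) S = 0"
proof -
  obtain P Q :: "complex ^ 'n ^ 'n" and m where P: "Q ** P = mat 1" "P ** Q = mat 1" and S: "S = P ** diag m ** Q"
    using assms(1) by (rule semisimpleE)
  have "peval (root_poly (range m)) S = P ** diag (\<lambda>i. poly (root_poly (range m)) (m i)) ** Q"
    unfolding S by (simp add: peval_conj P peval_diag)
  also have "(\<lambda>i. poly (root_poly (range m)) (m i)) = (\<lambda>i. 0)"
    by (intro ext iffD2 [OF poly_root_poly]) auto
  also have "diag (\<lambda>i. 0) = 0" by (simp add: vec_eq_iff diag_nth)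
  finally show ?thesis by (intro exI[of _ "range m"]) simp
qed

lemma semisimple_nilpotent_zero:
  fixes S :: "complex ^ 'n ^ 'n"
  assumes "semisimple S" "nilpotent S"
  shows "S = 0"
proof -
  obtain P Q :: "complex ^ 'n ^ 'n" and m where P: "Q ** P = mat 1" "P ** Q = mat 1" and S: "S = P ** diag m ** Q"
    using assms(1) by (rule semisimpleE)
  obtain k where k: "mpow S k = 0" using assms unfolding nilpotent_def by blast
  have "peval (monom 1 k) S = P ** diag (\<lambda>i. m i ^ k) ** Q"
    unfolding S by (simp add: peval_conj P peval_diag poly_monom)
  then have z: "P ** diag (\<lambda>i. m i ^ k) ** Q = 0" using k by (simp add: peval_monom)
  have "diag (\<lambda>i. m i ^ k) = (Q ** P) ** diag (\<lambda>i. m i ^ k) ** (Q ** P)"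
    by (simp add: P)
  also have "\<dots> = Q ** (P ** diag (\<lambda>i. m i ^ k) ** Q) ** P"
    by (simp add: matrix_mul_assoc)
  finally have "diag (\<lambda>i. m i ^ k) = 0" using z by simp
  then have "m i = 0" for i by (auto simp: vec_eq_iff diag_nth dest!: spec[of _ i])
  then have "diag m = 0" by (simp add: vec_eq_iff diag_nth)
  then show ?thesis using S by simp
qed

lemma semisimple_conj:
  fixes S U V :: "complex ^ 'n ^ 'n"
  assumes "semisimple S" "U ** V = mat 1" "V ** U = mat 1"
  shows "semisimple (U ** S ** V)"
proof -
  obtain M where M: "finite M" "peval (root_poly M) S = 0"
    using semisimple_root_poly[OF assms(1)] by blast
  then have "peval (root_poly M) (U ** S ** V) = 0" using assms by (simp add: peval_conj)
  then show ?thesis using M(1) by (intro semisimpleI_root_poly)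
qed

text \<open>If \<open>s\<close> is congruent to \<open>\<mu>\<close> modulo a high power of \<open>x - \<mu>\<close> for each eigenvalue \<open>\<mu>\<close> of \<open>A\<close>, then
  \<open>s A\<close> is annihilated by the product of the \<open>x - \<mu>\<close>, and a power of \<open>x - s\<close> annihilates \<open>A\<close>. That the semisimple
  part is a polynomial in \<open>A\<close> is essential later: it inherits every filtration that \<open>A\<close> preserves.\<close>

lemma jordan_decomposition:
  fixes A :: "complex ^ 'n ^ 'n"
  shows "\<exists>s. semisimple (peval s A) \<and> nilpotent (A - peval s A)"
proof -
  obtain p where p: "p \<noteq> 0" "peval p A = 0" using annihilating_poly_exists by blast
  define M where "M = {z. poly p z = 0}"
  have M: "finite M" unfolding M_def using p(1) by (rule poly_roots_finite)
  \<comment> \<open>Positive, and at least the multiplicity of every root.\<close>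
  define k where "k = Suc (degree p)"
  let ?R = "\<Prod>\<mu>\<in>M. [:- \<mu>, 1:] ^ k"
  have "(\<Prod>z\<in>M. [:-z, 1:] ^ order z p) dvd ?R"
    by (intro prod_dvd_prod le_imp_power_dvd) (auto simp: k_def intro: le_SucI order_degree [OF p(1)])
  then have "smult (lead_coeff p) (\<Prod>z\<in>M. [:-z, 1:] ^ order z p) dvd ?R"
    using p(1) by (intro smult_dvd) auto
  then have "p dvd ?R" unfolding M_def complex_poly_decompose .
  then have R: "peval ?R A = 0" using p(2) by (rule peval_dvd)
  obtain s where s: "\<And>\<mu>. \<mu> \<in> M \<Longrightarrow> [:- \<mu>, 1:] ^ k dvd s - [:\<mu>:]"
    using chinese_remainder_linear_powers[OF M] by blast
  have "?R dvd (\<Prod>\<mu>\<in>M. s - [:\<mu>:])" by (intro prod_dvd_prod s)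
  also have "(\<Prod>\<mu>\<in>M. s - [:\<mu>:]) = pcompose (root_poly M) s"
    unfolding root_poly_def pcompose_prod
    by (intro prod.cong refl) (simp add: pcompose_pCons diff_conv_add_uminus del: add_uminus_conv_diff)
  finally have "peval (pcompose (root_poly M) s) A = 0" using R by (rule peval_dvd)
  then have "semisimple (peval s A)"
    using M by (intro semisimpleI_root_poly) (auto simp: peval_pcompose)
  moreover have "?R dvd ([:0, 1:] - s) ^ k"
  proof (rule prod_linear_dvd[OF M])
    fix \<mu> assume "\<mu> \<in> M"
    then have "[:- \<mu>, 1:] dvd s - [:\<mu>:]"
      using s[of \<mu>] unfolding k_def by (metis dvd_trans dvd_triv_left power_Suc)
    then have "[:- \<mu>, 1:] dvd [:- \<mu>, 1:] - (s - [:\<mu>:])" by (rule dvd_diff [OF dvd_refl])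
    then show "[:- \<mu>, 1:] ^ k dvd ([:0, 1:] - s) ^ k"
      by (intro dvd_power_same) (simp add: algebra_simps)
  qed
  then have "peval (([:0, 1:] - s) ^ k) A = 0" using R by (rule peval_dvd)
  then have "nilpotent (A - peval s A)"
    unfolding nilpotent_def peval_power peval_diff peval_X by blast
  ultimately show ?thesis by blast
qed

section \<open>Curves of matrices and one-parameter groups\<close>

definition mderiv :: "(complex \<Rightarrow> complex ^ 'n ^ 'n) \<Rightarrow> complex ^ 'n ^ 'n \<Rightarrow> complex \<Rightarrow> bool" where
  "mderiv \<gamma> V t \<longleftrightarrow> (\<forall>i j. ((\<lambda>t. \<gamma> t $ i $ j) has_field_derivative V $ i $ j) (at t))"

lemma mderiv_const: "mderiv (\<lambda>_. A) 0 t"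
  by (simp add: mderiv_def)

lemma mderiv_mult:
  assumes "mderiv \<gamma> V t" "mderiv \<delta> W t"
  shows "mderiv (\<lambda>t. \<gamma> t ** \<delta> t) (V ** \<delta> t + \<gamma> t ** W) t"
  unfolding mderiv_def
proof (intro allI)
  fix i j
  have "((\<lambda>t. \<Sum>k\<in>UNIV. \<gamma> t $ i $ k * \<delta> t $ k $ j) has_field_derivative
      (\<Sum>k\<in>UNIV. V $ i $ k * \<delta> t $ k $ j + W $ k $ j * \<gamma> t $ i $ k)) (at t)"
    using assms unfolding mderiv_def by (intro DERIV_sum DERIV_mult) auto
  then show "((\<lambda>t. (\<gamma> t ** \<delta> t) $ i $ j) has_field_derivative (V ** \<delta> t + \<gamma> t ** W) $ i $ j) (at t)"
    by (simp add: matrix_mult_nth sum.distrib mult.commute)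
qed

lemma mderiv_conj:
  fixes P Q V :: "complex ^ 'n ^ 'n"
  assumes "mderiv \<gamma> V t" shows "mderiv (\<lambda>t. P ** \<gamma> t ** Q) (P ** V ** Q) t"
  using mderiv_mult[OF mderiv_mult[OF mderiv_const assms] mderiv_const, of P Q] by simp

lemma mderiv_compose_affine:
  assumes "mderiv \<gamma> V (a * t + b)" shows "mderiv (\<lambda>t. \<gamma> (a * t + b)) (cscale a V) t"
  unfolding mderiv_def
proof (intro allI)
  fix i j
  have "((\<lambda>t. \<gamma> t $ i $ j) has_field_derivative V $ i $ j) (at (a * t + b))"
    using assms by (simp add: mderiv_def)
  moreover have "((\<lambda>t. a * t + b) has_field_derivative a) (at t)"
    by (auto intro!: derivative_eq_intros)
  ultimately show "((\<lambda>t. \<gamma> (a * t + b) $ i $ j) has_field_derivative cscale a V $ i $ j) (at t)"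
    by (drule_tac DERIV_chain2) (auto simp: mult.commute)
qed

lemma mderiv_zero_const:
  assumes "\<And>t. mderiv \<gamma> 0 t" shows "\<gamma> s = \<gamma> t"
proof -
  have "\<gamma> s $ i $ j = \<gamma> t $ i $ j" for i j
    using has_field_derivative_zero_constant[of UNIV "\<lambda>t. \<gamma> t $ i $ j"] assms
    by (simp add: mderiv_def) metis
  then show ?thesis by (simp add: vec_eq_iff)
qed

text \<open>\<open>flow E A\<close> says that \<open>E t = exp (t A)\<close>, through the differential equation that determines \<open>E\<close>.\<close>

definition flow :: "(complex \<Rightarrow> complex ^ 'n ^ 'n) \<Rightarrow> complex ^ 'n ^ 'n \<Rightarrow> bool" where
  "flow E A \<longleftrightarrow> E 0 = mat 1 \<and> (\<forall>t. mderiv E (E t ** A) t \<and> E t ** A = A ** E t)"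

text \<open>\<open>E (r + u) ** E (- u)\<close> has derivative 0 in \<open>u\<close>.\<close>

lemma flow_add:
  assumes "flow E A"
  shows "E (s + t) = E s ** E t"
proof -
  have d: "mderiv E (E t ** A) t" and c: "E t ** A = A ** E t" and z: "E 0 = mat 1" for t
    using assms unfolding flow_def by blast+
  have const: "E (r + u) ** E (- u) = E r" for r u
  proof -
    have "mderiv (\<lambda>u. E (1 * u + r) ** E ((-1) * u + 0)) 0 t" for t
    proof -
      have "mderiv (\<lambda>u. E (1 * u + r) ** E ((-1) * u + 0))
         (cscale 1 (E (1 * t + r) ** A) ** E ((-1) * t + 0)
            + E (1 * t + r) ** cscale (-1) (E ((-1) * t + 0) ** A)) t"
        by (intro mderiv_mult mderiv_compose_affine d)
      moreover have "cscale 1 (E (1 * t + r) ** A) ** E ((-1) * t + 0)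
            + E (1 * t + r) ** cscale (-1) (E ((-1) * t + 0) ** A) = 0"
        by (simp add: c[of "- t"] matrix_ring)
      ultimately show ?thesis by simp
    qed
    from mderiv_zero_const[OF this, of u 0] show ?thesis by (simp add: z add.commute)
  qed
  have inv: "E (- t) ** E t = mat 1"
    using const[of 0 "- t"] by (simp add: z)
  have "E (s + t) = E (s + t) ** (E (- t) ** E t)" by (simp add: inv)
  also have "\<dots> = E s ** E t" by (simp only: matrix_mul_assoc const)
  finally show ?thesis .
qed

lemma flow_0: "flow E A \<Longrightarrow> E 0 = mat 1"
  by (simp add: flow_def)

lemma flow_mderiv_0: "flow E A \<Longrightarrow> mderiv E A 0"
  by (metis flow_def matrix_mul_lid)

lemma flow_mderiv: "flow E A \<Longrightarrow> mderiv E (E t ** A) t"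
  unfolding flow_def by blast

lemma flow_minus:
  assumes "flow E A" shows "E t ** E (- t) = mat 1" "E (- t) ** E t = mat 1"
  using flow_add[OF assms, of t "- t"] flow_add[OF assms, of "- t" t] flow_0[OF assms] by simp_all

lemma flow_invertible: "flow E A \<Longrightarrow> invertible (E t)"
  using flow_minus unfolding invertible_def by blast

lemma flow_matrix_inv: "flow E A \<Longrightarrow> matrix_inv (E t) = E (- t)"
  by (intro matrix_inv_eqI flow_minus)

lemma flowI:
  assumes "\<And>s t. E (s + t) = E s ** E t" "E 0 = mat 1" "mderiv E A 0"
  shows "flow E A"
  unfolding flow_def
proof (intro conjI allI)
  fix t
  have "mderiv (\<lambda>u. E (1 * u + (- t))) (cscale 1 A) t"
    using assms(3) by (intro mderiv_compose_affine) simp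
  then have *: "mderiv (\<lambda>u. E (u - t)) A t" by simp
  have "mderiv (\<lambda>u. E t ** E (u - t)) (E t ** A) t" "mderiv (\<lambda>u. E (u - t) ** E t) (A ** E t) t"
    using mderiv_mult[OF mderiv_const *, of "E t"] mderiv_mult[OF * mderiv_const, of "E t"] by simp_all
  moreover have "(\<lambda>u. E t ** E (u - t)) = E" "(\<lambda>u. E (u - t) ** E t) = E"
    by (simp_all add: assms(1) [symmetric])
  ultimately have d: "mderiv E (E t ** A) t" "mderiv E (A ** E t) t" by simp_all
  then show "mderiv E (E t ** A) t" by simp
  have "(E t ** A) $ i $ j = (A ** E t) $ i $ j" for i j
    using d unfolding mderiv_def by (meson DERIV_unique)
  then show "E t ** A = A ** E t" by (simp add: vec_eq_iff)
qed (rule assms(2))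

lemma flow_semisimple:
  fixes P Q :: "complex ^ 'n ^ 'n"
  assumes "Q ** P = mat 1" "P ** Q = mat 1"
  shows "flow (\<lambda>t. P ** diag (\<lambda>i. exp (t * m i)) ** Q) (P ** diag m ** Q)"
proof (rule flowI)
  fix s t
  have "P ** diag (\<lambda>i. exp (s * m i)) ** Q ** (P ** diag (\<lambda>i. exp (t * m i)) ** Q)
      = P ** diag (\<lambda>i. exp (s * m i)) ** (Q ** P) ** diag (\<lambda>i. exp (t * m i)) ** Q"
    by (simp add: matrix_mul_assoc)
  also have "\<dots> = P ** diag (\<lambda>i. exp ((s + t) * m i)) ** Q"
    by (simp add: assms matrix_mul_assoc [symmetric] exp_add distrib_right)
       (simp add: matrix_mul_assoc diag_mult [symmetric])
  finally show "P ** diag (\<lambda>i. exp ((s + t) * m i)) ** Q =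
      P ** diag (\<lambda>i. exp (s * m i)) ** Q ** (P ** diag (\<lambda>i. exp (t * m i)) ** Q)" by simp
next
  have "diag (\<lambda>i. 1) = (mat 1 :: complex ^ 'n ^ 'n)" by (simp add: vec_eq_iff diag_nth mat_def)
  then show "P ** diag (\<lambda>i. exp (0 * m i)) ** Q = mat 1" using assms by simp
next
  have "mderiv (\<lambda>t. diag (\<lambda>i. exp (t * m i))) (diag m) 0"
    by (auto simp: mderiv_def diag_nth intro!: derivative_eq_intros)
  then show "mderiv (\<lambda>t. P ** diag (\<lambda>i. exp (t * m i)) ** Q) (P ** diag m ** Q) 0"
    by (rule mderiv_conj)
qed

text \<open>The exponential series cut off at order \<open>K\<close>; it equals \<open>exp (t N)\<close> if the \<open>K\<close>-th power of \<open>N\<close> vanishes.\<close>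

definition nilexp :: "complex ^ 'n ^ 'n \<Rightarrow> nat \<Rightarrow> complex \<Rightarrow> complex ^ 'n ^ 'n" where
  "nilexp N K t = (\<Sum>k<K. cscale (t ^ k / fact k) (mpow N k))"

lemma flow_nilpotent:
  assumes "mpow N K = 0"
  shows "flow (nilexp N K) N"
  unfolding flow_def
proof (intro conjI allI)
  have "K \<noteq> 0" using assms by (auto simp: mat_1_neq_0 intro: gr0I)
  then obtain L where L: "K = Suc L" by (cases K) auto
  have "nilexp N K 0 = (\<Sum>k<Suc L. if k = 0 then mat 1 else 0)"
    unfolding nilexp_def L by (intro sum.cong refl) auto
  then show "nilexp N K 0 = mat 1" by simp
  fix t
  have "nilexp N K t ** N = (\<Sum>k<Suc L. cscale (t ^ k / fact k) (mpow N (Suc k)))"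
    unfolding nilexp_def L by (simp add: matrix_sum_mult matrix_add_rdistrib cscale_mult_left mpow_Suc2)
  also have "\<dots> = (\<Sum>k<L. cscale (t ^ k / fact k) (mpow N (Suc k)))"
    using assms by (simp add: L)
  finally have r: "nilexp N K t ** N = (\<Sum>k<L. cscale (t ^ k / fact k) (mpow N (Suc k)))" .
  have der: "((\<lambda>t. t ^ Suc k / fact (Suc k)) has_field_derivative t ^ k / fact k) (at t)" for k
  proof -
    have "((\<lambda>t. t ^ Suc k / fact (Suc k)) has_field_derivative of_nat (Suc k) * t ^ k / fact (Suc k)) (at t)"
      using DERIV_cdivide [OF DERIV_power [OF DERIV_ident, of "Suc k" t], of "fact (Suc k)"]
      by (simp del: of_nat_Suc power_Suc fact_Suc)
    moreover have "of_nat (Suc k) * t ^ k / fact (Suc k) = t ^ k / (fact k :: complex)"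
      by (simp add: divide_simps del: of_nat_Suc)
    ultimately show ?thesis by simp
  qed
  show "mderiv (nilexp N K) (nilexp N K t ** N) t"
    unfolding mderiv_def r
  proof (intro allI)
    fix i j
    have "((\<lambda>t. mpow N 0 $ i $ j + (\<Sum>k<L. t ^ Suc k / fact (Suc k) * mpow N (Suc k) $ i $ j)) has_field_derivative
        0 + (\<Sum>k<L. t ^ k / fact k * mpow N (Suc k) $ i $ j)) (at t)"
      by (intro DERIV_add DERIV_const DERIV_sum DERIV_cmult_right der)
    then show "((\<lambda>t. nilexp N K t $ i $ j) has_field_derivative
        (\<Sum>k<L. cscale (t ^ k / fact k) (mpow N (Suc k))) $ i $ j) (at t)"
      unfolding nilexp_def L sum.lessThan_Suc_shift by (simp add: sum_matrix_nth)
  qed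
  show "nilexp N K t ** N = N ** nilexp N K t"
    unfolding nilexp_def
    by (simp add: matrix_sum_mult matrix_mult_sum_right cscale_mult_left cscale_mult_right
        mpow_Suc2 [symmetric] mpow_Suc [symmetric])
qed

text \<open>\<open>E u ** B ** E (- u)\<close> has derivative 0 in \<open>u\<close>.\<close>

lemma flow_commute:
  assumes "flow E A" "A ** B = B ** A"
  shows "E t ** B = B ** E t"
proof -
  have d: "mderiv E (E t ** A) t" and c: "E t ** A = A ** E t" for t
    using assms unfolding flow_def by blast+
  have "mderiv (\<lambda>u. E (1 * u + 0) ** B ** E ((-1) * u + 0)) 0 t" for t
  proof -
    have "mderiv (\<lambda>u. E (1 * u + 0) ** B ** E ((-1) * u + 0))
       ((cscale 1 (E (1 * t + 0) ** A) ** B + E (1 * t + 0) ** 0) ** E ((-1) * t + 0)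
          + (E (1 * t + 0) ** B) ** cscale (-1) (E ((-1) * t + 0) ** A)) t"
      by (intro mderiv_mult mderiv_compose_affine d mderiv_const)
    moreover have "E t ** A ** B = E t ** B ** A"
      using assms(2) by (simp add: matrix_mul_assoc [symmetric])
    ultimately show ?thesis by (simp add: c[of "- t"] matrix_ring)
  qed
  from mderiv_zero_const[OF this, of t 0] have *: "E t ** B ** E (- t) = B"
    using flow_0[OF assms(1)] by simp
  have "E t ** B = E t ** B ** (E (- t) ** E t)" by (simp add: flow_minus[OF assms(1)])
  also have "\<dots> = B ** E t" by (simp only: matrix_mul_assoc *)
  finally show ?thesis .
qed

lemma flow_product:
  assumes E: "flow E A" and F: "flow F B" and "A ** B = B ** A"
  shows "flow (\<lambda>t. E t ** F t) (A + B)"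
proof (rule flowI)
  have c: "E t ** F s = F s ** E t" for s t
    by (rule flow_commute[OF E]) (metis flow_commute[OF F] assms(3))
  fix s t
  have "E (s + t) ** F (s + t) = E s ** (E t ** F s) ** F t"
    by (simp add: flow_add[OF E] flow_add[OF F] matrix_mul_assoc)
  also have "\<dots> = E s ** F s ** (E t ** F t)" by (simp only: c[of t s] matrix_mul_assoc)
  finally show "E (s + t) ** F (s + t) = E s ** F s ** (E t ** F t)" .
next
  show "E 0 ** F 0 = mat 1" using E F by (simp add: flow_0)
  show "mderiv (\<lambda>t. E t ** F t) (A + B) 0"
    using mderiv_mult[OF flow_mderiv_0[OF E] flow_mderiv_0[OF F]] E F by (simp add: flow_0)
qed

section \<open>Exponential polynomials\<close>

text \<open>Exponential polynomials, with one variable \<open>s\<close> for the exponentials and another, \<open>t\<close>, for the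
  polynomial coefficients. The two variables are those of the semisimple and of the nilpotent factor of
  a flow.\<close>

inductive exppoly :: "(complex \<Rightarrow> complex \<Rightarrow> complex) \<Rightarrow> bool" where
  const: "exppoly (\<lambda>s t. c)"
| exp: "exppoly (\<lambda>s t. exp (s * \<mu>))"
| var: "exppoly (\<lambda>s t. t)"
| add: "exppoly F \<Longrightarrow> exppoly G \<Longrightarrow> exppoly (\<lambda>s t. F s t + G s t)"
| mult: "exppoly F \<Longrightarrow> exppoly G \<Longrightarrow> exppoly (\<lambda>s t. F s t * G s t)"

definition expsum :: "complex set \<Rightarrow> (complex \<Rightarrow> complex poly) \<Rightarrow> complex \<Rightarrow> complex \<Rightarrow> complex" where
  "expsum M q s t = (\<Sum>\<mu>\<in>M. exp (s * \<mu>) * poly (q \<mu>) t)"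

lemma exppoly_normal_form:
  assumes "exppoly F"
  shows "\<exists>M q. finite M \<and> F = expsum M q"
  using assms
proof induction
  case (const c)
  show ?case by (rule exI[of _ "{0}"], rule exI[of _ "\<lambda>_. [:c:]"]) (simp add: expsum_def fun_eq_iff)
next
  case (exp \<mu>)
  show ?case by (rule exI[of _ "{\<mu>}"], rule exI[of _ "\<lambda>_. 1"]) (simp add: expsum_def fun_eq_iff)
next
  case var
  show ?case by (rule exI[of _ "{0}"], rule exI[of _ "\<lambda>_. [:0, 1:]"]) (simp add: expsum_def fun_eq_iff)
next
  case (add F G)
  then obtain M q M' q' where M: "finite M" "F = expsum M q" and M': "finite M'" "G = expsum M' q'"
    by blast
  define r where "r \<mu> = (if \<mu> \<in> M then q \<mu> else 0) + (if \<mu> \<in> M' then q' \<mu> else 0)" for \<mu>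
  have "expsum (M \<union> M') r s t = F s t + G s t" for s t
  proof -
    have "F s t = (\<Sum>\<mu>\<in>M \<union> M'. exp (s * \<mu>) * poly (if \<mu> \<in> M then q \<mu> else 0) t)"
      unfolding M(2) expsum_def using M(1) M'(1) by (intro sum.mono_neutral_cong_left) auto
    moreover have "G s t = (\<Sum>\<mu>\<in>M \<union> M'. exp (s * \<mu>) * poly (if \<mu> \<in> M' then q' \<mu> else 0) t)"
      unfolding M'(2) expsum_def using M(1) M'(1) by (intro sum.mono_neutral_cong_left) auto
    ultimately show ?thesis
      by (simp add: expsum_def r_def distrib_left sum.distrib [symmetric])
  qed
  then show ?case using M(1) M'(1) by (intro exI[of _ "M \<union> M'"] exI[of _ r]) (auto simp: fun_eq_iff)
next
  case (mult F G)
  then obtain M q M' q' where M: "finite M" "F = expsum M q" and M': "finite M'" "G = expsum M' q'"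
    by blast
  define f where "f = (\<lambda>p. fst p + snd p :: complex)"
  define r where "r \<kappa> = (\<Sum>p | p \<in> M \<times> M' \<and> f p = \<kappa>. q (fst p) * q' (snd p))" for \<kappa>
  have "expsum (f ` (M \<times> M')) r s t = F s t * G s t" for s t
  proof -
    have "F s t * G s t = (\<Sum>p\<in>M \<times> M'. exp (s * f p) * poly (q (fst p) * q' (snd p)) t)"
      unfolding M(2) M'(2) expsum_def sum_product sum.cartesian_product
      by (intro sum.cong refl) (auto simp: f_def exp_add distrib_left)
    also have "\<dots> = (\<Sum>\<kappa>\<in>f ` (M \<times> M'). \<Sum>p | p \<in> M \<times> M' \<and> f p = \<kappa>. exp (s * f p) * poly (q (fst p) * q' (snd p)) t)"
      using M(1) M'(1) by (intro sum.image_gen) auto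
    also have "\<dots> = expsum (f ` (M \<times> M')) r s t"
      unfolding expsum_def r_def poly_sum sum_distrib_left by (intro sum.cong refl) auto
    finally show ?thesis by simp
  qed
  then show ?case using M(1) M'(1)
    by (intro exI[of _ "f ` (M \<times> M')"] exI[of _ r]) (auto simp: fun_eq_iff)
qed

text \<open>Induction on the total size of the coefficients. If \<open>q \<mu> \<noteq> 0\<close>, the operator \<open>d/dt - \<mu>\<close> lowers the degree of
  \<open>q \<mu>\<close> and does not raise the others, so it makes all coefficients vanish. This is possible
  only if \<open>q \<mu>\<close> is a constant and all other coefficients are 0; the sum is then \<open>q \<mu>\<close> times an exponential.\<close>

lemma expsum_independent:
  assumes "finite M" "\<And>t. expsum M q t t = 0" "\<mu> \<in> M"
  shows "q \<mu> = 0"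
  using assms(2,3)
proof (induction "\<Sum>\<mu>\<in>M. if q \<mu> = 0 then 0 else Suc (degree (q \<mu>))" arbitrary: q \<mu> rule: less_induct)
  case less
  show ?case
  proof (rule ccontr)
    assume nz: "q \<mu> \<noteq> 0"
    \<comment> \<open>The coefficients after applying \<open>d/dt - \<mu>\<close>.\<close>
    define r where "r \<nu> = pderiv (q \<nu>) + smult (\<nu> - \<mu>) (q \<nu>)" for \<nu>
    have r0: "expsum M r t t = 0" for t
    proof -
      have "((\<lambda>t. expsum M q t t) has_field_derivative
          (\<Sum>\<nu>\<in>M. exp (t * \<nu>) * \<nu> * poly (q \<nu>) t + exp (t * \<nu>) * poly (pderiv (q \<nu>)) t)) (at t)"
        unfolding expsum_def
      proof (rule DERIV_sum)
        fix \<nu>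
        have "((\<lambda>t. exp (t * \<nu>)) has_field_derivative exp (t * \<nu>) * \<nu>) (at t)"
          by (auto intro!: derivative_eq_intros)
        from DERIV_mult [OF this poly_DERIV [of "q \<nu>" t]]
        show "((\<lambda>t. exp (t * \<nu>) * poly (q \<nu>) t) has_field_derivative
            exp (t * \<nu>) * \<nu> * poly (q \<nu>) t + exp (t * \<nu>) * poly (pderiv (q \<nu>)) t) (at t)"
          by (simp add: mult_ac)
      qed
      moreover have "(\<lambda>t. expsum M q t t) = (\<lambda>t. 0)" using less.prems by blast
      ultimately have "((\<lambda>t. 0) has_field_derivative
          (\<Sum>\<nu>\<in>M. exp (t * \<nu>) * \<nu> * poly (q \<nu>) t + exp (t * \<nu>) * poly (pderiv (q \<nu>)) t)) (at t)"
        by simp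
      from DERIV_unique [OF this DERIV_const]
      have 1: "(\<Sum>\<nu>\<in>M. exp (t * \<nu>) * \<nu> * poly (q \<nu>) t + exp (t * \<nu>) * poly (pderiv (q \<nu>)) t) = 0" .
      have "expsum M r t t = (\<Sum>\<nu>\<in>M. exp (t * \<nu>) * \<nu> * poly (q \<nu>) t + exp (t * \<nu>) * poly (pderiv (q \<nu>)) t)
           - \<mu> * expsum M q t t"
        unfolding expsum_def r_def sum_distrib_left sum_subtractf [symmetric]
        by (intro sum.cong refl) (simp add: algebra_simps)
      then show ?thesis using 1 less.prems by simp
    qed
    have le: "(if r \<nu> = 0 then 0 else Suc (degree (r \<nu>))) \<le> (if q \<nu> = 0 then 0 else Suc (degree (q \<nu>)))" for \<nu>
    proof (cases "q \<nu> = 0")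
      case False
      have "degree (r \<nu>) \<le> degree (q \<nu>)"
        unfolding r_def by (intro degree_add_le) (simp_all add: degree_pderiv)
      then show ?thesis using False by simp
    qed (simp add: r_def)
    have "(if r \<mu> = 0 then 0 else Suc (degree (r \<mu>))) < (if q \<mu> = 0 then 0 else Suc (degree (q \<mu>)))"
      using nz by (auto simp: r_def degree_pderiv pderiv_eq_0_iff)
    then have "(\<Sum>\<nu>\<in>M. if r \<nu> = 0 then 0 else Suc (degree (r \<nu>)))
        < (\<Sum>\<nu>\<in>M. if q \<nu> = 0 then 0 else Suc (degree (q \<nu>)))"
      using less.prems(2) assms(1) by (intro sum_strict_mono_ex1 ballI bexI [of _ \<mu>] le)
    from less.hyps[OF this r0] have rz: "r \<nu> = 0" if "\<nu> \<in> M" for \<nu> using that by blast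
    have "q \<nu> = 0" if "\<nu> \<in> M" "\<nu> \<noteq> \<mu>" for \<nu>
    proof (rule ccontr)
      assume "q \<nu> \<noteq> 0"
      have *: "pderiv (q \<nu>) = - smult (\<nu> - \<mu>) (q \<nu>)"
        using rz[OF that(1)] by (simp add: r_def add_eq_0_iff2)
      then have "degree (pderiv (q \<nu>)) = degree (q \<nu>)" using that(2) by simp
      then have "degree (q \<nu>) = 0" by (simp add: degree_pderiv)
      then have "pderiv (q \<nu>) = 0" by (simp add: pderiv_eq_0_iff)
      then show False using * that(2) \<open>q \<nu> \<noteq> 0\<close> by simp
    qed
    then have "expsum M q 0 0 = poly (q \<mu>) 0"
      unfolding expsum_def using less.prems(2) assms(1) by (simp add: sum.remove[of M \<mu>])
    then have "poly (q \<mu>) 0 = 0" using less.prems(1) by simp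
    moreover have "degree (q \<mu>) = 0"
      using rz[OF less.prems(2)] by (simp add: r_def pderiv_eq_0_iff)
    then obtain c where "q \<mu> = [:c:]" by (rule degree_eq_zeroE)
    ultimately show False using nz by simp
  qed
qed

text \<open>A relation that holds along \<open>exp (t S) ** exp (t N)\<close> thus holds on all \<open>exp (s S) ** exp (t N)\<close>, in
  particular on the semisimple factor alone.\<close>

lemma exppoly_diagonal_zero:
  assumes "exppoly F" "\<And>t. F t t = 0"
  shows "F s t = 0"
proof -
  obtain M q where M: "finite M" "F = expsum M q" using exppoly_normal_form[OF assms(1)] by blast
  then have "q \<mu> = 0" if "\<mu> \<in> M" for \<mu> using expsum_independent[of M q \<mu>] that assms(2) by simp
  then show ?thesis by (simp add: M expsum_def)
qed

lemma exp_sum_independent: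
  assumes "finite M" "\<And>t. (\<Sum>\<mu>\<in>M. exp (t * \<mu>) * c \<mu>) = (0 :: complex)" "\<mu> \<in> M"
  shows "c \<mu> = 0"
  using expsum_independent[of M "\<lambda>\<mu>. [:c \<mu>:]" \<mu>] assms by (simp add: expsum_def)

lemma exppoly_sum: "(\<And>i. i \<in> I \<Longrightarrow> exppoly (F i)) \<Longrightarrow> exppoly (\<lambda>s t. \<Sum>i\<in>I. F i s t)"
  by (induction I rule: infinite_finite_induct) (auto intro: exppoly.intros exppoly.const[of 0])

lemma exppoly_power: "exppoly (\<lambda>s t. t ^ k)"
  by (induction k) (auto intro: exppoly.intros exppoly.const[of 1])

definition mexppoly :: "(complex \<Rightarrow> complex \<Rightarrow> complex ^ 'n ^ 'n) \<Rightarrow> bool" where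
  "mexppoly X \<longleftrightarrow> (\<forall>i j. exppoly (\<lambda>s t. X s t $ i $ j))"

lemma mexppoly_const: "mexppoly (\<lambda>_ _. A)"
  by (auto simp: mexppoly_def intro: exppoly.const)

lemma mexppoly_mult: "mexppoly X \<Longrightarrow> mexppoly Y \<Longrightarrow> mexppoly (\<lambda>s t. X s t ** Y s t)"
  unfolding mexppoly_def matrix_mult_nth by (auto intro!: exppoly_sum exppoly.mult)

lemma mexppoly_diag: "mexppoly (\<lambda>s t. diag (\<lambda>i. exp (s * m i)))"
  unfolding mexppoly_def
proof (intro allI)
  fix i j show "exppoly (\<lambda>s t. diag (\<lambda>i. exp (s * m i)) $ i $ j)"
    by (cases "i = j") (auto simp: diag_nth intro: exppoly.exp exppoly.const)
qed

lemma mexppoly_nilexp: "mexppoly (\<lambda>s t. nilexp N K t)"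
proof -
  have "exppoly (\<lambda>s t. (t ^ k / fact k) * c)" for k c
    unfolding divide_inverse by (intro exppoly.mult exppoly_power exppoly.const)
  then show ?thesis
    unfolding mexppoly_def nilexp_def by (auto simp: sum_matrix_nth intro!: exppoly_sum)
qed

lemma poly_fun_exppoly:
  assumes "poly_fun f" "mexppoly X" shows "exppoly (\<lambda>s t. f (X s t))"
  using assms by induction (auto intro: exppoly.intros simp: mexppoly_def)

text \<open>The flow of a matrix is the product of the commuting flows of its Jordan parts; their entries are exponentials
  and polynomials, respectively.\<close>

lemma jordan_flow:
  fixes A :: "complex ^ 'n ^ 'n"
  obtains s ES EN where "semisimple (peval s A)" "nilpotent (A - peval s A)"
    "flow ES (peval s A)" "flow EN (A - peval s A)" "flow (\<lambda>t. ES t ** EN t) A"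
    "mexppoly (\<lambda>s t. ES s ** EN t)"
proof -
  obtain s where s: "semisimple (peval s A)" "nilpotent (A - peval s A)"
    using jordan_decomposition by blast
  let ?S = "peval s A" and ?N = "A - peval s A"
  obtain P Q :: "complex ^ 'n ^ 'n" and m where P: "Q ** P = mat 1" "P ** Q = mat 1" "?S = P ** diag m ** Q"
    using s(1) by (rule semisimpleE)
  define ES where "ES t = P ** diag (\<lambda>i. exp (t * m i)) ** Q" for t
  obtain K where K: "mpow ?N K = 0" using s(2) unfolding nilpotent_def by blast
  have ES: "flow ES ?S"
    unfolding P(3) ES_def by (intro flow_semisimple P(1,2))
  have EN: "flow (nilexp ?N K) ?N" using K by (rule flow_nilpotent)
  have "?S ** ?N = ?N ** ?S"
    by (simp add: matrix_ring peval_commute_self)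
  then have "flow (\<lambda>t. ES t ** nilexp ?N K t) (?S + ?N)" by (rule flow_product[OF ES EN])
  moreover have "mexppoly (\<lambda>s t. ES s ** nilexp ?N K t)"
    unfolding ES_def by (intro mexppoly_mult mexppoly_const mexppoly_diag mexppoly_nilexp)
  ultimately show ?thesis using that[OF s ES EN] by simp
qed

lemma flow_exists: "\<exists>E. flow E A"
  using jordan_flow[of A] by metis

section \<open>Polynomial functions and their gradients\<close>

lemma poly_fun_sum: "(\<And>i. i \<in> I \<Longrightarrow> poly_fun (f i)) \<Longrightarrow> poly_fun (\<lambda>A. \<Sum>i\<in>I. f i A)"
  by (induction I rule: infinite_finite_induct) (auto intro: poly_fun.add poly_fun.const[of 0])

lemma poly_fun_prod: "(\<And>i. i \<in> I \<Longrightarrow> poly_fun (f i)) \<Longrightarrow> poly_fun (\<lambda>A. \<Prod>i\<in>I. f i A)"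
  by (induction I rule: infinite_finite_induct) (auto intro: poly_fun.mult poly_fun.const[of 1])

lemma poly_fun_power: "poly_fun f \<Longrightarrow> poly_fun (\<lambda>A. f A ^ k)"
  by (induction k) (auto intro: poly_fun.mult poly_fun.const[of 1])

lemma poly_fun_diff:
  assumes "poly_fun f" "poly_fun g" shows "poly_fun (\<lambda>A. f A - g A)"
  using poly_fun.add[OF assms(1) poly_fun.mult[OF poly_fun.const[of "-1"] assms(2)]] by simp

lemma poly_fun_det: "poly_fun (\<lambda>A :: complex ^ 'n ^ 'n. det A)"
  unfolding det_def by (intro poly_fun_sum poly_fun.mult poly_fun.const poly_fun_prod poly_fun.entry)

lemma poly_fun_subst:
  assumes "poly_fun f" "\<And>i j. poly_fun (\<lambda>X. \<Phi> X $ i $ j)"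
  shows "poly_fun (\<lambda>X. f (\<Phi> X))"
  using assms(1) by induction (auto intro: poly_fun.intros(1,3,4) assms(2))

lemma poly_fun_mult_left: "poly_fun (\<lambda>X. (B ** X) $ i $ j)"
  and poly_fun_mult_right: "poly_fun (\<lambda>X. (X ** B) $ i $ j)"
  unfolding matrix_mult_nth by (intro poly_fun_sum poly_fun.mult poly_fun.const poly_fun.entry)+

text \<open>Every linear functional on matrices has this form, in which continuity is evident.\<close>

definition contract :: "('n \<Rightarrow> 'n \<Rightarrow> complex) \<Rightarrow> complex ^ 'n ^ 'n \<Rightarrow> complex" where
  "contract c V = (\<Sum>i\<in>UNIV. \<Sum>j\<in>UNIV. c i j * V $ i $ j)"

lemma contract_add: "contract c (V + W) = contract c V + contract c W"
  by (simp add: contract_def distrib_left sum.distrib)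

lemma contract_cscale: "contract c (cscale a V) = a * contract c V"
  by (simp add: contract_def sum_distrib_left mult_ac)

lemma contract_0 [simp]: "contract c 0 = 0"
  by (simp add: contract_def)

lemma contract_sum: "contract c (\<Sum>i\<in>I. f i) = (\<Sum>i\<in>I. contract c (f i))"
  by (induction I rule: infinite_finite_induct) (auto simp: contract_add)

lemma contract_mderiv:
  assumes "mderiv \<gamma> V t" shows "((\<lambda>t. contract c (\<gamma> t)) has_field_derivative contract c V) (at t)"
  unfolding contract_def using assms by (intro DERIV_sum DERIV_cmult) (auto simp: mderiv_def)

text \<open>The chain rule along arbitrary curves; the partial derivatives are again polynomials.\<close>

definition gradient_of :: "('n \<Rightarrow> 'n \<Rightarrow> complex ^ 'n ^ 'n \<Rightarrow> complex) \<Rightarrow> (complex ^ 'n ^ 'n \<Rightarrow> complex) \<Rightarrow> bool" where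
  "gradient_of g f \<longleftrightarrow> (\<forall>i j. poly_fun (g i j)) \<and> (\<forall>\<gamma> V t. mderiv \<gamma> V t \<longrightarrow>
    ((\<lambda>t. f (\<gamma> t)) has_field_derivative contract (\<lambda>i j. g i j (\<gamma> t)) V) (at t))"

lemma gradient_of_poly_fun: "gradient_of g f \<Longrightarrow> poly_fun (g i j)"
  and gradient_of_deriv: "gradient_of g f \<Longrightarrow> mderiv \<gamma> V t \<Longrightarrow>
    ((\<lambda>t. f (\<gamma> t)) has_field_derivative contract (\<lambda>i j. g i j (\<gamma> t)) V) (at t)"
  unfolding gradient_of_def by blast+

lemma poly_fun_gradient:
  assumes "poly_fun f"
  shows "\<exists>g. gradient_of g f"
  using assms
proof induction
  case (const c)
  show ?case
    by (rule exI[of _ "\<lambda>i j A. 0"]) (auto intro: poly_fun.const simp: contract_def gradient_of_def)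
next
  case (entry i j)
  have "((\<lambda>t. \<gamma> t $ i $ j) has_field_derivative
      contract (\<lambda>k l. if k = i then if l = j then 1 else 0 else 0) V) (at t)"
    if "mderiv \<gamma> V t" for \<gamma> V t
  proof -
    have "contract (\<lambda>k l. if k = i then if l = j then 1 else 0 else 0) V
        = (\<Sum>k\<in>UNIV. if k = i then \<Sum>l\<in>UNIV. if l = j then V $ k $ l else 0 else 0)"
      unfolding contract_def by (intro sum.cong refl) (auto simp: if_distrib [of "\<lambda>x. x * _"] cong: if_cong)
    also have "\<dots> = V $ i $ j" by simp
    finally show ?thesis using that by (simp add: mderiv_def)
  qed
  then show ?case
    by (intro exI[of _ "\<lambda>k l A. if k = i then if l = j then 1 else 0 else 0"])
      (auto intro: poly_fun.const simp: gradient_of_def)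
next
  case (add f g)
  then obtain a b where "gradient_of a f" "gradient_of b g" by blast
  note a = gradient_of_poly_fun[OF this(1)] gradient_of_deriv[OF this(1)]
    and b = gradient_of_poly_fun[OF this(2)] gradient_of_deriv[OF this(2)]
  have "((\<lambda>t. f (\<gamma> t) + g (\<gamma> t)) has_field_derivative contract (\<lambda>i j. a i j (\<gamma> t) + b i j (\<gamma> t)) V) (at t)"
    if "mderiv \<gamma> V t" for \<gamma> V t
    using DERIV_add[OF a(2) b(2), OF that that] by (simp add: contract_def distrib_right sum.distrib)
  then show ?case
    by (intro exI[of _ "\<lambda>i j A. a i j A + b i j A"] conjI allI impI poly_fun.add a(1) b(1)
        gradient_of_def [THEN iffD2])
next
  case (mult f g)
  then obtain a b where "gradient_of a f" "gradient_of b g" by blast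
  note a = gradient_of_poly_fun[OF this(1)] gradient_of_deriv[OF this(1)]
    and b = gradient_of_poly_fun[OF this(2)] gradient_of_deriv[OF this(2)]
  have "((\<lambda>t. f (\<gamma> t) * g (\<gamma> t)) has_field_derivative
      contract (\<lambda>i j. a i j (\<gamma> t) * g (\<gamma> t) + b i j (\<gamma> t) * f (\<gamma> t)) V) (at t)"
    if "mderiv \<gamma> V t" for \<gamma> V t
    using DERIV_mult[OF a(2) b(2), OF that that]
    by (simp add: contract_def distrib_right distrib_left sum.distrib sum_distrib_right sum_distrib_left mult_ac)
  then show ?case
    by (intro exI[of _ "\<lambda>i j A. a i j A * g A + b i j A * f A"] conjI allI impI
        poly_fun.add poly_fun.mult a(1) b(1) mult.hyps gradient_of_def [THEN iffD2])
qed

section \<open>The Lie algebra of an algebraic group\<close>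

definition vanishes_on :: "(complex ^ 'n ^ 'n) set \<Rightarrow> (complex ^ 'n ^ 'n \<Rightarrow> complex) \<Rightarrow> bool" where
  "vanishes_on G f \<longleftrightarrow> poly_fun f \<and> (\<forall>g\<in>G. f g = 0)"

lemma mderiv_line: "mderiv (\<lambda>t. mat 1 + cscale t A) A t"
  by (auto simp: mderiv_def intro!: derivative_eq_intros)

text \<open>The equations are the gradients at the identity of the polynomials vanishing on \<open>G\<close>. Knowing only
  that \<open>lie_alg G\<close> is cut out by linear functionals suffices to take derivatives and to compare
  coefficients inside it.\<close>

lemma lie_alg_linear:
  fixes G :: "(complex ^ 'n ^ 'n) set"
  shows "\<exists>C. lie_alg G = {A. \<forall>c\<in>C. contract c A = 0}"
proof -
  define C where "C = {c. \<exists>f. vanishes_on G f \<and> (\<forall>\<gamma> V. mderiv \<gamma> V 0 \<longrightarrow> \<gamma> 0 = mat 1 \<longrightarrow>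
    ((\<lambda>t. f (\<gamma> t)) has_field_derivative contract c V) (at 0))}"
  have ex: "\<exists>c\<in>C. (\<forall>\<gamma> V. mderiv \<gamma> V 0 \<longrightarrow> \<gamma> 0 = mat 1 \<longrightarrow>
      ((\<lambda>t. f (\<gamma> t)) has_field_derivative contract c V) (at 0))" if "vanishes_on G f" for f
  proof -
    have "poly_fun f" using that by (simp add: vanishes_on_def)
    then obtain g where "gradient_of g f" using poly_fun_gradient by blast
    note g = gradient_of_deriv[OF this]
    have "((\<lambda>t. f (\<gamma> t)) has_field_derivative contract (\<lambda>i j. g i j (mat 1)) V) (at 0)"
      if "mderiv \<gamma> V 0" "\<gamma> 0 = mat 1" for \<gamma> V
      using g[OF that(1)] that(2) by simp
    then show ?thesis using that by (intro bexI[of _ "\<lambda>i j. g i j (mat 1)"]) (auto simp: C_def)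
  qed
  have line: "((\<lambda>t. f (mat 1 + cscale t A)) has_field_derivative contract c A) (at 0)"
    if "\<forall>\<gamma> V. mderiv \<gamma> V 0 \<longrightarrow> \<gamma> 0 = mat 1 \<longrightarrow>
    ((\<lambda>t. f (\<gamma> t)) has_field_derivative contract c V) (at 0)" for f c A
    using that[rule_format, OF mderiv_line] by simp
  have "lie_alg G = {A. \<forall>c\<in>C. contract c A = 0}"
  proof (intro equalityI subsetI CollectI ballI)
    fix A c assume A: "A \<in> lie_alg G" and "c \<in> C"
    then obtain f where f: "vanishes_on G f"
      "((\<lambda>t. f (mat 1 + cscale t A)) has_field_derivative contract c A) (at 0)"
      unfolding C_def using line by blast
    then have "((\<lambda>t. f (mat 1 + cscale t A)) has_field_derivative 0) (at 0)"
      using A unfolding lie_alg_def vanishes_on_def by blast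
    then show "contract c A = 0" using f(2) DERIV_unique by blast
  next
    fix A assume A: "A \<in> {A. \<forall>c\<in>C. contract c A = 0}"
    have "((\<lambda>t. f (mat 1 + cscale t A)) has_field_derivative 0) (at 0)" if f: "vanishes_on G f" for f
    proof -
      obtain c where "c \<in> C"
        "((\<lambda>t. f (mat 1 + cscale t A)) has_field_derivative contract c A) (at 0)"
        using ex[OF f] line by blast
      then show ?thesis using A by simp
    qed
    then show "A \<in> lie_alg G" unfolding lie_alg_def vanishes_on_def by blast
  qed
  then show ?thesis by blast
qed

lemma lie_alg_subspace: "cmat.subspace (lie_alg G)"
proof -
  obtain C where C: "lie_alg G = {A. \<forall>c\<in>C. contract c A = 0}" using lie_alg_linear by blast
  show ?thesis unfolding C cmat.subspace_def by (auto simp: contract_add contract_cscale)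
qed

lemma lie_algI_curve:
  assumes "mderiv \<gamma> A 0" "\<gamma> 0 = mat 1" "\<And>t. \<gamma> t \<in> G"
  shows "A \<in> lie_alg G"
proof -
  have "((\<lambda>t. f (mat 1 + cscale t A)) has_field_derivative 0) (at 0)" if f: "vanishes_on G f" for f
  proof -
    have "poly_fun f" using f by (simp add: vanishes_on_def)
    then obtain g where "gradient_of g f" using poly_fun_gradient by blast
    note g = gradient_of_deriv[OF this]
    have "((\<lambda>t. f (\<gamma> t)) has_field_derivative contract (\<lambda>i j. g i j (mat 1)) A) (at 0)"
      using g[OF assms(1)] assms(2) by simp
    moreover have "(\<lambda>t. f (\<gamma> t)) = (\<lambda>t. 0)" using f assms(3) by (auto simp: vanishes_on_def)
    ultimately have "contract (\<lambda>i j. g i j (mat 1)) A = 0" by (metis DERIV_const DERIV_unique)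
    moreover have "((\<lambda>t. f (mat 1 + cscale t A)) has_field_derivative contract (\<lambda>i j. g i j (mat 1)) A) (at 0)"
      using g[OF mderiv_line, of A 0] by simp
    ultimately show ?thesis by simp
  qed
  then show ?thesis unfolding lie_alg_def vanishes_on_def by blast
qed

lemma lie_algD: "A \<in> lie_alg G \<Longrightarrow> vanishes_on G f \<Longrightarrow>
    ((\<lambda>t. f (mat 1 + cscale t A)) has_field_derivative 0) (at 0)"
  unfolding lie_alg_def vanishes_on_def by blast

lemma lie_alg_mono: "S \<subseteq> G \<Longrightarrow> lie_alg S \<subseteq> lie_alg G"
  unfolding lie_alg_def by blast

lemma alg_group_invertible: "alg_group G \<Longrightarrow> g \<in> G \<Longrightarrow> invertible g"
  unfolding alg_group_def closedin_zariski by blast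

lemma alg_group_memI:
  assumes "alg_group G" "invertible x" "\<And>f. vanishes_on G f \<Longrightarrow> f x = 0"
  shows "x \<in> G"
proof -
  obtain F where F: "\<forall>f\<in>F. poly_fun f" "G = {g. invertible g \<and> (\<forall>f\<in>F. f g = 0)}"
    using assms(1) unfolding alg_group_def closedin_zariski by blast
  then have "vanishes_on G f" if "f \<in> F" for f using that by (auto simp: vanishes_on_def)
  then have "\<forall>f\<in>F. f x = 0" using assms(3) by blast
  then show ?thesis by (subst F(2)) (simp add: assms(2))
qed

lemma alg_group_mult: "alg_group G \<Longrightarrow> g \<in> G \<Longrightarrow> h \<in> G \<Longrightarrow> g ** h \<in> G"
  and alg_group_inv: "alg_group G \<Longrightarrow> g \<in> G \<Longrightarrow> matrix_inv g \<in> G"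
  and alg_group_1: "alg_group G \<Longrightarrow> mat 1 \<in> G"
  by (auto simp: alg_group_def)

text \<open>The derivative of \<open>f\<close> in the direction of the left invariant field of \<open>A\<close> vanishes on \<open>G\<close>: at
  \<open>x \<in> G\<close> it is the derivative at 1 of the translate \<open>f (x ** _)\<close>, which vanishes on \<open>G\<close> too.\<close>

lemma vanishes_on_left_derivation:
  assumes G: "alg_group G" and A: "A \<in> lie_alg G" and E: "flow E A" and f: "vanishes_on G f"
  shows "\<exists>h. vanishes_on G h \<and> (\<forall>t. ((\<lambda>t. f (E t)) has_field_derivative h (E t)) (at t))"
proof -
  have "poly_fun f" using f by (simp add: vanishes_on_def)
  then obtain g where "gradient_of g f" using poly_fun_gradient by blast
  note gp = gradient_of_poly_fun[OF this] and g = gradient_of_deriv[OF this]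
  define h where "h X = contract (\<lambda>i j. g i j X) (X ** A)" for X
  have "poly_fun h"
    unfolding h_def contract_def by (intro poly_fun_sum poly_fun.mult gp poly_fun_mult_right)
  moreover have "h x = 0" if x: "x \<in> G" for x
  proof -
    have "poly_fun (\<lambda>Y. f (x ** Y))"
      by (rule poly_fun_subst[OF \<open>poly_fun f\<close> poly_fun_mult_left])
    then have "((\<lambda>t. f (x ** (mat 1 + cscale t A))) has_field_derivative 0) (at 0)"
      using f G x by (intro lie_algD[OF A, of "\<lambda>Y. f (x ** Y)"]) (simp_all add: vanishes_on_def alg_group_mult)
    moreover have "((\<lambda>t. f (x ** (mat 1 + cscale t A))) has_field_derivative h x) (at 0)"
      using g[OF mderiv_mult[OF mderiv_const mderiv_line], of x A 0] by (simp add: h_def)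
    ultimately show ?thesis using DERIV_unique by blast
  qed
  moreover have "((\<lambda>t. f (E t)) has_field_derivative h (E t)) (at t)" for t
    unfolding h_def by (intro g flow_mderiv E)
  ultimately show ?thesis by (auto simp: vanishes_on_def)
qed

text \<open>If \<open>f\<close> vanishes on \<open>G\<close>, the derivatives of all orders of the entire function \<open>f (E t)\<close> are values of
  polynomials vanishing on \<open>G\<close>, hence are 0 at \<open>t = 0\<close>.\<close>

lemma flow_in_group:
  assumes G: "alg_group G" and A: "A \<in> lie_alg G" and E: "flow E A"
  shows "E t \<in> G"
proof (rule alg_group_memI[OF G flow_invertible[OF E]])
  have der: "(deriv ^^ n) (\<lambda>t. f (E t)) 0 = 0" if "vanishes_on G f" for n f
    using that
  proof (induction n arbitrary: f)
    case 0 then show ?case using alg_group_1[OF G] flow_0[OF E] by (simp add: vanishes_on_def)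
  next
    case (Suc n)
    obtain h where h: "vanishes_on G h" "\<And>t. ((\<lambda>t. f (E t)) has_field_derivative h (E t)) (at t)"
      using vanishes_on_left_derivation[OF G A E Suc.prems] by blast
    have "deriv (\<lambda>t. f (E t)) = (\<lambda>t. h (E t))" using h(2) by (intro ext DERIV_imp_deriv)
    then show ?case using Suc.IH[OF h(1)] by (simp add: funpow_swap1)
  qed
  fix f assume f: "vanishes_on G f"
  obtain h where "\<And>t. ((\<lambda>t. f (E t)) has_field_derivative h (E t)) (at t)"
    using vanishes_on_left_derivation[OF G A E f] by blast
  then have "(\<lambda>t. f (E t)) holomorphic_on UNIV"
    unfolding holomorphic_on_def field_differentiable_def by auto
  then show "f (E t) = 0"
    using der[OF f] by (intro holomorphic_fun_eq_0_on_connected[of _ UNIV 0 t]) auto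
qed

text \<open>Every polynomial vanishing on \<open>G\<close> vanishes on the flow of \<open>A\<close>, and hence on the flow of
  the semisimple part.\<close>

lemma lie_alg_jordan:
  fixes G :: "(complex ^ 'n ^ 'n) set"
  assumes G: "alg_group G" and A: "A \<in> lie_alg G"
  obtains s where "semisimple (peval s A)" "nilpotent (A - peval s A)" "peval s A \<in> lie_alg G"
proof -
  obtain s ES EN where s: "semisimple (peval s A)" "nilpotent (A - peval s A)"
    "flow ES (peval s A)" "flow EN (A - peval s A)" "flow (\<lambda>t. ES t ** EN t) A"
    "mexppoly (\<lambda>s t. ES s ** EN t)"
    by (rule jordan_flow)
  have "ES t \<in> G" for t
  proof (rule alg_group_memI[OF G flow_invertible[OF s(3)]])
    fix f assume f: "vanishes_on G f"
    have "exppoly (\<lambda>s t. f (ES s ** EN t))"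
      using f s(6) by (intro poly_fun_exppoly) (auto simp: vanishes_on_def)
    moreover have "f (ES t ** EN t) = 0" for t
      using flow_in_group[OF G A s(5)] f by (simp add: vanishes_on_def)
    ultimately have "f (ES t ** EN 0) = 0" by (rule exppoly_diagonal_zero)
    then show "f (ES t) = 0" by (simp add: flow_0[OF s(4)])
  qed
  then have "peval s A \<in> lie_alg G"
    using s(3) by (intro lie_algI_curve[of ES] flow_mderiv_0 flow_0)
  with s show ?thesis using that by blast
qed

lemma lie_alg_Ad:
  assumes "alg_group G" "g \<in> G" "A \<in> lie_alg G"
  shows "g ** A ** matrix_inv g \<in> lie_alg G"
proof -
  obtain E where E: "flow E A" using flow_exists by blast
  show ?thesis
  proof (rule lie_algI_curve[of "\<lambda>t. g ** E t ** matrix_inv g"])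
    show "mderiv (\<lambda>t. g ** E t ** matrix_inv g) (g ** A ** matrix_inv g) 0"
      using flow_mderiv_0[OF E] by (rule mderiv_conj)
    show "g ** E 0 ** matrix_inv g = mat 1"
      using alg_group_invertible[OF assms(1,2)] by (simp add: flow_0[OF E] matrix_inv_both)
    show "g ** E t ** matrix_inv g \<in> G" for t
      using assms flow_in_group[OF assms(1,3) E] by (simp add: alg_group_mult alg_group_inv)
  qed
qed

text \<open>\<open>bracket A B\<close> is the derivative at 0 of \<open>E t ** B ** E (- t)\<close>, which stays in the linear space
  \<open>lie_alg G\<close>.\<close>

lemma lie_alg_bracket:
  assumes G: "alg_group G" and A: "A \<in> lie_alg G" and B: "B \<in> lie_alg G"
  shows "bracket A B \<in> lie_alg G"
proof -
  obtain C where C: "lie_alg G = {A. \<forall>c\<in>C. contract c A = 0}" using lie_alg_linear by blast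
  obtain E where E: "flow E A" using flow_exists by blast
  have "contract c (bracket A B) = 0" if c: "c \<in> C" for c
  proof -
    have "mderiv (\<lambda>t. E t ** B ** E ((-1) * t + 0)) ((A ** B + E 0 ** 0) ** E ((-1) * 0 + 0)
        + E 0 ** B ** cscale (-1) A) 0"
      using flow_mderiv_0[OF E] by (intro mderiv_mult mderiv_const mderiv_compose_affine) simp_all
    then have "mderiv (\<lambda>t. E t ** B ** E (- t)) (bracket A B) 0"
      by (simp add: flow_0[OF E] bracket_def cscale_mult_right matrix_uminus_mult)
    then have "((\<lambda>t. contract c (E t ** B ** E (- t))) has_field_derivative contract c (bracket A B)) (at 0)"
      by (rule contract_mderiv)
    moreover have "contract c (E t ** B ** E (- t)) = 0" for t
    proof -
      have "E t ** B ** matrix_inv (E t) \<in> lie_alg G"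
        using flow_in_group[OF G A E] by (intro lie_alg_Ad[OF G _ B])
      then show ?thesis using C c by (simp add: flow_matrix_inv[OF E])
    qed
    ultimately have "((\<lambda>t. 0) has_field_derivative contract c (bracket A B)) (at 0)" by simp
    then show ?thesis using DERIV_unique DERIV_const by blast
  qed
  then show ?thesis by (simp add: C)
qed

section \<open>Eigencomponents under a semisimple element\<close>

text \<open>The component of \<open>A\<close> in the eigenspace for \<open>\<kappa>\<close> of the adjoint action of \<open>P ** diag m ** Q\<close>, where
  \<open>Q\<close> is inverse to \<open>P\<close>.\<close>

definition eigencomp :: "complex ^ 'n ^ 'n \<Rightarrow> complex ^ 'n ^ 'n \<Rightarrow> ('n \<Rightarrow> complex) \<Rightarrow> complex
    \<Rightarrow> complex ^ 'n ^ 'n \<Rightarrow> complex ^ 'n ^ 'n" where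
  "eigencomp P Q m \<kappa> A = P ** (\<chi> p q. if m p - m q = \<kappa> then (Q ** A ** P) $ p $ q else 0) ** Q"

lemma conj_cancel:
  fixes P Q A :: "complex ^ 'n ^ 'n"
  assumes "Q ** P = mat 1" "P ** Q = mat 1"
  shows "Q ** (P ** A ** Q) ** P = A" "P ** (Q ** A ** P) ** Q = A"
proof -
  have "Q ** (P ** A ** Q) ** P = (Q ** P) ** A ** (Q ** P)" by (simp add: matrix_mul_assoc)
  then show "Q ** (P ** A ** Q) ** P = A" using assms by simp
  have "P ** (Q ** A ** P) ** Q = (P ** Q) ** A ** (P ** Q)" by (simp add: matrix_mul_assoc)
  then show "P ** (Q ** A ** P) ** Q = A" using assms by simp
qed

lemma conj_entry_eqI:
  fixes P Q A B :: "complex ^ 'n ^ 'n"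
  assumes "Q ** P = mat 1" "P ** Q = mat 1"
    and "\<And>p q. (Q ** A ** P) $ p $ q = (Q ** B ** P) $ p $ q"
  shows "A = B"
proof -
  have "Q ** A ** P = Q ** B ** P" using assms(3) by (simp add: vec_eq_iff)
  then show ?thesis using conj_cancel(2)[OF assms(1,2)] by metis
qed

lemma conj_mult:
  fixes P Q A B :: "complex ^ 'n ^ 'n"
  assumes "P ** Q = mat 1"
  shows "Q ** (A ** B) ** P = (Q ** A ** P) ** (Q ** B ** P)"
proof -
  have "(Q ** A ** P) ** (Q ** B ** P) = Q ** A ** (P ** Q) ** B ** P" by (simp add: matrix_mul_assoc)
  then show ?thesis using assms by (simp add: matrix_mul_assoc)
qed

lemma conj_exp_entry:
  fixes P Q A :: "complex ^ 'n ^ 'n"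
  assumes PQ: "Q ** P = mat 1" "P ** Q = mat 1"
  shows "(Q ** ((P ** diag (\<lambda>i. exp (t * m i)) ** Q) ** A ** (P ** diag (\<lambda>i. exp (- t * m i)) ** Q)) ** P) $ p $ q
    = exp (t * (m p - m q)) * (Q ** A ** P) $ p $ q"
proof -
  define E where "E t = P ** diag (\<lambda>i. exp (t * m i)) ** Q" for t
  have "Q ** (E t ** A ** E (- t)) ** P =
      diag (\<lambda>i. exp (t * m i)) ** (Q ** A ** P) ** diag (\<lambda>i. exp (- t * m i))"
    by (simp only: conj_mult[OF PQ(2), of "E t ** A"] conj_mult[OF PQ(2), of "E t"])
       (simp add: E_def conj_cancel(1)[OF PQ])
  then show ?thesis
    by (simp add: E_def diag_mult_nth exp_diff exp_minus right_diff_distrib field_simps)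
qed

text \<open>Conjugation by \<open>exp (t D)\<close> multiplies the component for \<open>\<kappa>\<close> by \<open>exp (t \<kappa>)\<close>. These functions are
  independent, so a linear equation that holds for all conjugates holds for each component.\<close>

lemma lie_alg_eigencomp:
  fixes P Q :: "complex ^ 'n ^ 'n"
  assumes G: "alg_group G" and PQ: "Q ** P = mat 1" "P ** Q = mat 1"
    and D: "P ** diag m ** Q \<in> lie_alg G" and A: "A \<in> lie_alg G"
  shows "eigencomp P Q m \<kappa> A \<in> lie_alg G"
proof -
  obtain C where C: "lie_alg G = {A. \<forall>c\<in>C. contract c A = 0}" using lie_alg_linear by blast
  define E where "E t = P ** diag (\<lambda>i. exp (t * m i)) ** Q" for t
  have E: "flow E (P ** diag m ** Q)" unfolding E_def using PQ by (rule flow_semisimple)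
  define M where "M = insert \<kappa> (range (\<lambda>(p, q). m p - m q))"
  have M: "finite M" by (simp add: M_def)
  have conj: "E t ** A ** matrix_inv (E t) = (\<Sum>\<kappa>\<in>M. cscale (exp (t * \<kappa>)) (eigencomp P Q m \<kappa> A))" for t
  proof (rule conj_entry_eqI[OF PQ])
    fix p q
    have "(Q ** (E t ** A ** matrix_inv (E t)) ** P) $ p $ q = exp (t * (m p - m q)) * (Q ** A ** P) $ p $ q"
      unfolding flow_matrix_inv[OF E] unfolding E_def by (rule conj_exp_entry[OF PQ])
    also have "\<dots> = (\<Sum>\<kappa>\<in>M. if m p - m q = \<kappa> then exp (t * \<kappa>) * (Q ** A ** P) $ p $ q else 0)"
    proof -
      have "m p - m q \<in> M" unfolding M_def by (rule insertI2, rule range_eqI[of _ _ "(p, q)"]) simp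
      then show ?thesis using M by simp
    qed
    also have "\<dots> = (\<Sum>\<kappa>\<in>M. exp (t * \<kappa>) * (Q ** eigencomp P Q m \<kappa> A ** P) $ p $ q)"
      unfolding eigencomp_def conj_cancel(1)[OF PQ] by (intro sum.cong refl) auto
    also have "\<dots> = (Q ** (\<Sum>\<kappa>\<in>M. cscale (exp (t * \<kappa>)) (eigencomp P Q m \<kappa> A)) ** P) $ p $ q"
      by (simp add: matrix_mult_sum_right matrix_sum_mult cscale_mult_left cscale_mult_right sum_matrix_nth)
    finally show "(Q ** (E t ** A ** matrix_inv (E t)) ** P) $ p $ q
        = (Q ** (\<Sum>\<kappa>\<in>M. cscale (exp (t * \<kappa>)) (eigencomp P Q m \<kappa> A)) ** P) $ p $ q" .
  qed
  have "contract c (eigencomp P Q m \<kappa> A) = 0" if c: "c \<in> C" for c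
  proof (rule exp_sum_independent[OF M, where c = "\<lambda>\<kappa>. contract c (eigencomp P Q m \<kappa> A)"])
    fix t
    have "E t ** A ** matrix_inv (E t) \<in> lie_alg G"
      using flow_in_group[OF G D E] by (intro lie_alg_Ad[OF G _ A])
    then have "contract c (\<Sum>\<kappa>\<in>M. cscale (exp (t * \<kappa>)) (eigencomp P Q m \<kappa> A)) = 0"
      using C c by (simp add: conj)
    then show "(\<Sum>\<kappa>\<in>M. exp (t * \<kappa>) * contract c (eigencomp P Q m \<kappa> A)) = 0"
      by (simp add: contract_sum contract_cscale)
  qed (simp add: M_def)
  then show ?thesis by (simp add: C)
qed

lemma conj_bracket_diag:
  fixes P Q A :: "complex ^ 'n ^ 'n"
  assumes PQ: "Q ** P = mat 1" "P ** Q = mat 1"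
  shows "(Q ** bracket (P ** diag m ** Q) A ** P) $ p $ q = (m p - m q) * (Q ** A ** P) $ p $ q"
proof -
  let ?D = "P ** diag m ** Q"
  have "Q ** bracket ?D A ** P = (Q ** ?D ** P) ** (Q ** A ** P) - (Q ** A ** P) ** (Q ** ?D ** P)"
    unfolding bracket_def by (simp only: conj_mult[OF PQ(2), symmetric] matrix_diff_ldistrib matrix_diff_rdistrib)
  then show ?thesis by (simp add: conj_cancel(1)[OF PQ] diag_mult_nth left_diff_distrib)
qed

text \<open>The adjoint action of \<open>D\<close> is inverted on each eigencomponent for \<open>\<kappa> \<noteq> 0\<close> by dividing by \<open>\<kappa>\<close>, and these
  components stay in \<open>lie_alg G\<close>.\<close>

lemma ad_semisimple_preimage:
  fixes P Q Y :: "complex ^ 'n ^ 'n"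
  assumes G: "alg_group G" and PQ: "Q ** P = mat 1" "P ** Q = mat 1"
    and D: "P ** diag m ** Q \<in> lie_alg G"
    and X: "bracket (P ** diag m ** Q) Y \<in> lie_alg G"
  shows "\<exists>\<xi>\<in>lie_alg G. bracket (P ** diag m ** Q) \<xi> = bracket (P ** diag m ** Q) Y"
proof -
  let ?D = "P ** diag m ** Q"
  let ?X = "bracket ?D Y"
  note ad = conj_bracket_diag[OF PQ, of m]
  define M where "M = range (\<lambda>(p, q). m p - m q) - {0}"
  have M: "finite M" by (simp add: M_def)
  define \<xi> where "\<xi> = (\<Sum>\<kappa>\<in>M. cscale (1 / \<kappa>) (eigencomp P Q m \<kappa> ?X))"
  have "\<xi> \<in> lie_alg G" unfolding \<xi>_def
    by (intro cmat.subspace_sum[OF lie_alg_subspace] cmat.subspace_scale[OF lie_alg_subspace]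
        lie_alg_eigencomp[OF G PQ D X])
  moreover have "bracket ?D \<xi> = ?X"
  proof (rule conj_entry_eqI[OF PQ])
    fix p q
    have "(Q ** \<xi> ** P) $ p $ q = (\<Sum>\<kappa>\<in>M. (1 / \<kappa>) * (Q ** eigencomp P Q m \<kappa> ?X ** P) $ p $ q)"
      unfolding \<xi>_def
      by (simp add: matrix_mult_sum_right matrix_sum_mult cscale_mult_left cscale_mult_right sum_matrix_nth)
    also have "\<dots> = (\<Sum>\<kappa>\<in>M. if \<kappa> = m p - m q then (1 / \<kappa>) * ((m p - m q) * (Q ** Y ** P) $ p $ q) else 0)"
      unfolding eigencomp_def conj_cancel(1)[OF PQ] by (intro sum.cong refl) (auto simp: ad)
    finally have e: "(Q ** \<xi> ** P) $ p $ q =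
      (if m p - m q \<in> M then (1 / (m p - m q)) * ((m p - m q) * (Q ** Y ** P) $ p $ q) else 0)"
      using M by simp
    show "(Q ** bracket ?D \<xi> ** P) $ p $ q = (Q ** ?X ** P) $ p $ q"
    proof (cases "m p = m q")
      case True
      then show ?thesis by (simp only: ad) simp
    next
      case False
      then have "m p - m q \<in> M" unfolding M_def by (auto intro: range_eqI[of _ _ "(p, q)"])
      then show ?thesis unfolding ad e using False by simp
    qed
  qed
  ultimately show ?thesis by blast
qed

section \<open>Stabilizers in a rational module\<close>

definition stab :: "(complex ^ 'n ^ 'n) set \<Rightarrow> (complex ^ 'n ^ 'n \<Rightarrow> complex ^ 'm ^ 'm)
    \<Rightarrow> complex ^ 'm \<Rightarrow> (complex ^ 'n ^ 'n) set" where
  "stab G \<rho> v = {g \<in> G. \<rho> g *v v = v}"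

lemma rational_module_coeffs:
  fixes \<rho> :: "complex ^ 'n ^ 'n \<Rightarrow> complex ^ 'm ^ 'm"
  assumes G: "alg_group G" and \<rho>: "rational_module G \<rho>"
  obtains p :: "'m \<Rightarrow> 'm \<Rightarrow> complex ^ 'n ^ 'n \<Rightarrow> complex" and k
  where "\<forall>i j. poly_fun (p i j)" "\<forall>g\<in>G. \<forall>i j. \<rho> g $ i $ j = p i j g / det g ^ k i j"
proof -
  have "\<forall>i j. \<exists>p k. poly_fun p \<and> (\<forall>g\<in>G. \<rho> g $ i $ j = p g / det g ^ k)"
    using \<rho> alg_group_invertible[OF G] unfolding rational_module_def regular_fun_def by metis
  then show ?thesis using that by metis
qed

lemma rational_module_mult: "rational_module G \<rho> \<Longrightarrow> g \<in> G \<Longrightarrow> h \<in> G \<Longrightarrow> \<rho> (g ** h) = \<rho> g ** \<rho> h"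
  and rational_module_1: "rational_module G \<rho> \<Longrightarrow> \<rho> (mat 1) = mat 1"
  by (auto simp: rational_module_def)

lemma alg_group_stab:
  fixes \<rho> :: "complex ^ 'n ^ 'n \<Rightarrow> complex ^ 'm ^ 'm"
  assumes G: "alg_group G" and \<rho>: "rational_module G \<rho>"
  shows "alg_group (stab G \<rho> v)"
  unfolding alg_group_def
proof (intro conjI ballI)
  obtain p :: "'m \<Rightarrow> 'm \<Rightarrow> complex ^ 'n ^ 'n \<Rightarrow> complex" and k
    where "\<forall>i j. poly_fun (p i j)" "\<forall>g\<in>G. \<forall>i j. \<rho> g $ i $ j = p i j g / det g ^ k i j"
    by (rule rational_module_coeffs[OF G \<rho>])
  then have p: "poly_fun (p i j)" "g \<in> G \<Longrightarrow> \<rho> g $ i $ j = p i j g / det g ^ k i j" for g i j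
    by blast+
  obtain F where F: "\<forall>f\<in>F. poly_fun f" "G = {g. invertible g \<and> (\<forall>f\<in>F. f g = 0)}"
    using G unfolding alg_group_def closedin_zariski by blast
  \<comment> \<open>A common exponent clears the denominators of all matrix coefficients.\<close>
  define K where "K = (\<Sum>i\<in>UNIV. \<Sum>j\<in>UNIV. k i j)"
  have kK: "k i j \<le> K" for i j
    unfolding K_def using member_le_sum[of i UNIV "\<lambda>i. \<Sum>j\<in>UNIV. k i j"] member_le_sum[of j UNIV "k i"]
    by simp
  define r where "r i g = (\<Sum>j\<in>UNIV. p i j g * det g ^ (K - k i j) * v $ j) - det g ^ K * v $ i" for i g
  have rp: "poly_fun (r i)" for i
    unfolding r_def
    by (intro poly_fun_diff poly_fun_sum poly_fun.mult p(1) poly_fun_power poly_fun_det poly_fun.const)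
  have r0: "r i g = det g ^ K * ((\<rho> g *v v) $ i - v $ i)" and det: "det g \<noteq> 0" if g: "g \<in> G" for i g
  proof -
    show "det g \<noteq> 0" using alg_group_invertible[OF G g] by (simp add: invertible_det_nz)
    then have "p i j g * det g ^ (K - k i j) = det g ^ K * \<rho> g $ i $ j" for j
      using kK[of i j] by (simp add: p(2)[OF g] power_diff)
    then show "r i g = det g ^ K * ((\<rho> g *v v) $ i - v $ i)"
      by (simp add: r_def matrix_vector_mult_def right_diff_distrib sum_distrib_left mult.assoc)
  qed
  have "stab G \<rho> v = {g. invertible g \<and> (\<forall>f\<in>F \<union> range r. f g = 0)}"
  proof (intro equalityI subsetI)
    fix g assume "g \<in> stab G \<rho> v"
    then have "g \<in> G" "\<And>i. r i g = 0" using r0 by (auto simp: stab_def)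
    then show "g \<in> {g. invertible g \<and> (\<forall>f\<in>F \<union> range r. f g = 0)}" using F(2) by auto
  next
    fix g assume g: "g \<in> {g. invertible g \<and> (\<forall>f\<in>F \<union> range r. f g = 0)}"
    then have gG: "g \<in> G" by (subst F(2)) auto
    have "(\<rho> g *v v) $ i = v $ i" for i
    proof -
      have "r i g = 0" using g by blast
      then show ?thesis using r0[OF gG, of i] det[OF gG] by simp
    qed
    then show "g \<in> stab G \<rho> v" using gG by (simp add: stab_def vec_eq_iff)
  qed
  moreover have "\<forall>f\<in>F \<union> range r. poly_fun f" using F(1) rp by auto
  ultimately show "closedin zariski (stab G \<rho> v)" unfolding closedin_zariski by blast
next
  show "mat 1 \<in> stab G \<rho> v" using G \<rho> by (simp add: stab_def alg_group_1 rational_module_1)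
next
  fix g h assume "g \<in> stab G \<rho> v" "h \<in> stab G \<rho> v"
  then show "g ** h \<in> stab G \<rho> v" using G \<rho>
    by (simp add: stab_def alg_group_mult rational_module_mult matrix_vector_mul_assoc [symmetric])
next
  fix g assume g: "g \<in> stab G \<rho> v"
  then have "\<rho> (matrix_inv g) *v (\<rho> g *v v) = \<rho> (matrix_inv g ** g) *v v"
    using G \<rho> by (simp add: stab_def alg_group_inv rational_module_mult matrix_vector_mul_assoc [symmetric])
  then show "matrix_inv g \<in> stab G \<rho> v"
    using g G \<rho> alg_group_invertible[OF G, of g]
    by (simp add: stab_def alg_group_inv matrix_inv_both rational_module_1)
qed

text \<open>The quotient rule, with \<open>det\<close> equal to 1 at the identity. Close to the identity the curve consists of
  invertible matrices, where \<open>f\<close> is the quotient.\<close>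

lemma regular_fun_derivative:
  fixes f :: "complex ^ 'n ^ 'n \<Rightarrow> complex"
  assumes "regular_fun f"
  shows "\<exists>c. \<forall>\<gamma> V. mderiv \<gamma> V 0 \<longrightarrow> \<gamma> 0 = mat 1 \<longrightarrow>
    ((\<lambda>t. f (\<gamma> t)) has_field_derivative contract c V) (at 0)"
proof -
  obtain p k where p: "poly_fun p" and f: "\<And>g. invertible g \<Longrightarrow> f g = p g / det g ^ k"
    using assms unfolding regular_fun_def by blast
  define q where "q g = det g ^ k" for g :: "complex ^ 'n ^ 'n"
  have q: "poly_fun q" unfolding q_def by (intro poly_fun_power poly_fun_det)
  obtain a b where "gradient_of a p" "gradient_of b q"
    using poly_fun_gradient[OF p] poly_fun_gradient[OF q] by blast
  note a = gradient_of_deriv[OF this(1)] and b = gradient_of_deriv[OF this(2)]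
  obtain d where "gradient_of d (det :: complex ^ 'n ^ 'n \<Rightarrow> complex)"
    using poly_fun_gradient[OF poly_fun_det] by blast
  note d = gradient_of_deriv[OF this]
  define c where "c i j = a i j (mat 1) - p (mat 1) * b i j (mat 1)" for i j
  have "((\<lambda>t. f (\<gamma> t)) has_field_derivative contract c V) (at 0)"
    if \<gamma>: "mderiv \<gamma> V 0" "\<gamma> 0 = mat 1" for \<gamma> V
  proof -
    have q1: "q (\<gamma> 0) = 1" using \<gamma> by (simp add: q_def)
    have "((\<lambda>t. p (\<gamma> t) / q (\<gamma> t)) has_field_derivative contract c V) (at 0)"
      using DERIV_divide[OF a[OF \<gamma>(1)] b[OF \<gamma>(1)]] q1 \<gamma>(2)
      by (simp add: c_def contract_def left_diff_distrib sum_subtractf sum_distrib_left mult.assoc)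
    moreover have "isCont (\<lambda>t. det (\<gamma> t)) 0" using d[OF \<gamma>(1)] by (rule DERIV_isCont)
    then have "\<forall>\<^sub>F t in nhds 0. det (\<gamma> t) \<noteq> 0"
      using \<gamma>(2) by (intro t1_space_nhds tendsto_imp_eventually_ne) (auto simp: isCont_def tendsto_nhds_iff)
    then have "\<forall>\<^sub>F t in nhds 0. p (\<gamma> t) / q (\<gamma> t) = f (\<gamma> t)"
      by eventually_elim (simp add: f q_def invertible_det_nz)
    ultimately show ?thesis by (subst DERIV_cong_ev[OF refl _ refl, symmetric])
  qed
  then show ?thesis by blast
qed

text \<open>Whichever regular extension of a matrix coefficient is differentiated, the result is the derivative of
  \<open>\<rho> (exp (t A))\<close>, because the flow stays in \<open>G\<close>. This shows that the description in \<open>diff_rep\<close> is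
  unique, and that it is linear in \<open>A\<close>.\<close>

lemma diff_rep_derivative:
  fixes \<rho> :: "complex ^ 'n ^ 'n \<Rightarrow> complex ^ 'm ^ 'm"
  assumes G: "alg_group G" and \<rho>: "rational_module G \<rho>"
  obtains c :: "'m \<Rightarrow> 'm \<Rightarrow> 'n \<Rightarrow> 'n \<Rightarrow> complex"
  where "\<forall>A\<in>lie_alg G. \<forall>i j. diff_rep G \<rho> A $ i $ j = contract (c i j) A"
    "\<forall>A\<in>lie_alg G. \<forall>E. flow E A \<longrightarrow> mderiv (\<lambda>t. \<rho> (E t)) (diff_rep G \<rho> A) 0"
proof -
  have "\<forall>i j. \<exists>f. regular_fun f \<and> (\<forall>g\<in>G. \<rho> g $ i $ j = f g)"
    using \<rho> by (simp add: rational_module_def)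
  then obtain f where f: "\<And>i j. regular_fun (f i j)" "\<And>i j g. g \<in> G \<Longrightarrow> \<rho> g $ i $ j = f i j g"
    by metis
  have "\<forall>i j. \<exists>c. \<forall>\<gamma> V. mderiv \<gamma> V 0 \<longrightarrow> \<gamma> 0 = mat 1 \<longrightarrow>
      ((\<lambda>t. f i j (\<gamma> t)) has_field_derivative contract c V) (at 0)"
    using regular_fun_derivative[OF f(1)] by blast
  then obtain c where c: "\<And>i j \<gamma> V. mderiv \<gamma> V 0 \<Longrightarrow> \<gamma> 0 = mat 1 \<Longrightarrow>
      ((\<lambda>t. f i j (\<gamma> t)) has_field_derivative contract (c i j) V) (at 0)"
    by metis
  have Ed: "((\<lambda>t. \<rho> (E t) $ i $ j) has_field_derivative contract (c i j) A) (at 0)"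
    if "A \<in> lie_alg G" "flow E A" for A E i j
    using c[OF flow_mderiv_0 flow_0, OF that(2,2)] flow_in_group[OF G that] f(2) by simp
  have eq: "diff_rep G \<rho> A $ i $ j = contract (c i j) A" if A: "A \<in> lie_alg G" for A i j
  proof -
    obtain E where E: "flow E A" using flow_exists by blast
    have "(THE d. \<exists>f. regular_fun f \<and> (\<forall>g\<in>G. \<rho> g $ i $ j = f g)
       \<and> ((\<lambda>t. f (mat 1 + cscale t A)) has_field_derivative d) (at 0)) = contract (c i j) A"
    proof (rule the_equality)
      have "((\<lambda>t. f i j (mat 1 + cscale t A)) has_field_derivative contract (c i j) A) (at 0)"
        by (rule c[OF mderiv_line]) simp
      then show "\<exists>f. regular_fun f \<and> (\<forall>g\<in>G. \<rho> g $ i $ j = f g)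
        \<and> ((\<lambda>t. f (mat 1 + cscale t A)) has_field_derivative contract (c i j) A) (at 0)"
        using f by (intro exI[of _ "f i j"]) auto
    next
      fix d assume "\<exists>f. regular_fun f \<and> (\<forall>g\<in>G. \<rho> g $ i $ j = f g)
        \<and> ((\<lambda>t. f (mat 1 + cscale t A)) has_field_derivative d) (at 0)"
      then obtain h where h: "regular_fun h" "\<And>g. g \<in> G \<Longrightarrow> \<rho> g $ i $ j = h g"
        "((\<lambda>t. h (mat 1 + cscale t A)) has_field_derivative d) (at 0)" by blast
      obtain b where b: "\<And>\<gamma> V. mderiv \<gamma> V 0 \<Longrightarrow> \<gamma> 0 = mat 1 \<Longrightarrow>
          ((\<lambda>t. h (\<gamma> t)) has_field_derivative contract b V) (at 0)"
        using regular_fun_derivative[OF h(1)] by blast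
      have "((\<lambda>t. h (mat 1 + cscale t A)) has_field_derivative contract b A) (at 0)"
        by (rule b[OF mderiv_line]) simp
      then have "d = contract b A" using h(3) DERIV_unique by blast
      moreover have "((\<lambda>t. \<rho> (E t) $ i $ j) has_field_derivative contract b A) (at 0)"
        using b[OF flow_mderiv_0 flow_0, OF E E] flow_in_group[OF G A E] h(2) by simp
      ultimately show "d = contract (c i j) A" using Ed[OF A E] DERIV_unique by blast
    qed
    then show ?thesis by (simp add: diff_rep_def)
  qed
  moreover have "mderiv (\<lambda>t. \<rho> (E t)) (diff_rep G \<rho> A) 0" if "A \<in> lie_alg G" "flow E A" for E A
    unfolding mderiv_def eq[OF that(1)] using Ed[OF that] by blast
  ultimately show ?thesis using that by blast
qed

lemma flow_diff_rep:
  assumes G: "alg_group G" and \<rho>: "rational_module G \<rho>" and A: "A \<in> lie_alg G" and E: "flow E A"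
  shows "flow (\<lambda>t. \<rho> (E t)) (diff_rep G \<rho> A)"
proof (rule flowI)
  show "\<rho> (E (s + t)) = \<rho> (E s) ** \<rho> (E t)" for s t
    using flow_in_group[OF G A E] by (simp add: flow_add[OF E] rational_module_mult[OF \<rho>])
  show "\<rho> (E 0) = mat 1" by (simp add: flow_0[OF E] rational_module_1[OF \<rho>])
  show "mderiv (\<lambda>t. \<rho> (E t)) (diff_rep G \<rho> A) 0"
  proof (rule diff_rep_derivative[OF G \<rho>])
    assume "\<forall>A\<in>lie_alg G. \<forall>E. flow E A \<longrightarrow> mderiv (\<lambda>t. \<rho> (E t)) (diff_rep G \<rho> A) 0"
    then show ?thesis using A E by blast
  qed
qed

lemma mderiv_vector:
  assumes "mderiv \<gamma> V t"
  shows "((\<lambda>t. (\<gamma> t *v v) $ i) has_field_derivative (V *v v) $ i) (at t)"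
  using assms unfolding mderiv_def matrix_vector_mult_def
  by (auto intro!: DERIV_sum DERIV_cmult_right)

text \<open>The derivative of \<open>\<rho> (E t) *v v\<close> is \<open>\<rho> (E t)\<close> applied to \<open>diff_rep G \<rho> A *v v\<close>, so the flow of \<open>A\<close> fixes
  \<open>v\<close> iff \<open>A\<close> annihilates it.\<close>

lemma lie_stabilizer_eq_lie_alg_stab:
  assumes G: "alg_group G" and \<rho>: "rational_module G \<rho>"
  shows "lie_stabilizer G \<rho> v = lie_alg (stab G \<rho> v)"
proof (intro equalityI subsetI)
  fix A assume "A \<in> lie_stabilizer G \<rho> v"
  then have A: "A \<in> lie_alg G" "diff_rep G \<rho> A *v v = 0" by (auto simp: lie_stabilizer_def)
  obtain E where E: "flow E A" using flow_exists by blast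
  have F: "flow (\<lambda>t. \<rho> (E t)) (diff_rep G \<rho> A)" by (rule flow_diff_rep[OF G \<rho> A(1) E])
  have "(\<rho> (E t) *v v) $ i = (\<rho> (E 0) *v v) $ i" for t i
  proof -
    have "((\<lambda>t. (\<rho> (E t) *v v) $ i) has_field_derivative 0) (at t)" for t
    proof -
      have "mderiv (\<lambda>t. \<rho> (E t)) (\<rho> (E t) ** diff_rep G \<rho> A) t"
        by (rule flow_mderiv[OF F])
      from mderiv_vector[OF this, of v i] show ?thesis by (simp add: matrix_vector_mul_assoc [symmetric] A(2))
    qed
    then have "\<exists>c. \<forall>t\<in>UNIV. (\<rho> (E t) *v v) $ i = c"
      by (intro has_field_derivative_zero_constant) auto
    then show ?thesis by auto
  qed
  then have "\<rho> (E t) *v v = v" for t by (simp add: vec_eq_iff flow_0[OF F])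
  then have "E t \<in> stab G \<rho> v" for t using flow_in_group[OF G A(1) E] by (simp add: stab_def)
  then show "A \<in> lie_alg (stab G \<rho> v)"
    by (intro lie_algI_curve[OF flow_mderiv_0[OF E] flow_0[OF E]])
next
  fix A assume A: "A \<in> lie_alg (stab G \<rho> v)"
  have AG: "A \<in> lie_alg G" using A lie_alg_mono[of "stab G \<rho> v" G] by (auto simp: stab_def)
  obtain E where E: "flow E A" using flow_exists by blast
  have "\<rho> (E t) *v v = v" for t
    using flow_in_group[OF alg_group_stab[OF G \<rho>] A E, of t] by (simp add: stab_def)
  moreover have "mderiv (\<lambda>t. \<rho> (E t)) (diff_rep G \<rho> A) 0"
    by (rule flow_mderiv_0[OF flow_diff_rep[OF G \<rho> AG E]])
  ultimately have "((\<lambda>t. v $ i) has_field_derivative (diff_rep G \<rho> A *v v) $ i) (at 0)" for i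
    using mderiv_vector[of "\<lambda>t. \<rho> (E t)" "diff_rep G \<rho> A" 0 v i] by simp
  then have "(diff_rep G \<rho> A *v v) $ i = 0" for i using DERIV_unique DERIV_const by blast
  then show "A \<in> lie_stabilizer G \<rho> v" using AG by (simp add: lie_stabilizer_def vec_eq_iff)
qed

section \<open>Weakly closed sets of nilpotent matrices\<close>

text \<open>The vectors killed by all products of \<open>i\<close> elements of \<open>S\<close>. The chain reaches the whole space iff
  the associative algebra generated by \<open>S\<close> is nilpotent.\<close>

fun kernel_chain :: "(complex ^ 'n ^ 'n) set \<Rightarrow> nat \<Rightarrow> (complex ^ 'n) set" where
  "kernel_chain S 0 = {0}"
| "kernel_chain S (Suc i) = {v. \<forall>A\<in>S. A *v v \<in> kernel_chain S i}"

lemma kernel_chain_subspace: "vec.subspace (kernel_chain S i)"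
proof (induction i)
  case (Suc i)
  then show ?case
    by (auto simp: vec.subspace_def matrix_vector_right_distrib vec.scale vec.add)
qed simp

lemma kernel_chain_mono: "kernel_chain S i \<subseteq> kernel_chain S (i + k)"
proof (induction i arbitrary: k)
  case 0
  then show ?case using vec.subspace_0[OF kernel_chain_subspace] by auto
next
  case (Suc i)
  then show ?case by fastforce
qed

lemma kernel_chain_span: "kernel_chain (cmat.span S) i = kernel_chain S i"
proof (induction i)
  case (Suc i)
  have "A *v v \<in> kernel_chain S i" if v: "\<forall>A\<in>S. A *v v \<in> kernel_chain S i" and "A \<in> cmat.span S" for A v
    using that(2)
  proof (induction rule: cmat.span_induct)
    case base
    show ?case using kernel_chain_subspace[of S i]
      by (auto simp: cmat.subspace_def vec.subspace_def matrix_vector_mult_add_rdistrib cscale_vector)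
  qed (use v in auto)
  moreover have "S \<subseteq> cmat.span S" by (auto intro: cmat.span_base)
  ultimately show ?case using Suc by auto
qed simp

lemma kernel_chain_antimono: "S \<subseteq> T \<Longrightarrow> kernel_chain T i \<subseteq> kernel_chain S i"
proof (induction i)
  case (Suc i)
  then show ?case by fastforce
qed simp

definition acts_nilpotently :: "(complex ^ 'n ^ 'n) set \<Rightarrow> bool" where
  "acts_nilpotently S \<longleftrightarrow> (\<exists>N. kernel_chain S N = UNIV)"

lemma mpow_vector_Suc: "mpow A (Suc k) *v v = A *v (mpow A k *v v)"
  by (simp add: mpow_Suc matrix_vector_mul_assoc)

lemma acts_nilpotently_nilpotent:
  fixes A :: "complex ^ 'n ^ 'n"
  assumes "acts_nilpotently S" "A \<in> S"
  shows "nilpotent A"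
proof -
  obtain N where N: "kernel_chain S N = UNIV" using assms(1) by (auto simp: acts_nilpotently_def)
  have "mpow A i *v v = 0" if "v \<in> kernel_chain S i" for i v
    using that
  proof (induction i arbitrary: v)
    case (Suc i)
    then have "A *v v \<in> kernel_chain S i" using assms(2) by simp
    then have "mpow A i *v (A *v v) = 0" by (rule Suc.IH)
    then show ?case by (simp only: mpow_Suc2 matrix_vector_mul_assoc)
  qed simp
  then have "mpow A N *v v = 0" for v using N by simp
  then have "mpow A N = 0" by (metis matrix_eq matrix_vector_mult_0)
  then show ?thesis by (auto simp: nilpotent_def)
qed

text \<open>As \<open>x\<close> normalizes the span of \<open>S\<close>, it preserves each step of the chain of \<open>S\<close>. If the \<open>k\<close>-th power of \<open>x\<close>
  is 0, each such step is refined into \<open>k\<close> steps of the chain of \<open>insert x S\<close>.\<close>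

lemma acts_nilpotently_insert:
  fixes S :: "(complex ^ 'n ^ 'n) set"
  assumes S: "acts_nilpotently S" and x: "nilpotent x"
    and br: "\<And>A. A \<in> S \<Longrightarrow> bracket A x \<in> cmat.span S"
  shows "acts_nilpotently (insert x S)"
proof -
  let ?V = "kernel_chain S" and ?V' = "kernel_chain (insert x S)"
  obtain N where N: "?V N = UNIV" using S by (auto simp: acts_nilpotently_def)
  obtain k where k: "mpow x k = 0" using x by (auto simp: nilpotent_def)
  have xV: "x *v v \<in> ?V i" if "v \<in> ?V i" for v i
    using that
  proof (induction i arbitrary: v)
    case (Suc i)
    have "A *v (x *v v) \<in> ?V i" if A: "A \<in> S" for A
    proof -
      have "A *v (x *v v) = x *v (A *v v) + bracket A x *v v"
        by (simp add: bracket_def matrix_vector_mul_assoc matrix_vector_mult_diff_rdistrib)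
      moreover have "x *v (A *v v) \<in> ?V i" using Suc A by auto
      moreover have "v \<in> kernel_chain (cmat.span S) (Suc i)" using Suc.prems by (simp only: kernel_chain_span)
      then have "bracket A x *v v \<in> ?V i" using br[OF A] by (simp add: kernel_chain_span)
      ultimately show ?thesis using vec.subspace_add[OF kernel_chain_subspace] by metis
    qed
    then show ?case by simp
  qed simp
  have xpV: "mpow x r *v v \<in> ?V i" if "v \<in> ?V i" for v i r
    using that by (induction r) (auto simp: mpow_vector_Suc intro: xV)
  have "?V i \<subseteq> ?V' (i * k)" for i
  proof (induction i)
    case (Suc i)
    have "mpow x (k - r) *v v \<in> ?V' (i * k + r)" if "r \<le> k" "v \<in> ?V (Suc i)" for r v
      using that(1)
    proof (induction r)
      case 0
      show ?case using k vec.subspace_0[OF kernel_chain_subspace] by simp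
    next
      case (Suc r)
      have "x *v (mpow x (k - Suc r) *v v) = mpow x (k - r) *v v"
        using Suc.prems by (simp add: mpow_vector_Suc [symmetric] Suc_diff_Suc)
      moreover have "A *v (mpow x (k - Suc r) *v v) \<in> ?V' (i * k + r)" if "A \<in> S" for A
        using xpV[OF \<open>v \<in> ?V (Suc i)\<close>, of "k - Suc r"] that \<open>?V i \<subseteq> ?V' (i * k)\<close>
          kernel_chain_mono[of "insert x S" "i * k" r] by auto
      ultimately show ?case using Suc by simp
    qed
    from this[of k] show ?case by (auto simp: add.commute)
  qed simp
  then have "?V' (N * k) = UNIV" using N by blast
  then show ?thesis by (auto simp: acts_nilpotently_def)
qed

lemma bracket_span_subset:
  assumes "\<And>A B. A \<in> S \<Longrightarrow> B \<in> T \<Longrightarrow> bracket A B \<in> cmat.span U"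
    and "A \<in> cmat.span S" "B \<in> cmat.span T"
  shows "bracket A B \<in> cmat.span U"
proof -
  have 1: "bracket A B \<in> cmat.span U" if "B \<in> T" "A \<in> cmat.span S" for A B
    using that(2)
  proof (induction rule: cmat.span_induct)
    case base
    show ?case by (auto simp: cmat.subspace_def bracket_simps
      intro: cmat.span_add cmat.span_scale cmat.span_zero)
  qed (use assms(1) that(1) in auto)
  show ?thesis using assms(3)
  proof (induction rule: cmat.span_induct)
    case base
    show ?case by (auto simp: cmat.subspace_def bracket_simps
      intro: cmat.span_add cmat.span_scale cmat.span_zero)
  qed (use 1 assms(2) in auto)
qed

text \<open>Otherwise brackets with elements of \<open>S\<close> could be iterated forever without entering the span of
  \<open>S\<close>. But each bracket improves by one step the way in which the element moves along the chain of \<open>S\<close>,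
  so after \<open>2 N\<close> brackets nothing but 0 is left.\<close>

lemma normalizing_element_exists:
  fixes S W :: "(complex ^ 'n ^ 'n) set"
  assumes S: "acts_nilpotently S" "S \<subseteq> W"
    and W: "\<And>A B. A \<in> W \<Longrightarrow> B \<in> W \<Longrightarrow> bracket A B \<in> W"
    and x: "x \<in> W" "x \<notin> cmat.span S"
  shows "\<exists>y\<in>W. y \<notin> cmat.span S \<and> (\<forall>A\<in>S. bracket A y \<in> cmat.span S)"
proof (rule ccontr)
  assume none: "\<not> ?thesis"
  obtain N where N: "kernel_chain S N = UNIV" using S by (auto simp: acts_nilpotently_def)
  have "\<exists>y\<in>W. y \<notin> cmat.span S \<and> (\<forall>j. \<forall>v\<in>kernel_chain S j. y *v v \<in> kernel_chain S (N + j - r))" for r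
  proof (induction r)
    case 0
    have "x *v v \<in> kernel_chain S (N + j)" for j v
      using kernel_chain_mono[of S N j] N by auto
    then show ?case using x by auto
  next
    case (Suc r)
    then obtain y where y: "y \<in> W" "y \<notin> cmat.span S"
      "\<And>j v. v \<in> kernel_chain S j \<Longrightarrow> y *v v \<in> kernel_chain S (N + j - r)" by blast
    then obtain A where A: "A \<in> S" "bracket A y \<notin> cmat.span S" using none by blast
    have low: "A *v v \<in> kernel_chain S (i - 1)" if "v \<in> kernel_chain S i" for v i
      using that A(1) by (cases i) auto
    have "bracket A y *v v \<in> kernel_chain S (N + j - Suc r)" if v: "v \<in> kernel_chain S j" for j v
    proof (cases j)
      case 0
      then show ?thesis using v vec.subspace_0[OF kernel_chain_subspace] by simp
    next
      case (Suc i)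
      have "A *v (y *v v) \<in> kernel_chain S (N + j - Suc r)"
        using low[OF y(3)[OF v]] by simp
      moreover have "y *v (A *v v) \<in> kernel_chain S (N + j - Suc r)"
        using y(3)[OF low[OF v]] Suc by simp
      ultimately have "A *v (y *v v) - y *v (A *v v) \<in> kernel_chain S (N + j - Suc r)"
        using vec.subspace_diff[OF kernel_chain_subspace] by blast
      then show ?thesis
        by (simp add: bracket_def matrix_vector_mul_assoc matrix_vector_mult_diff_rdistrib)
    qed
    moreover have "bracket A y \<in> W" using W S(2) A(1) y(1) by blast
    ultimately show ?case using A(2) by blast
  qed
  from this[of "N + N"] obtain y where y: "y \<notin> cmat.span S"
    "\<forall>j. \<forall>v\<in>kernel_chain S j. y *v v \<in> kernel_chain S (N + j - (N + N))" by blast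
  have "y *v v = 0" for v using y(2)[rule_format, of v N] N by simp
  then have "y = 0" by (metis matrix_eq matrix_vector_mult_0)
  then show False using y(1) cmat.span_zero by blast
qed

text \<open>Jacobson's generalization of Engel's theorem: a set closed under brackets and consisting of nilpotent
  matrices spans a space of nilpotent matrices. Among the subsets that act nilpotently and whose span
  is closed under brackets, take one with a span of greatest dimension. If the span were not everything, a
  normalizing element could be added.\<close>

lemma weakly_closed_acts_nilpotently:
  fixes W :: "(complex ^ 'n ^ 'n) set"
  assumes W: "\<And>A B. A \<in> W \<Longrightarrow> B \<in> W \<Longrightarrow> bracket A B \<in> W"
    and nil: "\<And>A. A \<in> W \<Longrightarrow> nilpotent A"
  shows "acts_nilpotently (cmat.span W)"
proof -
  define good where "good S \<longleftrightarrow> S \<subseteq> W \<and> acts_nilpotently S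
    \<and> (\<forall>A\<in>S. \<forall>B\<in>S. bracket A B \<in> cmat.span S)" for S
  have "good {}" by (auto simp: good_def acts_nilpotently_def intro: exI[of _ 1])
  moreover have "dim (cmat.span S) \<le> DIM(complex ^ 'n ^ 'n)" for S :: "(complex ^ 'n ^ 'n) set"
    by (rule dim_subset_UNIV)
  then have "\<forall>S. good S \<longrightarrow> dim (cmat.span S) < Suc DIM(complex ^ 'n ^ 'n)" by (meson less_Suc_eq_le)
  ultimately have "\<exists>S. good S \<and> (\<forall>T. good T \<longrightarrow> dim (cmat.span T) \<le> dim (cmat.span S))"
    by (rule ex_has_greatest_nat)
  then obtain S where S: "good S" and max: "\<And>T. good T \<Longrightarrow> dim (cmat.span T) \<le> dim (cmat.span S)"
    by blast
  have "W \<subseteq> cmat.span S"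
  proof
    fix x assume "x \<in> W"
    show "x \<in> cmat.span S"
    proof (rule ccontr)
      assume "x \<notin> cmat.span S"
      then obtain y where y: "y \<in> W" "y \<notin> cmat.span S" "\<And>A. A \<in> S \<Longrightarrow> bracket A y \<in> cmat.span S"
        using normalizing_element_exists[of S W x] S W \<open>x \<in> W\<close> unfolding good_def by blast
      have sub: "cmat.span S \<subseteq> cmat.span (insert y S)" by (rule cmat.span_mono) auto
      have br: "bracket A B \<in> cmat.span (insert y S)" if "A \<in> insert y S" "B \<in> insert y S" for A B
      proof -
        have "bracket y A \<in> cmat.span S" if "A \<in> S" for A
          by (subst bracket_swap) (intro cmat.span_scale y(3) that)
        then have "bracket A B \<in> cmat.span S"
          using that S y(3) unfolding good_def by (auto simp: bracket_simps cmat.span_zero)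
        then show ?thesis using sub by blast
      qed
      have "good (insert y S)"
        using S y br nil acts_nilpotently_insert[of S y] unfolding good_def by blast
      then have "dim (cmat.span (insert y S)) \<le> dim (cmat.span S)" by (rule max)
      moreover have real: "subspace (cmat.span T)" for T :: "(complex ^ 'n ^ 'n) set"
      proof -
        have "r *\<^sub>R A = cscale (of_real r) A" for r and A :: "complex ^ 'n ^ 'n"
          by (simp add: vec_eq_iff) (simp add: scaleR_conv_of_real)
        then show ?thesis unfolding subspace_def
          by (auto intro: cmat.span_zero cmat.span_add cmat.span_scale)
      qed
      ultimately have "cmat.span S = cmat.span (insert y S)"
        using sub by (intro subspace_dim_equal) auto
      then show False using y(2) cmat.span_base[of y "insert y S"] by simp
    qed
  qed
  then have "cmat.span W \<subseteq> cmat.span S" by (rule cmat.span_minimal) (rule cmat.subspace_span)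
  moreover obtain N where "kernel_chain (cmat.span S) N = UNIV"
    using S by (auto simp: good_def acts_nilpotently_def kernel_chain_span)
  ultimately show ?thesis
    using kernel_chain_antimono unfolding acts_nilpotently_def by blast
qed

section \<open>The grading by integer weights\<close>

text \<open>A basis, given by the columns of \<open>P\<close>, whose vectors have integer weights \<open>w\<close>. A matrix has degree \<open>j\<close> if its
  entry at \<open>(p, q)\<close> in this basis vanishes unless \<open>w p - w q = j\<close>.\<close>

locale weight_grading =
  fixes P Q :: "complex ^ 'n ^ 'n" and w :: "'n \<Rightarrow> int"
  assumes QP: "Q ** P = mat 1" and PQ: "P ** Q = mat 1"
begin

definition ent :: "complex ^ 'n ^ 'n \<Rightarrow> 'n \<Rightarrow> 'n \<Rightarrow> complex" where
  "ent A p q = (Q ** A ** P) $ p $ q"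

definition mk :: "('n \<Rightarrow> 'n \<Rightarrow> complex) \<Rightarrow> complex ^ 'n ^ 'n" where
  "mk f = P ** (\<chi> p q. f p q) ** Q"

text \<open>The homogeneous component of degree \<open>j\<close>.\<close>

definition hcomp :: "int \<Rightarrow> complex ^ 'n ^ 'n \<Rightarrow> complex ^ 'n ^ 'n" where
  "hcomp j A = mk (\<lambda>p q. if w p - w q = j then ent A p q else 0)"

text \<open>The matrices without components of degree less than \<open>j\<close>.\<close>

definition fil :: "int \<Rightarrow> (complex ^ 'n ^ 'n) set" where
  "fil j = {A. \<forall>p q. w p - w q < j \<longrightarrow> ent A p q = 0}"

lemma ent_eqI: "(\<And>p q. ent A p q = ent B p q) \<Longrightarrow> A = B"
  unfolding ent_def by (rule conj_entry_eqI[OF QP PQ])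

lemma ent_mk [simp]: "ent (mk f) p q = f p q"
  unfolding ent_def mk_def conj_cancel(1)[OF QP PQ] by simp

lemma ent_add [simp]: "ent (A + B) p q = ent A p q + ent B p q"
  and ent_diff [simp]: "ent (A - B) p q = ent A p q - ent B p q"
  and ent_cscale [simp]: "ent (cscale c A) p q = c * ent A p q"
  and ent_0 [simp]: "ent 0 p q = 0"
  and ent_1: "ent (mat 1) p q = (if p = q then 1 else 0)"
  by (simp_all add: ent_def matrix_ring QP) (simp add: mat_def)

lemma ent_mult: "ent (A ** B) p q = (\<Sum>r\<in>UNIV. ent A p r * ent B r q)"
  unfolding ent_def conj_mult[OF PQ] matrix_mult_nth by simp

lemma ent_sum: "ent (\<Sum>i\<in>I. f i) p q = (\<Sum>i\<in>I. ent (f i) p q)"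
  by (induction I rule: infinite_finite_induct) auto

lemma ent_hcomp [simp]: "ent (hcomp j A) p q = (if w p - w q = j then ent A p q else 0)"
  by (simp add: hcomp_def)

lemma hcomp_add: "hcomp j (A + B) = hcomp j A + hcomp j B"
  and hcomp_diff: "hcomp j (A - B) = hcomp j A - hcomp j B"
  and hcomp_cscale: "hcomp j (cscale c A) = cscale c (hcomp j A)"
  and hcomp_0 [simp]: "hcomp j 0 = 0"
  and hcomp_1 [simp]: "hcomp 0 (mat 1) = mat 1"
  and hcomp_hcomp: "hcomp j (hcomp i A) = (if i = j then hcomp j A else 0)"
  by (auto intro!: ent_eqI simp: ent_1)

lemma hcomp_sum: "hcomp j (\<Sum>i\<in>I. f i) = (\<Sum>i\<in>I. hcomp j (f i))"
  by (induction I rule: infinite_finite_induct) (auto simp: hcomp_add)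

lemma fil_subspace: "cmat.subspace (fil j)"
  by (auto simp: cmat.subspace_def fil_def)

lemma fil_antimono: "i \<le> j \<Longrightarrow> A \<in> fil j \<Longrightarrow> A \<in> fil i"
  by (auto simp: fil_def)

lemma hcomp_fil: "hcomp j A \<in> fil j"
  by (auto simp: fil_def)

lemma mat_1_fil: "mat 1 \<in> fil 0"
  by (auto simp: fil_def ent_1)

lemma fil_mult:
  assumes "A \<in> fil i" "B \<in> fil j" shows "A ** B \<in> fil (i + j)"
  unfolding fil_def mem_Collect_eq ent_mult
proof (intro allI impI sum.neutral ballI)
  fix p q r assume "w p - w q < i + j"
  then have "w p - w r < i \<or> w r - w q < j" by linarith
  then show "ent A p r * ent B r q = 0" using assms by (auto simp: fil_def)
qed

lemma hcomp_mult:
  assumes "A \<in> fil i" "B \<in> fil j" shows "hcomp (i + j) (A ** B) = hcomp i A ** hcomp j B"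
proof (rule ent_eqI)
  fix p q
  show "ent (hcomp (i + j) (A ** B)) p q = ent (hcomp i A ** hcomp j B) p q"
    unfolding ent_hcomp ent_mult
  proof (cases "w p - w q = i + j")
    case True
    have "ent A p r * ent B r q = (if w p - w r = i then ent A p r else 0) * (if w r - w q = j then ent B r q else 0)" for r
    proof (cases "w p - w r = i")
      case True
      then show ?thesis using \<open>w p - w q = i + j\<close> by auto
    next
      case False
      then have "w p - w r < i \<or> w r - w q < j" using True by linarith
      then have "ent A p r * ent B r q = 0" using assms by (auto simp: fil_def)
      then show ?thesis using False by simp
    qed
    then show "(if w p - w q = i + j then \<Sum>r\<in>UNIV. ent A p r * ent B r q else 0) =
      (\<Sum>r\<in>UNIV. (if w p - w r = i then ent A p r else 0) * (if w r - w q = j then ent B r q else 0))"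
      using True by simp
  next
    case False
    then have "(if w p - w r = i then ent A p r else 0) * (if w r - w q = j then ent B r q else 0) = 0" for r
      by auto
    then show "(if w p - w q = i + j then \<Sum>r\<in>UNIV. ent A p r * ent B r q else 0) =
      (\<Sum>r\<in>UNIV. (if w p - w r = i then ent A p r else 0) * (if w r - w q = j then ent B r q else 0))"
      using False by (simp only: if_False sum.neutral_const)
  qed
qed

lemma fil_diff_hcomp:
  assumes "A \<in> fil j" shows "A - hcomp j A \<in> fil (j + 1)"
  using assms by (auto simp: fil_def)

lemma hcomp_eq_0: "A \<in> fil j \<Longrightarrow> i < j \<Longrightarrow> hcomp i A = 0"
  by (auto intro!: ent_eqI simp: fil_def)

lemma weight_bound: "\<exists>J::nat. \<forall>p q. \<bar>w p - w q\<bar> < int J"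
proof -
  define M where "M = Max (range (\<lambda>(p, q). \<bar>w p - w q\<bar>))"
  have "\<bar>w p - w q\<bar> \<le> M" for p q
    unfolding M_def by (rule Max_ge) (auto intro: range_eqI[of _ _ "(p, q)"])
  then have "\<bar>w p - w q\<bar> < int (nat (M + 1))" for p q
    using order_trans [OF abs_ge_zero \<open>\<bar>w p - w q\<bar> \<le> M\<close>] by (simp add: order_le_less_trans)
  then show ?thesis by blast
qed

lemma fil_large_zero: "(\<And>p q. \<bar>w p - w q\<bar> < J) \<Longrightarrow> J \<le> j \<Longrightarrow> A \<in> fil j \<Longrightarrow> A = 0"
  by (rule ent_eqI) (smt (verit) fil_def mem_Collect_eq ent_0)

lemma sum_hcomp:
  assumes "A \<in> fil j" "\<And>p q. \<bar>w p - w q\<bar> < J" "J \<le> k"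
  shows "A = (\<Sum>i=j..k. hcomp i A)"
proof (rule ent_eqI)
  fix p q
  have "ent (\<Sum>i=j..k. hcomp i A) p q = (\<Sum>i=j..k. if i = w p - w q then ent A p q else 0)"
    unfolding ent_sum by (intro sum.cong refl) auto
  also have "\<dots> = ent A p q"
  proof (cases "w p - w q < j")
    case True
    then show ?thesis using assms(1) by (simp add: fil_def)
  next
    case False
    then have "w p - w q \<in> {j..k}" using assms(2)[of p q] assms(3) by auto
    then show ?thesis by simp
  qed
  finally show "ent A p q = ent (\<Sum>i=j..k. hcomp i A) p q" by simp
qed

lemma mpow_fil: "A \<in> fil j \<Longrightarrow> mpow A k \<in> fil (int k * j)"
proof (induction k)
  case (Suc k)
  then show ?case using fil_mult[of A j "mpow A k" "int k * j"] by (simp add: mpow_Suc algebra_simps)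
qed (simp add: mat_1_fil)

lemma fil_1_nilpotent:
  assumes "A \<in> fil 1" shows "nilpotent A"
proof -
  obtain J where J: "\<And>p q. \<bar>w p - w q\<bar> < int J" using weight_bound by blast
  have "mpow A J = 0" by (rule fil_large_zero[OF J order_refl]) (use mpow_fil[OF assms, of J] in simp)
  then show ?thesis by (auto simp: nilpotent_def)
qed

lemma hcomp_mpow_homogeneous: "ent (mpow (hcomp j A) k) p q \<noteq> 0 \<Longrightarrow> w p - w q = int k * j"
proof (induction k arbitrary: p)
  case 0 then show ?case by (auto simp: ent_1 split: if_splits)
next
  case (Suc k)
  then obtain r where "ent (hcomp j A) p r * ent (mpow (hcomp j A) k) r q \<noteq> 0"
    unfolding mpow_Suc ent_mult by (meson sum.neutral)
  then have "w p - w r = j" "w r - w q = int k * j"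
    using Suc.IH[of r] by (auto split: if_splits)
  then show ?case by (simp add: algebra_simps)
qed

lemma hcomp_nilpotent:
  assumes "j \<noteq> 0" shows "nilpotent (hcomp j A)"
proof -
  obtain J where J: "\<And>p q. \<bar>w p - w q\<bar> < int J" using weight_bound by blast
  have "mpow (hcomp j A) J = 0"
  proof (rule ent_eqI)
    fix p q
    have "int J * 1 \<le> int J * \<bar>j\<bar>" using assms by (intro mult_left_mono) auto
    then have "int J \<le> \<bar>int J * j\<bar>" by (simp add: abs_mult)
    then have "w p - w q \<noteq> int J * j" using J[of p q] by linarith
    then show "ent (mpow (hcomp j A) J) p q = ent 0 p q" using hcomp_mpow_homogeneous[of j A J p q] by auto
  qed
  then show ?thesis by (auto simp: nilpotent_def)
qed

text \<open>Taking the component of degree 0 is a ring homomorphism on \<open>fil 0\<close>.\<close>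

lemma peval_fil:
  assumes "A \<in> fil 0"
  shows "peval p A \<in> fil 0 \<and> hcomp 0 (peval p A) = peval p (hcomp 0 A)"
proof (induction p)
  case 0 then show ?case using cmat.subspace_0[OF fil_subspace] by simp
next
  case (pCons c p)
  have "A ** peval p A \<in> fil 0" "hcomp 0 (A ** peval p A) = hcomp 0 A ** hcomp 0 (peval p A)"
    using fil_mult[OF assms, of "peval p A" 0] hcomp_mult[OF assms, of "peval p A" 0] pCons by simp_all
  moreover have "cscale c (mat 1) \<in> fil 0" using cmat.subspace_scale[OF fil_subspace mat_1_fil] .
  ultimately show ?case using pCons
    by (simp add: hcomp_add hcomp_cscale cmat.subspace_add[OF fil_subspace])
qed

lemma matrix_inv_fil:
  assumes "A \<in> fil 0" "invertible A" shows "matrix_inv A \<in> fil 0"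
  using inverse_is_peval[OF assms(2)] peval_fil[OF assms(1)] by auto

lemma hcomp_nilpotent_part:
  assumes "A \<in> fil 0" "nilpotent A" shows "nilpotent (hcomp 0 A)"
proof -
  obtain k where "mpow A k = 0" using assms(2) by (auto simp: nilpotent_def)
  then have "peval (monom 1 k) A = 0" by (simp add: peval_monom)
  then have "peval (monom 1 k) (hcomp 0 A) = 0" using peval_fil[OF assms(1), of "monom 1 k"] by simp
  then show ?thesis by (auto simp: peval_monom nilpotent_def)
qed

text \<open>Since \<open>S\<close> and its part \<open>S\<^sub>0\<close> of degree 0 are annihilated by the same polynomial with simple roots, both have
  spectral projections, given by the same polynomials \<open>p\<^sub>\<mu>\<close>. The sum \<open>u\<close> of the products
  \<open>p\<^sub>\<mu> S\<^sub>0 ** p\<^sub>\<mu> S\<close> intertwines \<open>S\<close> with \<open>S\<^sub>0\<close>. Its part of degree 0 is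
  the sum of the squares of the projections \<open>p\<^sub>\<mu> S\<^sub>0\<close>, that is, the identity.\<close>

lemma intertwiner_exists:
  assumes S: "S \<in> fil 0" "semisimple S"
  shows "\<exists>u\<in>fil 0. hcomp 0 u = mat 1 \<and> u ** S = hcomp 0 S ** u"
proof -
  obtain M where M: "finite M" "peval (root_poly M) S = 0" using semisimple_root_poly[OF S(2)] by blast
  have "M \<noteq> {}" using M(2) by (auto simp: root_poly_def mat_1_neq_0)
  let ?S0 = "hcomp 0 S"
  have M0: "peval (root_poly M) ?S0 = 0" using peval_fil[OF S(1), of "root_poly M"] M(2) by simp
  have eig: "X ** peval (lagrange M \<mu>) X = cscale \<mu> (peval (lagrange M \<mu>) X)"
    if "\<mu> \<in> M" "peval (root_poly M) X = 0" for \<mu> X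
  proof -
    have "peval ([:- \<mu>, 1:] * lagrange M \<mu>) X = 0"
      using root_poly_dvd_lagrange[OF M(1) that(1)] that(2) by (rule peval_dvd)
    then show ?thesis unfolding peval_mult by (simp add: matrix_ring cscale_mult_right)
  qed
  define u where "u = (\<Sum>\<mu>\<in>M. peval (lagrange M \<mu>) ?S0 ** peval (lagrange M \<mu>) S)"
  have "u ** S = (\<Sum>\<mu>\<in>M. cscale \<mu> (peval (lagrange M \<mu>) ?S0 ** peval (lagrange M \<mu>) S))"
    unfolding u_def matrix_sum_mult
  proof (intro sum.cong refl)
    fix \<mu> assume "\<mu> \<in> M"
    then have "peval (lagrange M \<mu>) S ** S = cscale \<mu> (peval (lagrange M \<mu>) S)"
      using eig M(2) by (simp add: peval_commute_self [symmetric])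
    then show "peval (lagrange M \<mu>) ?S0 ** peval (lagrange M \<mu>) S ** S =
        cscale \<mu> (peval (lagrange M \<mu>) ?S0 ** peval (lagrange M \<mu>) S)"
      by (simp add: matrix_mul_assoc [symmetric] cscale_mult_right)
  qed
  also have "\<dots> = ?S0 ** u"
    unfolding u_def matrix_mult_sum_right
    by (intro sum.cong refl) (simp add: matrix_mul_assoc eig M0 cscale_mult_left)
  finally have "u ** S = ?S0 ** u" .
  moreover have S0f: "?S0 \<in> fil 0" by (rule hcomp_fil)
  have part: "peval (lagrange M \<mu>) ?S0 ** peval (lagrange M \<mu>) S \<in> fil 0"
      "hcomp 0 (peval (lagrange M \<mu>) ?S0 ** peval (lagrange M \<mu>) S) = peval (lagrange M \<mu>) ?S0"
    if mu: "\<mu> \<in> M" for \<mu>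
  proof -
    have f: "peval (lagrange M \<mu>) ?S0 \<in> fil 0" "peval (lagrange M \<mu>) S \<in> fil 0"
      using peval_fil S(1) S0f by blast+
    show "peval (lagrange M \<mu>) ?S0 ** peval (lagrange M \<mu>) S \<in> fil 0"
      using fil_mult[OF f] by simp
    have "hcomp 0 (peval (lagrange M \<mu>) ?S0 ** peval (lagrange M \<mu>) S)
        = peval (lagrange M \<mu>) ?S0 ** peval (lagrange M \<mu>) ?S0"
      using hcomp_mult[OF f] peval_fil S(1) S0f by (simp add: hcomp_hcomp)
    also have "\<dots> = peval (lagrange M \<mu> * lagrange M \<mu>) ?S0" by (simp add: peval_mult)
    also have "\<dots> = peval (lagrange M \<mu>) ?S0"
    proof -
      have "[:- \<mu>, 1:] dvd lagrange M \<mu> - 1"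
        using poly_lagrange[OF M(1) mu mu] by (simp add: poly_eq_0_iff_dvd [symmetric])
      then obtain r where r: "lagrange M \<mu> - 1 = [:- \<mu>, 1:] * r" by (elim dvdE)
      have "lagrange M \<mu> * lagrange M \<mu> - lagrange M \<mu> = ([:- \<mu>, 1:] * lagrange M \<mu>) * r"
        using r by (simp add: algebra_simps del: mult_pCons_left mult_pCons_right)
      moreover have "peval (([:- \<mu>, 1:] * lagrange M \<mu>) * r) ?S0 = 0"
        using root_poly_dvd_lagrange[OF M(1) mu] M0 by (meson dvd_mult2 peval_dvd)
      ultimately show ?thesis by (metis peval_diff right_minus_eq)
    qed
    finally show "hcomp 0 (peval (lagrange M \<mu>) ?S0 ** peval (lagrange M \<mu>) S) = peval (lagrange M \<mu>) ?S0" .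
  qed
  have "u \<in> fil 0" unfolding u_def by (intro cmat.subspace_sum[OF fil_subspace] part)
  moreover have "hcomp 0 u = mat 1"
    unfolding u_def hcomp_sum using lagrange_sum[OF M(1) \<open>M \<noteq> {}\<close>]
    by (simp add: part peval_sum [symmetric])
  ultimately show ?thesis by blast
qed

end

context weight_grading
begin

lemma tendsto_ent:
  assumes "(X \<longlongrightarrow> h) F" shows "((\<lambda>t. ent (X t) p q) \<longlongrightarrow> ent h p q) F"
  unfolding ent_def matrix_mult_nth using assms
  by (intro tendsto_sum tendsto_mult tendsto_const tendsto_vec_nth)

lemma tendsto_mk:
  assumes "\<And>p q. ((\<lambda>t. f t p q) \<longlongrightarrow> g p q) F"
  shows "((\<lambda>t. mk (f t)) \<longlongrightarrow> mk g) F"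
proof (intro vec_tendstoI)
  fix i j
  show "((\<lambda>t. mk (f t) $ i $ j) \<longlongrightarrow> mk g $ i $ j) F"
    unfolding mk_def matrix_mult_nth using assms
    by (simp, intro tendsto_sum tendsto_mult tendsto_const) auto
qed

lemma poly_fun_ent: "poly_fun (\<lambda>X. ent X p q)"
  unfolding ent_def by (rule poly_fun_subst[OF poly_fun_mult_right poly_fun_mult_left])

lemma hcomp_mult_degree_0:
  "hcomp j (hcomp 0 A ** B) = hcomp 0 A ** hcomp j B"
  "hcomp j (B ** hcomp 0 A) = hcomp j B ** hcomp 0 A"
  by (rule ent_eqI, simp only: ent_mult ent_hcomp, auto intro!: sum.cong sum.neutral)+

lemma hcomp_bracket_degree_0: "hcomp j (bracket (hcomp 0 A) B) = bracket (hcomp 0 A) (hcomp j B)"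
  by (simp add: bracket_def hcomp_diff hcomp_mult_degree_0)

end

section \<open>One-parameter subgroups and their unipotent radicals\<close>

text \<open>A one-parameter subgroup with weights \<open>w\<close>. The shift \<open>a\<close> is the exponent of a central twist; it
  cancels in all adjoint actions, so the generator of the twisted group induces the same grading.\<close>

locale one_ps = weight_grading P Q w for P Q :: "complex ^ 'n ^ 'n" and w +
  fixes G :: "(complex ^ 'n ^ 'n) set" and lam :: "complex \<Rightarrow> complex ^ 'n ^ 'n" and a :: complex
  assumes G: "alg_group G"
    and lam_in: "t \<noteq> 0 \<Longrightarrow> lam t \<in> G"
    and lam_eq: "t \<noteq> 0 \<Longrightarrow> lam t = P ** diag (\<lambda>p. t powi w p) ** Q"
    and generator_in: "P ** diag (\<lambda>p. a + of_int (w p)) ** Q \<in> lie_alg G"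
begin

lemma ent_conj_lam:
  assumes "t \<noteq> 0"
  shows "ent (lam t ** A ** matrix_inv (lam t)) p q = t powi (w p - w q) * ent A p q"
proof -
  have "lam t ** (P ** diag (\<lambda>p. t powi (- w p)) ** Q) = mat 1"
  proof (rule ent_eqI)
    fix p q
    have "Q ** (lam t ** (P ** diag (\<lambda>p. t powi (- w p)) ** Q)) ** P
        = diag (\<lambda>p. t powi w p) ** diag (\<lambda>p. t powi (- w p))"
      by (simp only: conj_mult[OF PQ, of "lam t"]) (simp only: lam_eq[OF assms] conj_cancel(1)[OF QP PQ])
    also have "\<dots> = mat 1"
      using assms by (simp add: diag_mult power_int_add [symmetric]) (simp add: vec_eq_iff diag_nth mat_def)
    finally show "ent (lam t ** (P ** diag (\<lambda>p. t powi (- w p)) ** Q)) p q = ent (mat 1) p q"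
      by (simp add: ent_def QP)
  qed
  then have inv: "matrix_inv (lam t) = P ** diag (\<lambda>p. t powi (- w p)) ** Q"
    by (intro matrix_inv_eqI) (simp_all add: matrix_left_right_inverse)
  have "Q ** (lam t ** A ** matrix_inv (lam t)) ** P
      = diag (\<lambda>p. t powi w p) ** (Q ** A ** P) ** diag (\<lambda>p. t powi (- w p))"
    unfolding inv by (simp only: conj_mult[OF PQ, of "lam t ** A"] conj_mult[OF PQ, of "lam t"])
       (simp only: lam_eq[OF assms] conj_cancel(1)[OF QP PQ])
  then show ?thesis
    using assms by (simp add: ent_def diag_mult_nth power_int_diff power_int_minus field_simps)
qed

lemma lie_alg_hcomp:
  assumes "A \<in> lie_alg G" shows "hcomp j A \<in> lie_alg G"
proof -
  have "hcomp j A = eigencomp P Q (\<lambda>p. a + of_int (w p)) (of_int j) A"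
  proof -
    have "a + of_int (w p) - (a + of_int (w q)) = of_int j \<longleftrightarrow> w p - w q = j" for p q
      by (simp flip: of_int_diff)
    then show ?thesis by (simp only: hcomp_def mk_def eigencomp_def ent_def)
  qed
  then show ?thesis using lie_alg_eigencomp[OF G QP PQ generator_in assms] by simp
qed

text \<open>One value of \<open>t\<close> that is no root of unity detects the degree; the proof uses \<open>t = 2\<close>.\<close>

lemma lie_grade_iff: "A \<in> lie_grade G lam j \<longleftrightarrow> A \<in> lie_alg G \<and> hcomp j A = A"
proof (intro iffI conjI)
  assume A: "A \<in> lie_grade G lam j"
  then show "A \<in> lie_alg G" by (simp add: lie_grade_def)
  have "lam 2 ** A ** matrix_inv (lam 2) = cscale (2 powi j) A"
    using A unfolding lie_grade_def by (auto dest: spec[of _ 2])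
  then have *: "2 powi (w p - w q) * ent A p q = 2 powi j * ent A p q" for p q
  proof -
    have "2 powi (w p - w q) * ent A p q = ent (lam 2 ** A ** matrix_inv (lam 2)) p q"
      by (rule ent_conj_lam [symmetric]) simp
    also have "\<dots> = 2 powi j * ent A p q"
      by (simp only: \<open>lam 2 ** A ** matrix_inv (lam 2) = cscale (2 powi j) A\<close> ent_cscale)
    finally show ?thesis .
  qed
  show "hcomp j A = A"
  proof (rule ent_eqI)
    fix p q
    have "w p - w q = j" if "ent A p q \<noteq> 0"
    proof -
      have "(2 :: complex) powi (w p - w q) = 2 powi j" using *[of p q] mult_right_cancel[OF that] by blast
      then have "norm ((2 :: complex) powi (w p - w q)) = norm ((2 :: complex) powi j)" by simp
      then have eq: "(2 :: real) powi (w p - w q) = 2 powi j" by (simp add: norm_power_int)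
      show ?thesis
        using power_int_strict_increasing[of "w p - w q" j "2 :: real"]
          power_int_strict_increasing[of j "w p - w q" "2 :: real"] eq by (cases "w p - w q" j rule: linorder_cases) auto
    qed
    then show "ent (hcomp j A) p q = ent A p q" by auto
  qed
next
  assume A: "A \<in> lie_alg G \<and> hcomp j A = A"
  have z: "ent A p q = 0" if "w p - w q \<noteq> j" for p q
    using ent_hcomp[of j A p q] A that by simp
  have "lam t ** A ** matrix_inv (lam t) = cscale (t powi j) A" if "t \<noteq> 0" for t
  proof (rule ent_eqI)
    fix p q
    show "ent (lam t ** A ** matrix_inv (lam t)) p q = ent (cscale (t powi j) A) p q"
      using z[of p q] by (cases "w p - w q = j") (simp_all add: ent_conj_lam[OF that])
  qed
  then show "A \<in> lie_grade G lam j" using A by (simp add: lie_grade_def)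
qed

lemma leading_term_iff:
  assumes A: "A \<in> lie_alg G"
  shows "leading_term G lam A B \<longleftrightarrow> (\<exists>j. A \<in> fil j \<and> B = hcomp j A \<and> B \<noteq> 0)"
proof
  assume "leading_term G lam A B"
  then obtain C j k where C: "j \<le> k" "\<And>i. hcomp i (C i) = C i" "A = (\<Sum>i=j..k. C i)" "C j \<noteq> 0" "B = C j"
    unfolding leading_term_def lie_grade_iff by blast
  have "C i \<in> fil j" if "j \<le> i" for i
    using fil_antimono[OF that hcomp_fil[of i "C i"]] C(2) by simp
  then have "A \<in> fil j" unfolding C(3) by (intro cmat.subspace_sum[OF fil_subspace]) auto
  moreover have "hcomp j A = (\<Sum>i=j..k. if i = j then C j else 0)"
    unfolding C(3) hcomp_sum by (intro sum.cong refl) (metis C(2) hcomp_hcomp)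
  then have "hcomp j A = C j" using C(1) by simp
  ultimately show "\<exists>j. A \<in> fil j \<and> B = hcomp j A \<and> B \<noteq> 0" using C by metis
next
  assume "\<exists>j. A \<in> fil j \<and> B = hcomp j A \<and> B \<noteq> 0"
  then obtain j where j: "A \<in> fil j" "B = hcomp j A" "B \<noteq> 0" by blast
  obtain J where J: "\<And>p q. \<bar>w p - w q\<bar> < int J" using weight_bound by blast
  have "A = (\<Sum>i=j..max j (int J). hcomp i A)" by (rule sum_hcomp[OF j(1) J]) simp
  then show "leading_term G lam A B"
    unfolding leading_term_def using j lie_alg_hcomp[OF A]
    by (intro exI[of _ "\<lambda>i. hcomp i A"] exI[of _ j] exI[of _ "max j (int J)"])
       (simp add: lie_grade_iff hcomp_hcomp)
qed

text \<open>The elements of \<open>G\<close> that \<open>lam t\<close> contracts to 1 as \<open>t\<close> tends to 0.\<close>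

definition U :: "(complex ^ 'n ^ 'n) set" where
  "U = {g \<in> G. g - mat 1 \<in> fil 1}"

text \<open>The curve of the conjugates of \<open>g \<in> U\<close> by \<open>lam t\<close>, extended to \<open>t = 0\<close> by the identity; its entries
  are polynomials in \<open>t\<close>.\<close>

definition contraction :: "complex ^ 'n ^ 'n \<Rightarrow> complex \<Rightarrow> complex ^ 'n ^ 'n" where
  "contraction g t = mk (\<lambda>p q. if w p - w q \<le> 0 then ent (mat 1) p q else t ^ nat (w p - w q) * ent g p q)"

lemma contraction_0: "contraction g 0 = mat 1"
  by (rule ent_eqI) (auto simp: contraction_def ent_1)

lemma contraction_eq:
  assumes "g - mat 1 \<in> fil 1" "t \<noteq> 0"
  shows "contraction g t = lam t ** g ** matrix_inv (lam t)"
proof (rule ent_eqI)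
  fix p q
  show "ent (contraction g t) p q = ent (lam t ** g ** matrix_inv (lam t)) p q"
  proof (cases "w p - w q \<le> 0")
    case True
    then have "ent g p q = ent (mat 1) p q" using assms(1) by (simp add: fil_def)
    then show ?thesis using True
      by (auto simp: contraction_def ent_conj_lam[OF assms(2)] ent_1)
  next
    case False
    then show ?thesis
      by (simp add: contraction_def ent_conj_lam[OF assms(2)] power_int_nonneg_exp)
  qed
qed

lemma contraction_isCont: "isCont (contraction g) t"
  unfolding isCont_def contraction_def
  by (intro tendsto_mk) (auto intro!: tendsto_intros)

lemma fil_0_of_unipotent: "g - mat 1 \<in> fil 1 \<Longrightarrow> g \<in> fil 0"
  using cmat.subspace_add[OF fil_subspace fil_antimono[of 0 1 "g - mat 1"] mat_1_fil] by simp

lemma contraction_in_U: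
  assumes "g \<in> U" shows "contraction g t \<in> U"
proof (cases "t = 0")
  case True
  then show ?thesis using alg_group_1[OF G] cmat.subspace_0[OF fil_subspace]
    by (simp add: contraction_0 U_def)
next
  case False
  have g: "g \<in> G" "g - mat 1 \<in> fil 1" using assms by (auto simp: U_def)
  have "contraction g t \<in> G"
    unfolding contraction_eq[OF g(2) False] using lam_in[OF False] G g(1)
    by (intro alg_group_mult alg_group_inv) auto
  moreover have "contraction g t - mat 1 \<in> fil 1"
    by (auto simp: fil_def contraction_def)
  ultimately show ?thesis by (simp add: U_def)
qed

lemma alg_group_U: "alg_group U"
  unfolding alg_group_def
proof (intro conjI ballI)
  obtain F where F: "\<forall>f\<in>F. poly_fun f" "G = {g. invertible g \<and> (\<forall>f\<in>F. f g = 0)}"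
    using G unfolding alg_group_def closedin_zariski by blast
  define F' where "F' = {\<lambda>g. ent g p q - ent (mat 1) p q | p q. w p - w q < 1}"
  have "\<forall>f\<in>F \<union> F'. poly_fun f"
    using F(1) by (auto simp: F'_def intro: poly_fun_diff poly_fun_ent poly_fun.const)
  moreover have "U = {g. invertible g \<and> (\<forall>f\<in>F \<union> F'. f g = 0)}"
  proof (intro equalityI subsetI)
    fix g assume "g \<in> U"
    then show "g \<in> {g. invertible g \<and> (\<forall>f\<in>F \<union> F'. f g = 0)}"
      unfolding U_def fil_def F'_def by (subst (asm) F(2)) auto
  next
    fix g assume g: "g \<in> {g. invertible g \<and> (\<forall>f\<in>F \<union> F'. f g = 0)}"
    then have "g \<in> G" by (subst F(2)) auto
    moreover have "ent g p q - ent (mat 1) p q = 0" if "w p - w q < 1" for p q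
    proof -
      have "(\<lambda>g. ent g p q - ent (mat 1) p q) \<in> F'" using that unfolding F'_def by blast
      moreover have "\<forall>f\<in>F'. f g = 0" using g by simp
      ultimately show ?thesis by (rule bspec [rotated])
    qed
    ultimately show "g \<in> U" by (simp add: U_def fil_def)
  qed
  ultimately show "closedin zariski U" unfolding closedin_zariski by blast
next
  show "mat 1 \<in> U" using alg_group_1[OF G] cmat.subspace_0[OF fil_subspace] by (simp add: U_def)
next
  fix g h assume "g \<in> U" "h \<in> U"
  then have gh: "g \<in> G" "h \<in> G" "g - mat 1 \<in> fil 1" "h - mat 1 \<in> fil 1" by (auto simp: U_def)
  have "g ** h - mat 1 = (g - mat 1) ** h + (h - mat 1)" by (simp add: matrix_ring)
  moreover have "(g - mat 1) ** h \<in> fil 1"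
    using fil_mult[OF gh(3) fil_0_of_unipotent[OF gh(4)]] by simp
  ultimately have "g ** h - mat 1 \<in> fil 1" by (metis cmat.subspace_add fil_subspace gh(4))
  then show "g ** h \<in> U" using gh alg_group_mult[OF G] by (simp add: U_def)
next
  fix g assume "g \<in> U"
  then have g: "g \<in> G" "g - mat 1 \<in> fil 1" by (auto simp: U_def)
  have inv: "invertible g" using alg_group_invertible[OF G g(1)] .
  have "matrix_inv g - mat 1 = cscale (-1) (matrix_inv g ** (g - mat 1))"
    by (simp add: matrix_diff_ldistrib matrix_inv_both[OF inv] vec_eq_iff)
  moreover have "matrix_inv g ** (g - mat 1) \<in> fil 1"
    using fil_mult[OF matrix_inv_fil[OF fil_0_of_unipotent[OF g(2)] inv] g(2)] by simp
  ultimately have "matrix_inv g - mat 1 \<in> fil 1" by (metis cmat.subspace_scale fil_subspace)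
  then show "matrix_inv g \<in> U" using alg_group_inv[OF G g(1)] by (simp add: U_def)
qed

lemma U_subset_parabolic: "U \<subseteq> parabolic G lam"
proof
  fix g assume "g \<in> U"
  then have g: "g \<in> G" "g - mat 1 \<in> fil 1" by (auto simp: U_def)
  have "(contraction g \<longlongrightarrow> mat 1) (at 0)"
    using contraction_isCont[where g = g and t = 0] by (simp add: isCont_def contraction_0)
  moreover have "\<forall>\<^sub>F t in at 0. contraction g t = lam t ** g ** matrix_inv (lam t)"
    using contraction_eq[OF g(2)] by (auto simp: eventually_at_filter)
  ultimately have "((\<lambda>t. lam t ** g ** matrix_inv (lam t)) \<longlongrightarrow> mat 1) (at 0)"
    by (rule Lim_transform_eventually)
  then show "g \<in> parabolic G lam" using g alg_group_1[OF G] unfolding parabolic_def by blast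
qed

text \<open>An entry in negative degree is multiplied by a negative power of \<open>t\<close>, so the limit exists only if it vanishes.\<close>

lemma parabolic_fil:
  assumes "g \<in> parabolic G lam" shows "g \<in> fil 0"
  unfolding fil_def
proof (intro CollectI allI impI)
  fix p q assume neg: "w p - w q < 0"
  obtain h where h: "((\<lambda>t. lam t ** g ** matrix_inv (lam t)) \<longlongrightarrow> h) (at 0)"
    using assms unfolding parabolic_def by blast
  define k where "k = nat (w q - w p)"
  have k: "k > 0" using neg by (simp add: k_def)
  have "((\<lambda>t. t ^ k * ent (lam t ** g ** matrix_inv (lam t)) p q) \<longlongrightarrow> 0 ^ k * ent h p q) (at 0)"
    by (intro tendsto_mult tendsto_ent[OF h] tendsto_power tendsto_ident_at)
  moreover have "\<forall>\<^sub>F t in at 0. t ^ k * ent (lam t ** g ** matrix_inv (lam t)) p q = ent g p q"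
    unfolding eventually_at_filter
  proof (rule always_eventually, intro allI impI)
    fix t :: complex assume t: "t \<noteq> 0"
    have "t ^ k * t powi (w p - w q) = t powi (int k + (w p - w q))" using t by (simp add: power_int_add)
    also have "int k + (w p - w q) = 0" using neg by (simp add: k_def)
    finally show "t ^ k * ent (lam t ** g ** matrix_inv (lam t)) p q = ent g p q"
      using t by (simp add: ent_conj_lam mult.assoc [symmetric])
  qed
  ultimately have "((\<lambda>t. ent g p q) \<longlongrightarrow> 0 ^ k * ent h p q) (at (0 :: complex))" by (rule Lim_transform_eventually)
  then have "ent g p q = 0 ^ k * ent h p q" by (rule tendsto_const_iff[THEN iffD1, rotated]) simp
  then show "ent g p q = 0" using k by simp
qed

text \<open>The contraction curves are continuous images of the complex plane; they cover \<open>U\<close> and meet in the identity.\<close>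

lemma connectedin_U: "connectedin zariski U"
proof -
  have cont: "continuous_map euclidean zariski (contraction g)" if g: "g \<in> U" for g
    unfolding continuous_map_def
  proof (intro conjI allI impI)
    show "contraction g \<in> topspace euclidean \<rightarrow> topspace zariski"
      using contraction_in_U[OF g] alg_group_invertible[OF alg_group_U] by (auto simp: topspace_zariski)
    fix V :: "(complex ^ 'n ^ 'n) set" assume "openin zariski V"
    then obtain F where F: "\<forall>f\<in>F. poly_fun f" "V = {g. invertible g \<and> (\<exists>f\<in>F. f g \<noteq> 0)}"
      unfolding openin_zariski by blast
    have inv: "invertible (contraction g t)" for t
      using contraction_in_U[OF g] alg_group_invertible[OF alg_group_U] by blast
    have "{x \<in> topspace euclidean. contraction g x \<in> V} = (\<Union>f\<in>F. {t. f (contraction g t) \<noteq> 0})"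
      unfolding F(2) using inv by auto
    moreover have "open {t. f (contraction g t) \<noteq> 0}" if "f \<in> F" for f
    proof -
      have "poly_fun f" using F(1) that by blast
      then have "isCont (\<lambda>t. f (contraction g t)) t" for t
      proof induction
        case (entry i j)
        then show ?case using contraction_isCont[where g = g and t = t] unfolding isCont_def
          by (intro tendsto_vec_nth)
      qed auto
      then have "continuous_on UNIV (\<lambda>t. f (contraction g t))"
        by (simp add: continuous_at_imp_continuous_on)
      then show ?thesis by (intro open_Collect_neq continuous_on_const)
    qed
    ultimately show "openin euclidean {x \<in> topspace euclidean. contraction g x \<in> V}"
      by (simp add: open_UN)
  qed
  have "connectedin zariski (contraction g ` UNIV)" if "g \<in> U" for g
    using connectedin_continuous_map_image[OF cont[OF that], of UNIV] by (simp add: connected_UNIV)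
  moreover have "U = \<Union>((\<lambda>g. contraction g ` UNIV) ` U)"
  proof (intro equalityI subsetI)
    fix g assume g: "g \<in> U"
    have "contraction g 1 = g"
    proof (rule ent_eqI)
      fix p q
      have "w p - w q \<le> 0 \<Longrightarrow> ent g p q = ent (mat 1) p q" using g by (auto simp: U_def fil_def)
      then show "ent (contraction g 1) p q = ent g p q" by (simp add: contraction_def)
    qed
    then show "g \<in> \<Union>((\<lambda>g. contraction g ` UNIV) ` U)" using g by (metis UN_I range_eqI)
  qed (use contraction_in_U in auto)
  moreover have one: "mat 1 \<in> contraction g ` UNIV" for g
    using contraction_0[of g] by (metis range_eqI)
  have "\<Inter>((\<lambda>g. contraction g ` UNIV) ` U) \<noteq> {}" using one by blast
  ultimately show ?thesis
    using connectedin_Union[of "(\<lambda>g. contraction g ` UNIV) ` U" zariski] by fastforce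
qed

lemma U_subset_unipotent_radical: "U \<subseteq> unipotent_radical (parabolic G lam)"
proof -
  have "g ** n ** matrix_inv g \<in> U" if g: "g \<in> parabolic G lam" and n: "n \<in> U" for g n
  proof -
    have gG: "g \<in> G" using g by (simp add: parabolic_def)
    have nG: "n \<in> G" "n - mat 1 \<in> fil 1" using n by (auto simp: U_def)
    have inv: "invertible g" by (rule alg_group_invertible[OF G gG])
    have "g ** n ** matrix_inv g - mat 1 = g ** (n - mat 1) ** matrix_inv g"
      by (simp add: matrix_diff_ldistrib matrix_diff_rdistrib matrix_inv_both[OF inv])
    moreover have "g ** (n - mat 1) ** matrix_inv g \<in> fil 1"
      using fil_mult[OF fil_mult[OF parabolic_fil[OF g] nG(2)] matrix_inv_fil[OF parabolic_fil[OF g] inv]] by simp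
    ultimately show ?thesis using gG nG G by (simp add: U_def alg_group_mult alg_group_inv)
  qed
  moreover have "unipotent n" if "n \<in> U" for n
    using fil_1_nilpotent[of "n - mat 1"] that by (simp add: U_def nilpotent_def unipotent_def mpow_def)
  ultimately have "U \<in> {N. N \<subseteq> parabolic G lam \<and> alg_group N \<and> connectedin zariski N
     \<and> (\<forall>g\<in>parabolic G lam. \<forall>n\<in>N. g ** n ** matrix_inv g \<in> N) \<and> (\<forall>n\<in>N. unipotent n)}"
    using U_subset_parabolic alg_group_U connectedin_U by blast
  then show ?thesis unfolding unipotent_radical_def by blast
qed

lemma unipotent_exponential:
  assumes \<xi>: "\<xi> \<in> lie_alg G" "\<xi> \<in> fil j" "1 \<le> j"
  shows "\<exists>v\<in>U. v - mat 1 - \<xi> \<in> fil (j + 1)"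
proof -
  obtain K where K: "mpow \<xi> K = 0"
    using fil_1_nilpotent[OF fil_antimono[OF \<xi>(3,2)]] by (auto simp: nilpotent_def)
  \<comment> \<open>Two further terms, so that the terms of order 0 and 1 can be split off.\<close>
  define L where "L = Suc (Suc K)"
  have L: "mpow \<xi> L = 0" by (simp add: L_def mpow_Suc K)
  define v where "v = nilexp \<xi> L 1"
  have "v \<in> G" unfolding v_def using flow_in_group[OF G \<xi>(1) flow_nilpotent[OF L]] .
  have "v = mat 1 + \<xi> + (\<Sum>k<K. cscale (1 / fact (Suc (Suc k))) (mpow \<xi> (Suc (Suc k))))"
    unfolding v_def nilexp_def L_def sum.lessThan_Suc_shift by (simp add: mpow_Suc add.assoc)
  then have "v - mat 1 - \<xi> = (\<Sum>k<K. cscale (1 / fact (Suc (Suc k))) (mpow \<xi> (Suc (Suc k))))"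
    by (simp add: algebra_simps)
  also have "\<dots> \<in> fil (j + 1)"
  proof (intro cmat.subspace_sum[OF fil_subspace] cmat.subspace_scale[OF fil_subspace])
    fix k
    have "0 \<le> int k * j" using \<xi>(3) by simp
    moreover have "int (Suc (Suc k)) * j = j + j + int k * j" by (simp add: distrib_right)
    ultimately have "j + 1 \<le> int (Suc (Suc k)) * j" using \<xi>(3) by linarith
    then show "mpow \<xi> (Suc (Suc k)) \<in> fil (j + 1)" using mpow_fil[OF \<xi>(2)] fil_antimono by blast
  qed
  finally have r: "v - mat 1 - \<xi> \<in> fil (j + 1)" .
  have "v - mat 1 = (v - mat 1 - \<xi>) + \<xi>" by simp
  also have "\<dots> \<in> fil 1"
    using r \<xi>(2,3) by (intro cmat.subspace_add[OF fil_subspace]) (auto elim!: fil_antimono[rotated])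
  finally show ?thesis using r \<open>v \<in> G\<close> by (auto simp: U_def)
qed

text \<open>Comparing lowest components in \<open>u ** S = S\<^sub>0 ** u\<close>, for the intertwiner \<open>u\<close>, writes the component of
  degree \<open>j\<close> as a bracket \<open>[S\<^sub>0, Y]\<close> of matrices. As \<open>S\<^sub>0\<close> is semisimple, \<open>Y\<close> can be replaced by an
  element of \<open>lie_alg G\<close>.\<close>

lemma semisimple_lowest_part_is_bracket:
  assumes S: "S \<in> lie_alg G" "S \<in> fil 0" "semisimple S" "S - hcomp 0 S \<in> fil j" and j: "1 \<le> j"
  shows "\<exists>\<xi>\<in>lie_alg G. \<xi> \<in> fil j \<and> bracket (hcomp 0 S) \<xi> = hcomp j S"
proof -
  let ?S0 = "hcomp 0 S"
  obtain u where u: "u \<in> fil 0" "hcomp 0 u = mat 1" "u ** S = ?S0 ** u"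
    using intertwiner_exists[OF S(2,3)] by blast
  have "hcomp j S = hcomp (0 + j) (u ** (S - ?S0))"
    unfolding hcomp_mult[OF u(1) S(4)] using j by (simp add: u(2) hcomp_diff hcomp_hcomp)
  also have "\<dots> = hcomp j (bracket ?S0 u)" by (simp add: bracket_def matrix_diff_ldistrib u(3))
  finally have X: "hcomp j S = bracket ?S0 (hcomp j u)" by (simp only: hcomp_bracket_degree_0)
  obtain M where M: "finite M" "peval (root_poly M) S = 0" using semisimple_root_poly[OF S(3)] by blast
  then have "semisimple ?S0"
    using peval_fil[OF S(2), of "root_poly M"] by (intro semisimpleI_root_poly[OF M(1)]) simp
  then obtain R T :: "complex ^ 'n ^ 'n" and m where R: "T ** R = mat 1" "R ** T = mat 1" "?S0 = R ** diag m ** T"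
    by (rule semisimpleE)
  have "\<exists>\<xi>\<in>lie_alg G. bracket ?S0 \<xi> = bracket ?S0 (hcomp j u)"
    using lie_alg_hcomp[OF S(1), of 0] lie_alg_hcomp[OF S(1), of j] unfolding X unfolding R(3)
    by (intro ad_semisimple_preimage[OF G R(1,2)])
  then obtain \<xi> where \<xi>: "\<xi> \<in> lie_alg G" "bracket ?S0 \<xi> = hcomp j S" using X by auto
  have "bracket ?S0 (hcomp j \<xi>) = hcomp j S"
    unfolding hcomp_bracket_degree_0 [symmetric] \<xi>(2) by (simp add: hcomp_hcomp)
  then show ?thesis using lie_alg_hcomp[OF \<xi>(1)] hcomp_fil by blast
qed

text \<open>If \<open>[S\<^sub>0, \<xi>]\<close> is the lowest component of \<open>S - S\<^sub>0\<close>, conjugating \<open>S\<close> by \<open>exp \<xi>\<close> cancels this component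
  and changes only components of higher degree. Degrees are bounded, so this stops.\<close>

lemma conjugate_to_leading_part_aux:
  assumes "S \<in> lie_alg G" "S \<in> fil 0" "semisimple S" "S - hcomp 0 S \<in> fil j" "1 \<le> j"
    and J: "\<And>p q. \<bar>w p - w q\<bar> < int J" and "int J - j \<le> int n"
  shows "\<exists>u\<in>U. u ** S ** matrix_inv u = hcomp 0 S"
  using assms(1-5,7)
proof (induction n arbitrary: S j)
  case 0
  then have "S - hcomp 0 S = 0" by (intro fil_large_zero[OF J _ 0(4)]) simp
  moreover have "matrix_inv (mat 1) = (mat 1 :: complex ^ 'n ^ 'n)" by (rule matrix_inv_eqI) simp_all
  ultimately show ?case using alg_group_1[OF alg_group_U] by (intro bexI[of _ "mat 1"]) simp_all
next
  case (Suc n)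
  let ?S0 = "hcomp 0 S"
  obtain \<xi> where \<xi>: "\<xi> \<in> lie_alg G" "\<xi> \<in> fil j" "bracket ?S0 \<xi> = hcomp j S"
    using semisimple_lowest_part_is_bracket[OF Suc.prems(1-5)] by blast
  obtain v where v: "v \<in> U" "v - mat 1 - \<xi> \<in> fil (j + 1)"
    using unipotent_exponential[OF \<xi>(1,2) Suc.prems(5)] by blast
  have vG: "v \<in> G" "v - mat 1 \<in> fil 1" using v(1) by (auto simp: U_def)
  have inv: "invertible v" by (rule alg_group_invertible[OF G vG(1)])
  define r where "r = v - mat 1 - \<xi>"
  define S' where "S' = v ** S ** matrix_inv v"
  have v_eq: "v = mat 1 + \<xi> + r" by (simp add: r_def)
  have "(S' - ?S0) ** v = v ** S - ?S0 ** v"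
    unfolding S'_def by (simp add: matrix_diff_rdistrib matrix_mul_assoc [symmetric] matrix_inv_both[OF inv])
  also have "\<dots> = (v - mat 1) ** (S - ?S0) + ((S - ?S0) - (hcomp j S)) + (r ** ?S0 - ?S0 ** r)"
    unfolding \<xi>(3) [symmetric] bracket_def by (subst (1 2 3) v_eq) (simp add: matrix_ring)
  also have "\<dots> \<in> fil (j + 1)"
  proof (rule cmat.subspace_add[OF fil_subspace cmat.subspace_add[OF fil_subspace] cmat.subspace_diff[OF fil_subspace]])
    show "(v - mat 1) ** (S - ?S0) \<in> fil (j + 1)"
      using fil_mult[OF vG(2) Suc.prems(4)] by (simp add: add.commute)
    have "hcomp j S = hcomp j (S - ?S0)" using Suc.prems(5) by (simp add: hcomp_diff hcomp_hcomp)
    then show "(S - ?S0) - (hcomp j S) \<in> fil (j + 1)" using fil_diff_hcomp[OF Suc.prems(4)] by simp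
    have "r \<in> fil (j + 1)" "?S0 \<in> fil 0" using v(2) hcomp_fil by (auto simp: r_def)
    then show "r ** ?S0 \<in> fil (j + 1)" "?S0 ** r \<in> fil (j + 1)"
      using fil_mult[of r "j + 1" ?S0 0] fil_mult[of ?S0 0 r "j + 1"] by simp_all
  qed
  finally have "(S' - ?S0) ** v ** matrix_inv v \<in> fil (j + 1 + 0)"
    using matrix_inv_fil[OF fil_0_of_unipotent[OF vG(2)] inv] by (rule fil_mult)
  then have d: "S' - ?S0 \<in> fil (j + 1)"
    by (simp add: matrix_mul_assoc [symmetric] matrix_inv_both[OF inv])
  have "hcomp 0 (S' - ?S0) = 0" using d Suc.prems(5) by (intro hcomp_eq_0) auto
  then have S'0: "hcomp 0 S' = ?S0" by (simp add: hcomp_diff hcomp_hcomp)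
  have "S' - ?S0 + ?S0 \<in> fil 0"
    using Suc.prems(5) fil_antimono[OF _ d, of 0] by (intro cmat.subspace_add[OF fil_subspace] hcomp_fil) auto
  then have "S' \<in> fil 0" by simp
  moreover have "S' \<in> lie_alg G" unfolding S'_def by (rule lie_alg_Ad[OF G vG(1) Suc.prems(1)])
  moreover have "semisimple S'" unfolding S'_def
    by (rule semisimple_conj[OF Suc.prems(3) matrix_inv_both[OF inv]])
  ultimately obtain u where u: "u \<in> U" "u ** S' ** matrix_inv u = ?S0"
    using Suc.IH[of S' "j + 1"] d S'0 Suc.prems(5,6) by auto
  have "(u ** v) ** S ** matrix_inv (u ** v) = ?S0"
    using u(2) matrix_inv_mult[OF alg_group_invertible[OF alg_group_U u(1)] inv]
    by (simp add: S'_def matrix_mul_assoc)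
  then show ?case using alg_group_mult[OF alg_group_U u(1) v(1)] by blast
qed

lemma conjugate_to_leading_part:
  assumes "S \<in> lie_alg G" "S \<in> fil 0" "semisimple S"
  shows "\<exists>u\<in>U. u ** S ** matrix_inv u = hcomp 0 S"
proof -
  obtain J where J: "\<And>p q. \<bar>w p - w q\<bar> < int J" using weight_bound by blast
  have "S - hcomp 0 S \<in> fil 1" using fil_diff_hcomp[OF assms(2)] by simp
  then show ?thesis using conjugate_to_leading_part_aux[OF assms _ order_refl J, of "nat (int J - 1)"] by auto
qed

end

section \<open>The dichotomy\<close>

lemma semisimple_cscale: "semisimple A \<Longrightarrow> semisimple (cscale c A)"
proof -
  assume "semisimple A"
  then obtain P :: "complex ^ 'a ^ 'a" and m where P: "invertible P" "A = P ** diag m ** matrix_inv P"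
    unfolding semisimple_def by blast
  have "cscale c (diag m) = diag (\<lambda>i. c * m i)" by (simp add: vec_eq_iff diag_nth)
  then have "cscale c A = P ** diag (\<lambda>i. c * m i) ** matrix_inv P"
    unfolding P(2) by (metis cscale_mult_left cscale_mult_right)
  then show "semisimple (cscale c A)" unfolding semisimple_def using P(1) by blast
qed

context one_ps
begin

definition generator :: "complex ^ 'n ^ 'n" where
  "generator = P ** diag (\<lambda>p. a + of_int (w p)) ** Q"

lemma generator_semisimple: "semisimple generator"
  unfolding semisimple_def generator_def
  using matrix_inv_eqI[OF PQ QP] QP PQ unfolding invertible_def by metis

lemma bracket_generator_hcomp: "bracket generator (hcomp j A) = cscale (of_int j) (hcomp j A)"
proof (rule ent_eqI)
  fix p q
  have "ent (bracket generator (hcomp j A)) p q = (of_int (w p) - of_int (w q)) * ent (hcomp j A) p q"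
    unfolding ent_def generator_def conj_bracket_diag[OF QP PQ] by simp
  then show "ent (bracket generator (hcomp j A)) p q = ent (cscale (of_int j) (hcomp j A)) p q"
    by (auto simp flip: of_int_diff)
qed

text \<open>The leading terms of elements of \<open>K\<close>, together with 0 when \<open>j\<close> is below the leading degree. Allowing 0
  makes the set closed under brackets.\<close>

definition leading_parts :: "(complex ^ 'n ^ 'n) set \<Rightarrow> (complex ^ 'n ^ 'n) set" where
  "leading_parts K = {hcomp j A | j A. A \<in> K \<and> A \<in> fil j}"

lemma leading_span_eq:
  assumes "K \<subseteq> lie_alg G"
  shows "leading_span G lam K = cmat.span (leading_parts K)"
proof
  show "leading_span G lam K \<subseteq> cmat.span (leading_parts K)"
    unfolding leading_span_def
  proof (rule cmat.span_mono, rule subsetI)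
    fix X assume "X \<in> {B. \<exists>A\<in>K. A \<noteq> 0 \<and> leading_term G lam A B}"
    then obtain A where "A \<in> K" "leading_term G lam A X" by blast
    then show "X \<in> leading_parts K" using assms leading_term_iff[of A X] unfolding leading_parts_def by blast
  qed
  have "hcomp j A \<in> leading_span G lam K" if A: "A \<in> K" "A \<in> fil j" for j A
  proof (cases "hcomp j A = 0")
    case True
    then show ?thesis by (simp add: leading_span_def cmat.span_zero)
  next
    case False
    then have "leading_term G lam A (hcomp j A)" using leading_term_iff A assms by blast
    moreover have "A \<noteq> 0" using False by auto
    ultimately show ?thesis unfolding leading_span_def using A by (intro cmat.span_base) blast
  qed
  then show "cmat.span (leading_parts K) \<subseteq> leading_span G lam K"
    by (intro cmat.span_minimal) (auto simp: leading_parts_def leading_span_def)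
qed

lemma bracket_leading_parts:
  assumes K: "\<And>A B. A \<in> K \<Longrightarrow> B \<in> K \<Longrightarrow> bracket A B \<in> K"
    and "X \<in> leading_parts K" "Y \<in> leading_parts K"
  shows "bracket X Y \<in> leading_parts K"
proof -
  obtain i A j B where A: "A \<in> K" "A \<in> fil i" "X = hcomp i A" and B: "B \<in> K" "B \<in> fil j" "Y = hcomp j B"
    using assms(2,3) by (auto simp: leading_parts_def)
  have "bracket A B \<in> fil (i + j)"
    unfolding bracket_def using fil_mult[OF A(2) B(2)] fil_mult[OF B(2) A(2)]
    by (intro cmat.subspace_diff[OF fil_subspace]) (simp_all add: add.commute)
  moreover have "bracket X Y = hcomp (i + j) (bracket A B)"
    unfolding bracket_def hcomp_diff A(3) B(3) using hcomp_mult[OF A(2) B(2)] hcomp_mult[OF B(2) A(2)]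
    by (simp add: add.commute)
  ultimately show ?thesis using K[OF A(1) B(1)] by (auto simp: leading_parts_def)
qed

text \<open>In nonzero degree, matrices shift the weights. In degree 0, the semisimple Jordan part of \<open>A\<close> lies in
  \<open>lie_alg S\<close> and \<open>fil 0\<close>, so it is 0, and \<open>A\<close> is nilpotent together with its component of degree 0.\<close>

lemma leading_parts_nilpotent:
  assumes S: "alg_group S" "S \<subseteq> G"
    and none: "\<And>k. k \<in> lie_alg S \<Longrightarrow> k \<in> fil 0 \<Longrightarrow> semisimple k \<Longrightarrow> k = 0"
    and X: "X \<in> leading_parts (lie_alg S)"
  shows "nilpotent X"
proof -
  obtain j A where A: "A \<in> lie_alg S" "A \<in> fil j" "X = hcomp j A"
    using X by (auto simp: leading_parts_def)
  show ?thesis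
  proof (cases "j = 0")
    case True
    obtain s where s: "semisimple (peval s A)" "nilpotent (A - peval s A)" "peval s A \<in> lie_alg S"
      by (rule lie_alg_jordan[OF S(1) A(1)])
    have "peval s A \<in> fil 0" using peval_fil A(2) True by blast
    then have "peval s A = 0" using none s by blast
    then have "nilpotent A" using s(2) by simp
    then show ?thesis using hcomp_nilpotent_part A True by blast
  qed (simp add: A(3) hcomp_nilpotent)
qed

text \<open>\<open>Khat\<close> consists of nilpotent matrices and contains all brackets of \<open>K'\<close>. For elements \<open>x \<noteq> 0\<close> and \<open>y\<close> of a torus, a
  combination \<open>y - \<gamma> x\<close> has no component along the generator; being nilpotent and semisimple, it is 0.\<close>

lemma rank_one_alternative:
  assumes S: "alg_group S" "S \<subseteq> G"
    and H: "cmat.subspace H" "generator \<in> H"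
    and lead: "\<And>j A. A \<in> lie_alg S \<Longrightarrow> A \<in> fil j \<Longrightarrow> hcomp j A \<in> H"
    and none: "\<And>k. k \<in> lie_alg S \<Longrightarrow> k \<in> fil 0 \<Longrightarrow> semisimple k \<Longrightarrow> k = 0"
    and nz: "generator \<noteq> 0"
    and Khat_def: "Khat = leading_span G lam (lie_alg S)"
    and K'_def: "K' = {A + B | A B. A \<in> Khat \<and> B \<in> cmat.span {generator}}"
  shows "Khat \<inter> cmat.span {generator} = {0} \<and> K' \<subseteq> H \<and> lie_subalgebra K' \<and> has_rank K' 1"
proof -
  let ?K = "lie_alg S"
  let ?W = "leading_parts ?K"
  have Khat: "Khat = cmat.span ?W"
    unfolding Khat_def by (rule leading_span_eq[OF lie_alg_mono[OF S(2)]])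
  have Wbr: "bracket A B \<in> ?W" if "A \<in> ?W" "B \<in> ?W" for A B
    using bracket_leading_parts[OF lie_alg_bracket[OF S(1)] that] .
  have "acts_nilpotently Khat"
    unfolding Khat by (rule weakly_closed_acts_nilpotently[OF Wbr leading_parts_nilpotent[OF S none]])
  then have Khat_nil: "nilpotent A" if "A \<in> Khat" for A
    using that by (rule acts_nilpotently_nilpotent)
  have Khat_ss: "A = 0" if "A \<in> Khat" "semisimple A" for A
    using Khat_nil[OF that(1)] that(2) semisimple_nilpotent_zero by blast
  have Khat_sub: "cmat.subspace Khat" unfolding Khat by (rule cmat.subspace_span)
  have line: "cmat.span {generator} = range (\<lambda>c. cscale c generator)" by (rule cmat.span_singleton)
  have K': "K' = {A + cscale c generator | A c. A \<in> Khat}"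
    unfolding K'_def line by blast
  have inter: "Khat \<inter> cmat.span {generator} = {0}"
  proof -
    have "cscale c generator = 0" if "cscale c generator \<in> Khat" for c
      using Khat_ss[OF that semisimple_cscale[OF generator_semisimple]] .
    then show ?thesis using cmat.subspace_0[OF Khat_sub] cmat.span_zero unfolding line by auto
  qed
  have "?W \<subseteq> H" using lead by (auto simp: leading_parts_def)
  then have "Khat \<subseteq> H" unfolding Khat by (rule cmat.span_minimal[OF _ H(1)])
  then have K'H: "K' \<subseteq> H"
    unfolding K' using cmat.subspace_add[OF H(1)] cmat.subspace_scale[OF H(1) H(2)] by blast
  have K'sub: "cmat.subspace K'"
    unfolding K'_def by (rule cmat.subspace_sums[OF Khat_sub cmat.subspace_span])
  have br1: "bracket A B \<in> Khat" if "A \<in> Khat" "B \<in> Khat" for A B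
    unfolding Khat by (rule bracket_span_subset[OF cmat.span_base[OF Wbr] that[unfolded Khat]])
  have br2: "bracket generator B \<in> Khat" if "B \<in> Khat" for B
  proof -
    have "bracket A B \<in> cmat.span ?W" if A: "A \<in> {generator}" and B: "B \<in> ?W" for A B
    proof -
      obtain j C where "B = hcomp j C" using B by (auto simp: leading_parts_def)
      then have "bracket A B = cscale (of_int j) B" using A bracket_generator_hcomp by simp
      then show ?thesis using cmat.span_scale[OF cmat.span_base[OF B]] by simp
    qed
    moreover have "generator \<in> cmat.span {generator}" by (rule cmat.span_base) simp
    ultimately show ?thesis using that unfolding Khat by (rule bracket_span_subset)
  qed
  have "lie_subalgebra K'"
    unfolding lie_subalgebra_def
  proof (intro conjI K'sub ballI)
    fix X Y assume "X \<in> K'" "Y \<in> K'"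
    then obtain A b B c where X: "A \<in> Khat" "X = A + cscale b generator"
      and Y: "B \<in> Khat" "Y = B + cscale c generator" unfolding K' by blast
    have "bracket X Y = bracket A B + (cscale b (bracket generator B) + cscale (- c) (bracket generator A))"
      unfolding X Y by (simp add: bracket_simps bracket_swap[of A generator] add.assoc)
    also have "\<dots> \<in> Khat"
      by (intro cmat.subspace_add[OF Khat_sub] cmat.subspace_scale[OF Khat_sub] br1 br2 X Y)
    finally have "bracket X Y + cscale 0 generator \<in> K'" unfolding K' by blast
    then show "bracket X Y \<in> K'" by simp
  qed
  moreover have "has_rank K' 1"
    unfolding has_rank_def
  proof (intro allI impI)
    fix T assume T: "maximal_torus_in K' T"
    then have TK': "T \<subseteq> K'" and Tsub: "cmat.subspace T" and Tss: "\<And>A. A \<in> T \<Longrightarrow> semisimple A"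
      and max: "\<And>T'. torus_in K' T' \<Longrightarrow> T \<subseteq> T' \<Longrightarrow> T' = T"
      by (auto simp: maximal_torus_in_def torus_in_def lie_subalgebra_def)
    have "torus_in K' (cmat.span {generator})"
      unfolding torus_in_def lie_subalgebra_def
    proof (intro conjI ballI cmat.subspace_span)
      show "cmat.span {generator} \<subseteq> K'"
        using cmat.subspace_0[OF Khat_sub] unfolding line K' by force
      fix A B assume "A \<in> cmat.span {generator}" "B \<in> cmat.span {generator}"
      then show "bracket A B = 0" "bracket A B \<in> cmat.span {generator}"
        unfolding line by (auto simp: bracket_simps)
    next
      fix A assume "A \<in> cmat.span {generator}"
      then show "semisimple A" unfolding line using semisimple_cscale[OF generator_semisimple] by auto
    qed
    moreover have "generator \<in> cmat.span {generator}" by (rule cmat.span_base) simp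
    ultimately have "\<not> T \<subseteq> {0}"
      using max[of "cmat.span {generator}"] nz cmat.span_zero[of "{generator}"] by auto
    then obtain x where x: "x \<in> T" "x \<noteq> 0" by blast
    obtain A b where xA: "A \<in> Khat" "x = A + cscale b generator" using x(1) TK' unfolding K' by blast
    have "b \<noteq> 0"
    proof
      assume "b = 0"
      then have "x \<in> Khat" using xA by simp
      then show False using Khat_ss Tss x by blast
    qed
    have "T \<subseteq> cmat.span {x}"
    proof
      fix y assume y: "y \<in> T"
      then obtain B c where yB: "B \<in> Khat" "y = B + cscale c generator" using TK' unfolding K' by blast
      have "y - cscale (c / b) x = B - cscale (c / b) A"
        unfolding xA(2) yB(2) using \<open>b \<noteq> 0\<close> by (simp add: cmat.scale_right_distrib)
      moreover have "B - cscale (c / b) A \<in> Khat"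
        by (intro cmat.subspace_diff[OF Khat_sub] cmat.subspace_scale[OF Khat_sub] xA(1) yB(1))
      moreover have "y - cscale (c / b) x \<in> T"
        by (intro cmat.subspace_diff[OF Tsub] cmat.subspace_scale[OF Tsub] x(1) y)
      ultimately have "y - cscale (c / b) x = 0" using Khat_ss Tss by metis
      then have "y = cscale (c / b) x" by simp
      then show "y \<in> cmat.span {x}" by (simp add: cmat.span_base cmat.span_scale)
    qed
    moreover have "cmat.span {x} \<subseteq> T" using x(1) by (intro cmat.span_minimal Tsub) simp
    ultimately have "T = cmat.span {x}" by blast
    then have "cmat.dim T = card {x}"
      using x(2) by (intro cmat.dim_eq_card) (simp_all add: cmat.span_span)
    then show "cmat.dim T = 1" by simp
  qed
  ultimately show ?thesis using inter K'H by blast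
qed

end

text \<open>The twisted group is \<open>exp (s l)\<close>, and untwisting it gives a function of \<open>exp s\<close>, with period
  \<open>2 \<pi> \<i>\<close>. Hence the eigenvalues of \<open>l\<close> differ from \<open>a\<close> by integers, which are the weights.\<close>

lemma one_ps_of_semisimple_generator:
  fixes G :: "(complex ^ 'n ^ 'n) set"
  assumes G: "alg_group G" and scalars: "\<And>t. t \<noteq> 0 \<Longrightarrow> mat t \<in> G"
    and lam: "one_param_subgroup G lam" and l: "semisimple_generator l (central_twist a lam)"
  obtains P Q w where "one_ps P Q w G lam (of_rat a)"
    "l = P ** diag (\<lambda>p. of_rat a + of_int (w p)) ** Q"
    "\<forall>s. central_twist a lam s = P ** diag (\<lambda>p. exp (s * (of_rat a + of_int (w p)))) ** Q"
    "\<forall>s. central_twist a lam s \<in> G"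
proof -
  obtain P :: "complex ^ 'n ^ 'n" and m where P: "invertible P" and lP: "l = P ** diag m ** matrix_inv P"
    and F: "\<And>s. central_twist a lam s = P ** diag (\<lambda>i. exp (s * m i)) ** matrix_inv P"
    using l unfolding semisimple_generator_def by blast
  define Q where "Q = matrix_inv P"
  have QP: "Q ** P = mat 1" and PQ: "P ** Q = mat 1" using matrix_inv_both[OF P] by (simp_all add: Q_def)
  have F': "central_twist a lam s = P ** diag (\<lambda>i. exp (s * m i)) ** Q" for s by (simp add: F Q_def)
  have flow: "flow (central_twist a lam) (P ** diag m ** Q)"
    using flow_semisimple[OF QP PQ, of m] F' by presburger
  have lam1: "lam 1 = mat 1" using flow_0[OF flow] by (simp add: central_twist_def cscale_def)
  have "\<exists>n :: int. m i = of_rat a + of_int n" for i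
  proof -
    \<comment> \<open>At \<open>s = \<tau>\<close> the untwisted group returns to the identity.\<close>
    define \<tau> where "\<tau> = 2 * of_real pi * \<i>"
    have "central_twist a lam \<tau> = cscale (exp (of_rat a * \<tau>)) (mat 1)"
      by (simp add: central_twist_def \<tau>_def exp_two_pi_i lam1)
    then have "Q ** (P ** diag (\<lambda>i. exp (\<tau> * m i)) ** Q) ** P = cscale (exp (of_rat a * \<tau>)) (mat 1)"
      unfolding F' by (simp add: cscale_mult_left cscale_mult_right QP)
    then have "diag (\<lambda>i. exp (\<tau> * m i)) $ i $ i = cscale (exp (of_rat a * \<tau>)) (mat 1) $ i $ i"
      unfolding conj_cancel(1)[OF QP PQ] by simp
    then have "exp (\<tau> * m i) = exp (of_rat a * \<tau>)" by (simp add: diag_nth mat_def)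
    then have "exp (\<tau> * (m i - of_rat a)) = 1" by (simp add: right_diff_distrib exp_diff mult.commute)
    then obtain n :: int where n: "Re (\<tau> * (m i - of_rat a)) = 0"
      "Im (\<tau> * (m i - of_rat a)) = of_int (2 * n) * pi" unfolding exp_eq_1 by blast
    then have "m i - of_rat a = of_int n" by (simp add: \<tau>_def complex_eq_iff)
    then have "m i = of_rat a + of_int n" by (simp add: algebra_simps)
    then show ?thesis ..
  qed
  then obtain w :: "'n \<Rightarrow> int" where w: "\<And>i. m i = of_rat a + of_int (w i)" by metis
  have m: "m = (\<lambda>p. of_rat a + of_int (w p))" using w by blast
  have lam_in: "lam t \<in> G" if "t \<noteq> 0" for t using lam that by (simp add: one_param_subgroup_def)
  have twist_in: "central_twist a lam s \<in> G" for s
  proof -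
    have "central_twist a lam s = mat (exp (of_rat a * s)) ** lam (exp s)"
      by (simp add: central_twist_def mat_eq_cscale [of "exp (of_rat a * s)"] cscale_mult_left)
    then show ?thesis using alg_group_mult[OF G scalars lam_in] by simp
  qed
  have "one_ps P Q w G lam (of_rat a)"
  proof
    show "Q ** P = mat 1" "P ** Q = mat 1" by fact+
    show "alg_group G" by fact
    show "lam t \<in> G" if "t \<noteq> 0" for t using lam_in that .
    show "lam t = P ** diag (\<lambda>p. t powi w p) ** Q" if t: "t \<noteq> 0" for t
    proof -
      define s where "s = Ln t"
      have s: "exp s = t" using t by (simp add: s_def)
      have "lam t = cscale (exp (- (of_rat a * s))) (central_twist a lam s)"
        by (simp add: central_twist_def s exp_minus)
      also have "\<dots> = P ** cscale (exp (- (of_rat a * s))) (diag (\<lambda>i. exp (s * m i))) ** Q"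
        unfolding F' by (simp add: cscale_mult_left cscale_mult_right)
      also have "cscale (exp (- (of_rat a * s))) (diag (\<lambda>i. exp (s * m i))) = diag (\<lambda>i. t powi w i)"
        by (auto simp: vec_eq_iff diag_nth m s [symmetric] exp_power_int exp_add [symmetric] algebra_simps)
      finally show ?thesis .
    qed
    have "P ** diag m ** Q \<in> lie_alg G"
      using twist_in by (intro lie_algI_curve[OF flow_mderiv_0[OF flow] flow_0[OF flow]])
    then show "P ** diag (\<lambda>p. of_rat a + of_int (w p)) ** Q \<in> lie_alg G" by (simp add: m)
  qed
  then show ?thesis using that[of P Q w] twist_in F' lP by (simp add: m Q_def)
qed

lemma exp_decay:
  assumes "0 < (k :: int)"
  shows "((\<lambda>x :: real. exp (of_int k * (s + of_real x)) :: complex) \<longlongrightarrow> 0) at_bot"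
proof (rule tendsto_norm_zero_cancel)
  have "((\<lambda>x :: real. exp (of_int k * Re s) * exp (of_int k * x)) \<longlongrightarrow> exp (of_int k * Re s) * 0) at_bot"
    using assms by (intro tendsto_mult tendsto_const filterlim_compose[OF exp_at_bot]
      filterlim_tendsto_pos_mult_at_bot[OF tendsto_const] filterlim_ident) simp
  moreover have "norm (exp (of_int k * (s + of_real x)) :: complex) = exp (of_int k * Re s) * exp (of_int k * x)" for x
    by (simp add: norm_exp_eq_Re flip: exp_add) (simp add: distrib_left)
  ultimately show "((\<lambda>x :: real. norm (exp (of_int k * (s + of_real x)) :: complex)) \<longlongrightarrow> 0) at_bot"
    by simp
qed

lemma tendsto_mult_vector:
  assumes "(v \<longlongrightarrow> v') F"
  shows "((\<lambda>x. (A :: complex ^ 'm ^ 'm) *v v x) \<longlongrightarrow> A *v v') F"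
  unfolding matrix_vector_mult_def using assms
  by (intro vec_tendstoI) (simp, intro tendsto_sum tendsto_mult tendsto_const tendsto_vec_nth)

lemma lie_alg_stab_conj:
  assumes G: "alg_group G" and \<rho>: "rational_module G \<rho>" and g: "g \<in> G" and A: "A \<in> lie_alg (stab G \<rho> v)"
  shows "g ** A ** matrix_inv g \<in> lie_alg (stab G \<rho> (\<rho> g *v v))"
proof -
  obtain E where E: "flow E A" using flow_exists by blast
  have inv: "invertible g" by (rule alg_group_invertible[OF G g])
  show ?thesis
  proof (rule lie_algI_curve[of "\<lambda>t. g ** E t ** matrix_inv g"])
    show "mderiv (\<lambda>t. g ** E t ** matrix_inv g) (g ** A ** matrix_inv g) 0"
      using flow_mderiv_0[OF E] by (rule mderiv_conj)
    show "g ** E 0 ** matrix_inv g = mat 1" by (simp add: flow_0[OF E] matrix_inv_both[OF inv])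
    fix t
    have Et: "E t \<in> G" "\<rho> (E t) *v v = v"
      using flow_in_group[OF alg_group_stab[OF G \<rho>] A E, of t] by (auto simp: stab_def)
    have gE: "g ** E t ** matrix_inv g \<in> G" using g Et(1) G by (simp add: alg_group_mult alg_group_inv)
    have "\<rho> (g ** E t ** matrix_inv g) *v (\<rho> g *v v) = \<rho> (g ** E t ** matrix_inv g ** g) *v v"
      using rational_module_mult[OF \<rho> gE g] by (simp add: matrix_vector_mul_assoc)
    also have "g ** E t ** matrix_inv g ** g = g ** E t"
      by (simp add: matrix_mul_assoc [symmetric] matrix_inv_both[OF inv])
    also have "\<rho> (g ** E t) *v v = \<rho> g *v v"
      using rational_module_mult[OF \<rho> g Et(1)] Et(2) by (simp add: matrix_vector_mul_assoc [symmetric])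
    finally show "g ** E t ** matrix_inv g \<in> stab G \<rho> (\<rho> g *v v)" using gE by (simp add: stab_def)
  qed
qed

text \<open>The conjugate of \<open>k\<close> by \<open>E x\<close> annihilates \<open>\<rho> (E x) *v y\<close>. As \<open>x\<close> tends to minus infinity, this vector
  tends to \<open>z\<close>, and \<open>exp (- j x)\<close> times the conjugate tends to the component of degree \<open>j\<close>.\<close>

lemma (in one_ps) leading_part_stabilizes_limit:
  fixes \<rho> :: "complex ^ 'n ^ 'n \<Rightarrow> complex ^ 'm ^ 'm"
  assumes \<rho>: "rational_module G \<rho>"
    and E: "\<And>s. E s = P ** diag (\<lambda>p. exp (s * (a + of_int (w p)))) ** Q" and EG: "\<And>s. E s \<in> G"
    and lim: "((\<lambda>x :: real. \<rho> (E (of_real x)) *v y) \<longlongrightarrow> z) at_bot"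
    and k: "k \<in> lie_alg (stab G \<rho> y)" "k \<in> fil j"
  shows "hcomp j k \<in> lie_alg (stab G \<rho> z)"
proof -
  have flow: "flow E generator"
    using flow_semisimple[OF QP PQ, of "\<lambda>p. a + of_int (w p)"] E unfolding generator_def by presburger
  have kG: "k \<in> lie_alg G" using k(1) lie_alg_mono[of "stab G \<rho> y" G] by (auto simp: stab_def)
  define B where "B x = cscale (exp (- of_int j * of_real x)) (E (of_real x) ** k ** matrix_inv (E (of_real x)))"
    for x :: real
  obtain c :: "'m \<Rightarrow> 'm \<Rightarrow> 'n \<Rightarrow> 'n \<Rightarrow> complex"
    where c: "\<forall>A\<in>lie_alg G. \<forall>p q. diff_rep G \<rho> A $ p $ q = contract (c p q) A"
    by (rule diff_rep_derivative[OF G \<rho>])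
  have Bent: "B x = mk (\<lambda>p q. exp (of_int (w p - w q - j) * of_real x) * ent k p q)" for x
  proof (rule ent_eqI)
    fix p q
    have "ent (E (of_real x) ** k ** matrix_inv (E (of_real x))) p q
      = exp (of_real x * ((a + of_int (w p)) - (a + of_int (w q)))) * ent k p q"
      unfolding flow_matrix_inv[OF flow] unfolding E ent_def by (rule conj_exp_entry[OF QP PQ])
    then show "ent (B x) p q = ent (mk (\<lambda>p q. exp (of_int (w p - w q - j) * of_real x) * ent k p q)) p q"
      by (simp add: B_def exp_add [symmetric] mult.assoc [symmetric]) (simp add: algebra_simps)
  qed
  have Blim: "(B \<longlongrightarrow> hcomp j k) at_bot"
    unfolding Bent hcomp_def
  proof (rule tendsto_mk)
    fix p q
    show "((\<lambda>x :: real. exp (of_int (w p - w q - j) * of_real x) * ent k p q)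
        \<longlongrightarrow> (if w p - w q = j then ent k p q else 0)) at_bot"
    proof (cases "w p - w q \<le> j")
      case True
      then show ?thesis using k(2) by (cases "w p - w q = j") (auto simp: fil_def)
    next
      case False
      then have "((\<lambda>x :: real. exp (of_int (w p - w q - j) * (0 + of_real x)) * ent k p q) \<longlongrightarrow> 0 * ent k p q) at_bot"
        by (intro tendsto_mult tendsto_const exp_decay) simp
      then show ?thesis using False by simp
    qed
  qed
  have zero: "(\<Sum>q\<in>UNIV. contract (c p q) (B x) * (\<rho> (E (of_real x)) *v y) $ q) = 0" for p x
  proof -
    have "B x \<in> lie_alg (stab G \<rho> (\<rho> (E (of_real x)) *v y))"
      unfolding B_def by (intro cmat.subspace_scale[OF lie_alg_subspace] lie_alg_stab_conj[OF G \<rho> EG k(1)])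
    then have "B x \<in> lie_stabilizer G \<rho> (\<rho> (E (of_real x)) *v y)"
      by (simp add: lie_stabilizer_eq_lie_alg_stab[OF G \<rho>])
    then have *: "B x \<in> lie_alg G" "diff_rep G \<rho> (B x) *v (\<rho> (E (of_real x)) *v y) = 0"
      by (auto simp: lie_stabilizer_def)
    have "(diff_rep G \<rho> (B x) *v (\<rho> (E (of_real x)) *v y)) $ p = 0" using *(2) by simp
    then show ?thesis using c *(1) by (simp add: matrix_vector_mult_def)
  qed
  have hG: "hcomp j k \<in> lie_alg G" by (rule lie_alg_hcomp[OF kG])
  have "(diff_rep G \<rho> (hcomp j k) *v z) $ p = 0" for p
  proof -
    have "((\<lambda>x. \<Sum>q\<in>UNIV. contract (c p q) (B x) * (\<rho> (E (of_real x)) *v y) $ q)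
        \<longlongrightarrow> (\<Sum>q\<in>UNIV. contract (c p q) (hcomp j k) * z $ q)) at_bot"
      unfolding contract_def
      by (intro tendsto_sum tendsto_mult tendsto_const tendsto_vec_nth Blim lim)
    then have "(\<Sum>q\<in>UNIV. contract (c p q) (hcomp j k) * z $ q) = 0"
      unfolding zero by (simp add: tendsto_const_iff)
    then show ?thesis using c hG by (simp add: matrix_vector_mult_def)
  qed
  then have "hcomp j k \<in> lie_stabilizer G \<rho> z" using hG by (simp add: lie_stabilizer_def vec_eq_iff)
  then show ?thesis by (simp add: lie_stabilizer_eq_lie_alg_stab[OF G \<rho>])
qed

theorem theorem1p2:
  fixes G :: "(complex ^ 'n ^ 'n) set"
    and \<rho> :: "complex ^ 'n ^ 'n \<Rightarrow> complex ^ 'm ^ 'm"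
    and c d e D :: int
    and lam :: "complex \<Rightarrow> complex ^ 'n ^ 'n"
    and y z :: "complex ^ 'm" and yc :: "int \<Rightarrow> complex ^ 'm"
    and a :: rat and l :: "complex ^ 'n ^ 'n"
  assumes "reductive G"
    and "\<And>t. t \<noteq> 0 \<Longrightarrow> mat t \<in> G"
    and "rational_module G \<rho>"
    and "c \<noteq> 0" and "\<And>t. t \<noteq> 0 \<Longrightarrow> \<rho> (mat t) = mat (t powi c)"
    and "one_param_subgroup G lam"
    and "d < e" and "e \<le> D" and "z \<noteq> 0" and "yc e \<noteq> 0"
    and "\<And>t. t \<noteq> 0 \<Longrightarrow> \<rho> (lam t) *v y = t powi d *s z + (\<Sum>i=e..D. t powi i *s yc i)"
    and "\<And>s. \<rho> (central_twist a lam s) *v y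
               = z + (\<Sum>i=e..D. exp (of_int (i - d) * s) *s yc i)"
    and "semisimple_generator l (central_twist a lam)"
  shows "let K = lie_stabilizer G \<rho> y;
             H = lie_stabilizer G \<rho> z;
             Khat = leading_span G lam K;
             K' = {A + B | A B. A \<in> Khat \<and> B \<in> cmat.span {l}}
         in (Khat \<inter> cmat.span {l} = {0} \<and> K' \<subseteq> H \<and> lie_subalgebra K' \<and> has_rank K' 1)
          \<or> (\<exists>k\<in>K. k \<noteq> 0 \<and> semisimple k \<and>
               (\<exists>u\<in>unipotent_radical (parabolic G lam). u ** k ** matrix_inv u \<in> H))"
proof -
  have G: "alg_group G" using assms(1) by (simp add: reductive_def)
  note \<rho> = assms(3)
  obtain P Q w where ps: "one_ps P Q w G lam (of_rat a)"
    and l: "l = P ** diag (\<lambda>p. of_rat a + of_int (w p)) ** Q"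
    and E0: "\<forall>s. central_twist a lam s = P ** diag (\<lambda>p. exp (s * (of_rat a + of_int (w p)))) ** Q"
    and EG0: "\<forall>s. central_twist a lam s \<in> G"
    by (rule one_ps_of_semisimple_generator[OF G assms(2,6,13)])
  interpret one_ps P Q w G lam "of_rat a" by (rule ps)
  define E where "E = central_twist a lam"
  have E: "E s = P ** diag (\<lambda>p. exp (s * (of_rat a + of_int (w p)))) ** Q" and EG: "E s \<in> G" for s
    using E0 EG0 by (auto simp: E_def)
  have gen: "generator = l" by (simp add: generator_def l)
  have flow: "flow E l"
    using flow_semisimple[OF QP PQ, of "\<lambda>p. of_rat a + of_int (w p)"] E unfolding l by presburger
  have orbit: "\<rho> (E s) *v y = z + (\<Sum>i=e..D. exp (of_int (i - d) * s) *s yc i)" for s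
    unfolding E_def by (rule assms(12))
  \<comment> \<open>The sum consists of decaying exponentials because \<open>e > d\<close>.\<close>
  have shifted_lim: "((\<lambda>x :: real. \<rho> (E (s + of_real x)) *v y) \<longlongrightarrow> z) at_bot" for s
  proof (rule vec_tendstoI)
    fix r
    have "((\<lambda>x :: real. z $ r + (\<Sum>i=e..D. exp (of_int (i - d) * (s + of_real x)) * yc i $ r))
        \<longlongrightarrow> z $ r + (\<Sum>i=e..D. 0 * yc i $ r)) at_bot"
      by (intro tendsto_add tendsto_const tendsto_sum tendsto_mult exp_decay) (use assms(7) in auto)
    then show "((\<lambda>x :: real. (\<rho> (E (s + of_real x)) *v y) $ r) \<longlongrightarrow> z $ r) at_bot"
      unfolding orbit by (simp add: sum_component)
  qed
  have lim: "((\<lambda>x :: real. \<rho> (E (of_real x)) *v y) \<longlongrightarrow> z) at_bot"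
    using shifted_lim[of 0] by simp
  \<comment> \<open>The limit point of the orbit is fixed by the group that moves along it.\<close>
  have Ez: "\<rho> (E s) *v z = z" for s
  proof -
    have "((\<lambda>x :: real. \<rho> (E s) *v (\<rho> (E (of_real x)) *v y)) \<longlongrightarrow> \<rho> (E s) *v z) at_bot"
      by (rule tendsto_mult_vector[OF lim])
    moreover have "\<rho> (E s) *v (\<rho> (E (of_real x)) *v y) = \<rho> (E (s + of_real x)) *v y" for x :: real
      by (simp add: flow_add[OF flow] rational_module_mult[OF \<rho> EG EG] matrix_vector_mul_assoc)
    ultimately have "((\<lambda>x :: real. \<rho> (E (s + of_real x)) *v y) \<longlongrightarrow> \<rho> (E s) *v z) at_bot" by simp
    then show ?thesis using shifted_lim[of s] by (rule tendsto_unique[rotated]) simp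
  qed
  have lH: "generator \<in> lie_alg (stab G \<rho> z)"
    unfolding gen using Ez EG
    by (intro lie_algI_curve[OF flow_mderiv_0[OF flow] flow_0[OF flow]]) (simp add: stab_def)
  \<comment> \<open>Otherwise the orbit map would be constant, and the exponentials in it would have coefficients 0.\<close>
  have nz: "generator \<noteq> 0"
  proof
    assume "generator = 0"
    then have "mderiv E 0 t" for t using flow_mderiv[OF flow, of t] by (simp add: gen)
    then have const: "E s = E 0" for s by (rule mderiv_zero_const)
    have "((\<lambda>x :: real. \<rho> (E 0) *v y) \<longlongrightarrow> z) at_bot" using lim by (simp only: const [of "of_real x" for x])
    then have "\<rho> (E 0) *v y = z" by (simp add: tendsto_const_iff)
    then have "\<rho> (E s) *v y = z" for s by (simp only: const [of s])
    then have sum0: "(\<Sum>i=e..D. exp (of_int (i - d) * s) *s yc i) = 0" for s using orbit[of s] by simp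
    have "yc e $ r = 0" for r
    proof -
      \<comment> \<open>The exponents \<open>i - d\<close> index the sum, as the independence of exponentials is stated for sums over exponents.\<close>
      define M where "M = (\<lambda>i :: int. of_int (i - d) :: complex) ` {e..D}"
      have inj: "inj_on (\<lambda>i :: int. of_int (i - d) :: complex) {e..D}" by (auto simp: inj_on_def)
      define f where "f \<mu> = yc (the_inv_into {e..D} (\<lambda>i :: int. of_int (i - d) :: complex) \<mu>) $ r" for \<mu>
      have f: "f (of_int (i - d)) = yc i $ r" if "i \<in> {e..D}" for i
        unfolding f_def using the_inv_into_f_f[OF inj that] by simp
      have "f (of_int (e - d)) = 0"
      proof (rule exp_sum_independent[of M f])
        show "finite M" by (simp add: M_def)
        show "of_int (e - d) \<in> M" unfolding M_def using assms(8) by auto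
        fix t
        have "(\<Sum>\<mu>\<in>M. exp (t * \<mu>) * f \<mu>) = (\<Sum>i=e..D. exp (of_int (i - d) * t) * yc i $ r)"
          unfolding M_def sum.reindex[OF inj] by (intro sum.cong refl) (simp only: o_def f mult.commute)
        also have "\<dots> = (\<Sum>i=e..D. exp (of_int (i - d) * t) *s yc i) $ r" by (simp add: sum_component)
        finally show "(\<Sum>\<mu>\<in>M. exp (t * \<mu>) * f \<mu>) = 0" unfolding sum0 by simp
      qed
      then show ?thesis using f[of e] assms(8) by simp
    qed
    then show False using assms(10) by (simp add: vec_eq_iff)
  qed
  have lead: "hcomp j k \<in> lie_alg (stab G \<rho> z)" if "k \<in> lie_alg (stab G \<rho> y)" "k \<in> fil j" for j k
    by (rule leading_part_stabilizes_limit[OF \<rho> E EG lim that])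
  have S: "alg_group (stab G \<rho> y)" "stab G \<rho> y \<subseteq> G"
    using alg_group_stab[OF G \<rho>] by (auto simp: stab_def)
  let ?Khat = "leading_span G lam (lie_alg (stab G \<rho> y))"
  let ?K' = "{A + B | A B. A \<in> ?Khat \<and> B \<in> cmat.span {generator}}"
  have "(?Khat \<inter> cmat.span {generator} = {0} \<and> ?K' \<subseteq> lie_alg (stab G \<rho> z) \<and> lie_subalgebra ?K' \<and> has_rank ?K' 1)
    \<or> (\<exists>k\<in>lie_alg (stab G \<rho> y). k \<noteq> 0 \<and> semisimple k \<and>
               (\<exists>u\<in>unipotent_radical (parabolic G lam). u ** k ** matrix_inv u \<in> lie_alg (stab G \<rho> z)))"
  proof (cases "\<exists>k\<in>lie_alg (stab G \<rho> y). k \<in> fil 0 \<and> semisimple k \<and> k \<noteq> 0")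
    case True
    then obtain k where k: "k \<in> lie_alg (stab G \<rho> y)" "k \<in> fil 0" "semisimple k" "k \<noteq> 0" by blast
    have "k \<in> lie_alg G" using k(1) lie_alg_mono[OF S(2)] by blast
    then obtain u where "u \<in> U" "u ** k ** matrix_inv u = hcomp 0 k"
      using conjugate_to_leading_part k(2,3) by blast
    then show ?thesis using k lead[OF k(1,2)] U_subset_unipotent_radical by force
  next
    case False
    then show ?thesis
      using rank_one_alternative[OF S lie_alg_subspace lH lead _ nz refl refl] by blast
  qed
  then show ?thesis
    by (simp add: Let_def lie_stabilizer_eq_lie_alg_stab[OF G \<rho>] gen)
qed

end
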